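(* For every $t\ge 0$ and every $u_0\in C^\infty_b(\mathbb{R})$, $$T^tu_0 - X^t Y^t u_0 = - \int_0^t \int_0^s \mathcal{D} T^{t-s} (X^s Y^s u_0)\, X^{s-r}\Bigl[ f''(X^r Y^s u_0) \left( \partial_x X^r Y^s u_0 \right)^2\Bigr] \, dr\, ds,$$ and $$\begin{aligned} T^tu_0 - Y^t X^t u_0 = \int_0^t \int_0^s & \mathcal{D} T^{t-s} (Y^s X^s u_0) \biggl[ \exp\left(\int_0^{s-r} f'(Y^{\sigma+r} X^s u_0)\, d\sigma \right) \\ & \times f''(Y^r X^s u_0 ) \exp\left(2\int_0^r f'(Y^{\sigma} X^s u_0)\, d\sigma \right) \left( \partial_x X^s u_0 \right)^2 \biggr]\, dr\, ds. \end{aligned}$$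
   Context: $C^\infty_b(\mathbb{R})$ denotes the space of functions of class $C^\infty$ on $\mathbb{R}$ that are bounded over $\mathbb{R}$, with the maximum norm $\|\cdot\|_\infty$. The function $f:\mathbb{R}\to\mathbb{R}$ is of class $C^\infty$ with $f(0)=0$ and satisfies: $|r|\ge 1 \Rightarrow r f(r)\le 0$. For initial data in $C^\infty_b(\mathbb{R})$ and $t\ge 0$ define three (bounded-solution) semi-flows: - $T^tu_0$ is the solution $u(\cdot,t)$ of $\partial_t u-\partial_x^2 u=f(u)$ on $\mathbb{R}\times(0,\infty)$, $u(\cdot,0)=u_0$; - $X^tv_0$ is the solution $v(\cdot,t)$ of the heat equation $\partial_t v-\partial_x^2 v=0$, $v(\cdot,0)=v_0$ (given by the heat semi-group, i.e. Gauss–Weierstrass convolution); - $Y^tw_0$ is the solution $w(\cdot,t)$ of $\partial_t w=f(w)$ (pointwise in $x$), $w(\cdot,0)=w_0$. Compositions are read as $X^tY^tu_0=X^t(Y^tu_0)$. $\mathcal{D}T^{\tau}(v)$ denotes the derivative of $T^\tau$ with respect to the initial condition, at the initial condition $v$; it is a linear operator, applied here to the function in square brackets. Expressions such as $f'(w)$, $f''(w)$ for a function $w$ are pointwise compositions, and products are pointwise. *)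

theory Defs
  imports "HOL-Analysis.Analysis"
begin

section \<open>Bounded smooth functions with the supremum norm\<close>

definition smooth :: "(real \<Rightarrow> real) \<Rightarrow> bool" where
  "smooth g \<longleftrightarrow> (\<forall>n x. (deriv ^^ n) g field_differentiable (at x))"

lemma higher_deriv_add:
  assumes "smooth g" "smooth h"
  shows "(deriv ^^ n) (\<lambda>x. g x + h x) = (\<lambda>x. (deriv ^^ n) g x + (deriv ^^ n) h x)"
proof (induction n)
  case (Suc n)
  have "deriv (\<lambda>x. (deriv ^^ n) g x + (deriv ^^ n) h x) x =
      deriv ((deriv ^^ n) g) x + deriv ((deriv ^^ n) h) x" for x
    using assms by (intro deriv_add) (auto simp: smooth_def)
  then show ?case by (simp add: Suc.IH)
qed simp

lemma higher_deriv_cmult: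
  assumes "smooth g"
  shows "(deriv ^^ n) (\<lambda>x. c * g x) = (\<lambda>x. c * (deriv ^^ n) g x)"
proof (induction n)
  case (Suc n)
  have "deriv (\<lambda>x. c * (deriv ^^ n) g x) x = c * deriv ((deriv ^^ n) g) x" for x
    using assms by (intro deriv_cmult) (auto simp: smooth_def)
  then show ?case by (simp add: Suc.IH)
qed simp

lemma smooth_add: "smooth g \<Longrightarrow> smooth h \<Longrightarrow> smooth (\<lambda>x. g x + h x)"
  unfolding smooth_def[of "\<lambda>x. g x + h x"]
  by (auto simp: higher_deriv_add) (auto simp: smooth_def intro: field_differentiable_add)

lemma smooth_cmult: "smooth g \<Longrightarrow> smooth (\<lambda>x. c * g x)"
  unfolding smooth_def[of "\<lambda>x. c * g x"]
  by (auto simp: higher_deriv_cmult)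
     (auto simp: smooth_def intro!: field_differentiable_mult)

lemma smooth_zero: "smooth (\<lambda>x. 0)"
proof -
  have "(deriv ^^ n) (\<lambda>x::real. 0::real) = (\<lambda>x. 0)" for n
    by (induction n) auto
  then show ?thesis by (auto simp: smooth_def)
qed

text \<open>Only the functions themselves are bounded; their derivatives need not be.\<close>

typedef Cb = "{g :: real \<Rightarrow> real. smooth g \<and> bounded (range g)}"
  morphisms apply_Cb to_Cb
  by (rule exI[of _ "\<lambda>_. 0"]) (auto simp: smooth_zero)

declare [[coercion apply_Cb]]

setup_lifting type_definition_Cb

lemma apply_Cb_eqI: "(\<And>x. apply_Cb g x = apply_Cb h x) \<Longrightarrow> g = h"
  by (auto simp: apply_Cb_inject[symmetric])

instantiation Cb :: real_vector
begin

lift_definition zero_Cb :: Cb is "\<lambda>_. 0"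
  by (auto simp: smooth_zero)

lift_definition plus_Cb :: "Cb \<Rightarrow> Cb \<Rightarrow> Cb" is "\<lambda>g h x. g x + h x"
  by (auto intro: smooth_add bounded_plus_comp)

lift_definition uminus_Cb :: "Cb \<Rightarrow> Cb" is "\<lambda>g x. - g x"
  using smooth_cmult[where c = "-1"] by (auto simp: bounded_iff)

lift_definition minus_Cb :: "Cb \<Rightarrow> Cb \<Rightarrow> Cb" is "\<lambda>g h x. g x - h x"
  using smooth_add[OF _ smooth_cmult[where c = "-1"]] by (auto intro: bounded_minus_comp)

lift_definition scaleR_Cb :: "real \<Rightarrow> Cb \<Rightarrow> Cb" is "\<lambda>c g x. c * g x"
proof (safe intro!: smooth_cmult)
  fix c :: real and g :: "real \<Rightarrow> real"
  assume "bounded (range g)"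
  then have "bounded ((\<lambda>y. c *\<^sub>R y) ` range g)" by (rule bounded_scaling)
  then show "bounded (range (\<lambda>x. c * g x))" by (simp add: image_image)
qed

instance
  by standard (transfer; simp add: algebra_simps)+

end

lemma bdd_above_abs_Cb: "bdd_above (range (\<lambda>x. \<bar>apply_Cb g x\<bar>))"
  using apply_Cb[of g] by (auto simp: bounded_iff bdd_above_def)

instantiation Cb :: real_normed_vector
begin

definition norm_Cb :: "Cb \<Rightarrow> real" where
  "norm_Cb g = (SUP x. \<bar>apply_Cb g x\<bar>)"

definition sgn_Cb :: "Cb \<Rightarrow> Cb" where
  "sgn_Cb g = g /\<^sub>R norm g"

definition dist_Cb :: "Cb \<Rightarrow> Cb \<Rightarrow> real" where
  "dist_Cb g h = norm (g - h)"

definition uniformity_Cb :: "(Cb \<times> Cb) filter" where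
  "uniformity_Cb = (INF e\<in>{0 <..}. principal {(g, h). dist g h < e})"

definition open_Cb :: "Cb set \<Rightarrow> bool" where
  "open_Cb U \<longleftrightarrow> (\<forall>g\<in>U. \<forall>\<^sub>F (g', h) in uniformity. g' = g \<longrightarrow> h \<in> U)"

instance
proof
  fix g h :: Cb and c :: real and U :: "Cb set"
  have le: "\<bar>apply_Cb k x\<bar> \<le> norm k" for k x
    unfolding norm_Cb_def by (rule cSUP_upper[OF _ bdd_above_abs_Cb]) simp
  have nonneg: "0 \<le> norm k" for k :: Cb
    using le[of k 0] by linarith
  show "dist g h = norm (g - h)" by (rule dist_Cb_def)
  show "sgn g = g /\<^sub>R norm g" by (rule sgn_Cb_def)
  show "(uniformity :: (Cb \<times> Cb) filter) = (INF e\<in>{0 <..}. principal {(g, h). dist g h < e})"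
    by (rule uniformity_Cb_def)
  show "open U \<longleftrightarrow> (\<forall>g\<in>U. \<forall>\<^sub>F (g', h) in uniformity. g' = g \<longrightarrow> h \<in> U)"
    by (rule open_Cb_def)
  show "norm g = 0 \<longleftrightarrow> g = 0"
  proof
    assume "norm g = 0"
    then have "apply_Cb g x = 0" for x using le[of g x] by simp
    then show "g = 0" by (intro apply_Cb_eqI) (simp add: zero_Cb.rep_eq)
  qed (simp add: norm_Cb_def zero_Cb.rep_eq)
  show "norm (g + h) \<le> norm g + norm h"
    unfolding norm_Cb_def[of "g + h"]
  proof (rule cSUP_least)
    show "\<bar>apply_Cb (g + h) x\<bar> \<le> norm g + norm h" for x
      using le[of g x] le[of h x] by (simp add: plus_Cb.rep_eq)
  qed simp
  have scale_le: "norm (a *\<^sub>R k) \<le> \<bar>a\<bar> * norm k" for a and k :: Cb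
    unfolding norm_Cb_def[of "a *\<^sub>R k"]
    by (rule cSUP_least) (auto simp: scaleR_Cb.rep_eq abs_mult intro: mult_left_mono le)
  show "norm (c *\<^sub>R g) = \<bar>c\<bar> * norm g"
  proof (cases "c = 0")
    case True
    then show ?thesis using scale_le[of 0 g] nonneg[of "0 *\<^sub>R g"] by simp
  next
    case False
    have "norm (inverse c *\<^sub>R (c *\<^sub>R g)) \<le> \<bar>inverse c\<bar> * norm (c *\<^sub>R g)"
      by (rule scale_le)
    then have "\<bar>c\<bar> * norm g \<le> norm (c *\<^sub>R g)"
      using False by (simp add: field_simps)
    then show ?thesis using scale_le[of c g] by simp
  qed
qed

end

section \<open>The three semi-flows\<close>

text \<open>
  Bounded solutions of \<open>\<partial>\<^sub>t u = F(u)\<close> on \<open>\<real> \<times> (0, \<infinity>)\<close> with initial value \<open>u0\<close>, where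
  \<open>F v x\<close> is the right-hand side at the point \<open>x\<close> for the profile \<open>v\<close>.  The initial value is
  attained through joint continuity in \<open>(t, x)\<close>: continuity of \<open>t \<mapsto> u t\<close> at 0 in the
  supremum norm fails for the heat equation when \<open>u0\<close> is not uniformly continuous.
\<close>

definition bounded_solution ::
    "(Cb \<Rightarrow> real \<Rightarrow> real) \<Rightarrow> Cb \<Rightarrow> (real \<Rightarrow> Cb) \<Rightarrow> bool" where
  "bounded_solution F u0 u \<longleftrightarrow>
     u 0 = u0 \<and>
     continuous_on ({0..} \<times> UNIV) (\<lambda>(t, x). u t x) \<and>
     bounded ((\<lambda>(t, x). u t x) ` ({0..} \<times> UNIV)) \<and>
     (\<forall>t>0. \<forall>x. ((\<lambda>\<tau>. u \<tau> x) has_real_derivative F (u t) x) (at t))"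

text \<open>
  Solutions are unique only on \<open>{0..}\<close>, so the description operator selects the value at
  time \<open>t\<close> rather than the trajectory.  For \<open>t < 0\<close> the value is unspecified.
\<close>

definition flow :: "(Cb \<Rightarrow> real \<Rightarrow> real) \<Rightarrow> real \<Rightarrow> Cb \<Rightarrow> Cb" where
  "flow F t u0 = (THE v. \<exists>u. bounded_solution F u0 u \<and> v = u t)"

definition Tflow :: "(real \<Rightarrow> real) \<Rightarrow> real \<Rightarrow> Cb \<Rightarrow> Cb" where
  "Tflow f = flow (\<lambda>v x. deriv (deriv v) x + f (v x))"

definition Xflow :: "real \<Rightarrow> Cb \<Rightarrow> Cb" where
  "Xflow = flow (\<lambda>v x. deriv (deriv v) x)"

definition Yflow :: "(real \<Rightarrow> real) \<Rightarrow> real \<Rightarrow> Cb \<Rightarrow> Cb" where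
  "Yflow f = flow (\<lambda>v x. f (v x))"

definition DTflow :: "(real \<Rightarrow> real) \<Rightarrow> real \<Rightarrow> Cb \<Rightarrow> Cb \<Rightarrow> Cb" where
  "DTflow f \<tau> v = frechet_derivative (Tflow f \<tau>) (at v)"

text \<open>
  The sources of the two splitting formulas.  Without bounds on the derivatives of the initial
  datum, \<open>splitting_source_XY\<close> may be unbounded for \<open>r = 0\<close> and \<open>splitting_source_YX\<close> for
  \<open>s = 0\<close>; there \<open>to_Cb\<close> returns an unspecified value.  This only concerns null sets of the
  domain of integration \<open>0 \<le> r \<le> s \<le> t\<close>.
\<close>

definition splitting_source_XY ::
    "(real \<Rightarrow> real) \<Rightarrow> Cb \<Rightarrow> real \<Rightarrow> real \<Rightarrow> Cb" where
  "splitting_source_XY f u0 s r = to_Cb (\<lambda>y.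
     deriv (deriv f) (Xflow r (Yflow f s u0) y) * (deriv (Xflow r (Yflow f s u0)) y)\<^sup>2)"

definition splitting_source_YX ::
    "(real \<Rightarrow> real) \<Rightarrow> Cb \<Rightarrow> real \<Rightarrow> real \<Rightarrow> Cb" where
  "splitting_source_YX f u0 s r = to_Cb (\<lambda>y.
     exp (integral {0..s - r} (\<lambda>\<sigma>. deriv f (Yflow f (\<sigma> + r) (Xflow s u0) y))) *
     deriv (deriv f) (Yflow f r (Xflow s u0) y) *
     exp (2 * integral {0..r} (\<lambda>\<sigma>. deriv f (Yflow f \<sigma> (Xflow s u0) y))) *
     (deriv (Xflow s u0) y)\<^sup>2)"

end

theory Submission
  imports Defs "HOL-Probability.Distributions" "HOL-Analysis.Bounded_Continuous_Function"
begin

text \<open>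
Fix \<open>u0\<close> and let \<open>V s\<close> be one of the two split solutions \<open>X\<^sup>sY\<^sup>su0\<close>, \<open>Y\<^sup>sX\<^sup>su0\<close>.  It solves the
reaction-diffusion equation up to a defect, \<open>\<partial>\<^sub>sV = \<partial>\<^sub>x\<^sup>2V + f(V) + R\<close>, and the curve
\<open>s \<mapsto> T\<^bsup>t-s\<^esup>(V s)\<close> leads from \<open>T\<^sup>tu0\<close> to \<open>V t\<close> with derivative \<open>DT\<^bsup>t-s\<^esup>(V s)[R s]\<close>.  Integrating this
derivative is the nonlinear variation of constants formula (\<open>alekseev_groebner\<close>); both splitting
formulas follow from it once the defect is itself written as an integral over \<open>r\<close>.

For \<open>XY\<close> put \<open>w = Y\<^sup>su0\<close>; then \<open>R = X\<^sup>sf(w) - f(X\<^sup>sw)\<close>, and \<open>r \<mapsto> X\<^bsup>s-r\<^esup>f(X\<^sup>rw)\<close> has the derivative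
\<open>- X\<^bsup>s-r\<^esup>[f''(X\<^sup>rw)(\<partial>\<^sub>xX\<^sup>rw)\<^sup>2]\<close>.  For \<open>YX\<close> put \<open>h = X\<^sup>su0\<close> and let \<open>y(t, a)\<close> be the flow of the scalar
equation \<open>y' = f(y)\<close>; then \<open>V s = y(s, h)\<close> and \<open>R = - \<partial>\<^sub>a\<^sup>2y(s, h) (\<partial>\<^sub>xh)\<^sup>2\<close>, where
\<open>\<partial>\<^sub>ay = exp (\<integral> f'(y))\<close>, so that \<open>\<partial>\<^sub>a\<^sup>2y\<close> is an integral over \<open>{0..s}\<close>.  The space \<open>Cb\<close> is not complete,
hence no function with values in \<open>Cb\<close> is integrated: a primitive in \<open>r\<close> is written down, the linear
operator \<open>DT\<close> is applied to it, and the real function obtained by evaluation at \<open>x\<close> is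
differentiated (\<open>XY_inner_integral\<close>, \<open>YX_inner_integral\<close>).

The derivatives of \<open>u0\<close> may be unbounded, and then \<open>X\<^sup>su0\<close> need not tend to \<open>u0\<close> in the supremum norm.
Limits in time are therefore taken in the sense of bounded, locally uniform convergence.  The
derivative \<open>DT\<close> is continuous for it because the maximum principle, used with the weight
\<open>1 + x\<^sup>2\<close>, bounds a solution in terms of the weighted size of its initial value
(\<open>parabolic_estimate\<close>, \<open>cont_bdd_weighted_uniform\<close>, \<open>DTflow_weighted\<close>).

The flows are defined by a description, so existence and uniqueness of bounded solutions with
smooth time slices are part of the proof.  Uniqueness is the maximum principle.  Solutions are
constructed as fixed points of the Duhamel formula (\<open>mild_solution_exists\<close>).  They are smooth for
positive times because a Duhamel integral has one more space derivative than its source, away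
from time 0 (\<open>regular_duhamel\<close>, \<open>mild_solution_classical\<close>).
\<close>

section \<open>Differentiation of Lebesgue integrals with a parameter\<close>

text \<open>
Fubini on \<open>[a, b] \<times> \<real>\<close>.  The outer integral runs over a bounded interval, so a uniform bound on the
\<open>L\<^sup>1\<close> norms of the slices already makes the integrand integrable on the strip.
\<close>

lemma strip_integral_swap:
  fixes B :: "real \<Rightarrow> real \<Rightarrow> real"
  assumes cont: "continuous_on ({a..b} \<times> UNIV) (\<lambda>(s, z). B s z)"
    and int: "\<And>s. s \<in> {a..b} \<Longrightarrow> integrable lborel (B s)"
    and bound: "\<And>s. s \<in> {a..b} \<Longrightarrow> (LINT z|lborel. \<bar>B s z\<bar>) \<le> C"
    and cont': "continuous_on {a..b} (\<lambda>s. LINT z|lborel. B s z)"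
  shows "integrable lborel (\<lambda>z. integral {a..b} (\<lambda>s. B s z))"
    and "(LINT z|lborel. integral {a..b} (\<lambda>s. B s z)) = integral {a..b} (\<lambda>s. LINT z|lborel. B s z)"
proof -
  define F where "F s z = indicator {a..b} s * B s z" for s z
  have "(\<lambda>p. indicator ({a..b} \<times> UNIV) p *\<^sub>R (\<lambda>(s, z). B s z) p) \<in> borel_measurable borel"
    by (rule borel_measurable_continuous_on_indicator) (use cont in \<open>auto intro!: borel_closed closed_Times\<close>)
  also have "(\<lambda>p. indicator ({a..b} \<times> UNIV) p *\<^sub>R (\<lambda>(s, z). B s z) p) = (\<lambda>(s, z). F s z)"
    by (auto simp: F_def indicator_def fun_eq_iff)
  finally have meas: "(\<lambda>(s, z). F s z) \<in> borel_measurable (lborel \<Otimes>\<^sub>M lborel)"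
    by (simp add: lborel_prod)
  have intF: "integrable lborel (F s)" for s
    using int by (cases "s \<in> {a..b}") (auto simp: F_def[abs_def])
  have "integrable lborel (\<lambda>s. LINT z|lborel. \<bar>F s z\<bar>)"
  proof (rule Bochner_Integration.integrable_bound)
    show "integrable lborel (\<lambda>s. indicator {a..b} s * C)"
      by (intro integrable_mult_left integrable_real_indicator) (auto simp: emeasure_lborel_Icc_eq)
    show "(\<lambda>s. LINT z|lborel. \<bar>F s z\<bar>) \<in> borel_measurable lborel"
      using meas by (intro lborel.borel_measurable_lebesgue_integral) (auto simp: split_beta')
    show "AE s in lborel. norm (LINT z|lborel. \<bar>F s z\<bar>) \<le> norm (indicator {a..b} s * C)"
    proof (intro AE_I2)
      fix s
      have "0 \<le> (LINT z|lborel. \<bar>F s z\<bar>)" by simp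
      moreover have "(LINT z|lborel. \<bar>F s z\<bar>) \<le> indicator {a..b} s * C"
        using bound[of s] by (auto simp: F_def indicator_def)
      ultimately show "norm (LINT z|lborel. \<bar>F s z\<bar>) \<le> norm (indicator {a..b} s * C)" by simp
    qed
  qed
  then have intp: "integrable (lborel \<Otimes>\<^sub>M lborel) (\<lambda>(s, z). F s z)"
    using meas intF by (intro lborel_pair.Fubini_integrable) auto
  have inner: "(LINT s|lborel. F s z) = integral {a..b} (\<lambda>s. B s z)" for z
  proof -
    have "continuous_on {a..b} (\<lambda>s. B s z)"
      by (rule continuous_on_compose2[OF cont, of _ "\<lambda>s. (s, z)", simplified]) (auto intro!: continuous_intros)
    from borel_integrable_atLeastAtMost'[OF this]
    show ?thesis by (simp add: F_def set_borel_integral_eq_integral(2)[symmetric] set_lebesgue_integral_def)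
  qed
  have outer: "(LINT s|lborel. LINT z|lborel. F s z) = integral {a..b} (\<lambda>s. LINT z|lborel. B s z)"
    using borel_integrable_atLeastAtMost'[OF cont']
    by (simp add: F_def set_borel_integral_eq_integral(2)[symmetric] set_lebesgue_integral_def)
  show "integrable lborel (\<lambda>z. integral {a..b} (\<lambda>s. B s z))"
    using lborel_pair.integrable_snd[OF intp] by (simp add: inner)
  show "(LINT z|lborel. integral {a..b} (\<lambda>s. B s z)) = integral {a..b} (\<lambda>s. LINT z|lborel. B s z)"
    using lborel_pair.Fubini_integral[OF intp] by (simp add: inner outer)
qed

text \<open>
Differentiation under the integral without a dominating function: by Fubini the integral of
\<open>A\<close> is a primitive of the integral of \<open>B\<close>.  This suits moving kernels, whose slices have
bounded \<open>L\<^sup>1\<close> norm but no convenient common majorant.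
\<close>

lemma lebesgue_integral_has_real_derivative:
  fixes A B :: "real \<Rightarrow> real \<Rightarrow> real"
  assumes der: "\<And>s z. s \<in> {a..b} \<Longrightarrow> ((\<lambda>s. A s z) has_real_derivative B s z) (at s within {a..b})"
    and cont: "continuous_on ({a..b} \<times> UNIV) (\<lambda>(s, z). B s z)"
    and intA: "\<And>s. s \<in> {a..b} \<Longrightarrow> integrable lborel (A s)"
    and intB: "\<And>s. s \<in> {a..b} \<Longrightarrow> integrable lborel (B s)"
    and bound: "\<And>s. s \<in> {a..b} \<Longrightarrow> (LINT z|lborel. \<bar>B s z\<bar>) \<le> C"
    and cont': "continuous_on {a..b} (\<lambda>s. LINT z|lborel. B s z)"
    and s: "s \<in> {a..b}"
  shows "((\<lambda>s. LINT z|lborel. A s z) has_real_derivative (LINT z|lborel. B s z)) (at s within {a..b})"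
proof -
  have eq: "(LINT z|lborel. A a z) + integral {a..t} (\<lambda>s. LINT z|lborel. B s z) = (LINT z|lborel. A t z)"
    if t: "t \<in> {a..b}" for t
  proof -
    have sub: "{a..t} \<subseteq> {a..b}" and at: "a \<in> {a..b}" using t by auto
    have "(LINT z|lborel. integral {a..t} (\<lambda>s. B s z)) = integral {a..t} (\<lambda>s. LINT z|lborel. B s z)"
      by (rule strip_integral_swap(2)[where C = C])
         (use sub in \<open>auto intro!: intB bound continuous_on_subset[OF cont] continuous_on_subset[OF cont']\<close>)
    moreover have "integral {a..t} (\<lambda>s. B s z) = A t z - A a z" for z
    proof (rule integral_unique, rule fundamental_theorem_of_calculus)
      show "a \<le> t" using t by simp
      show "((\<lambda>s. A s z) has_vector_derivative B s z) (at s within {a..t})" if "s \<in> {a..t}" for s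
        using DERIV_subset[OF der[of s z] sub] that t
        by (auto simp: has_real_derivative_iff_has_vector_derivative)
    qed
    ultimately show ?thesis using intA[OF t] intA[OF at] by simp
  qed
  have "((\<lambda>t. (LINT z|lborel. A a z) + integral {a..t} (\<lambda>s. LINT z|lborel. B s z))
      has_real_derivative (LINT z|lborel. B s z)) (at s within {a..b})"
    using integral_has_real_derivative[OF cont' s] by (auto intro!: derivative_eq_intros)
  then show ?thesis
    by (rule has_field_derivative_transform_within[OF _ zero_less_one s]) (use eq in auto)
qed

section \<open>Gaussian averages\<close>

text \<open>
The derivatives in space and time of the heat kernel are, up to scaling, polynomials times the
Gaussian density; this class is closed under differentiation (\<open>gauss_deriv\<close>).
\<close>

definition gauss_poly :: "real poly \<Rightarrow> real \<Rightarrow> real" where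
  "gauss_poly p y = poly p y * std_normal_density y"

definition gauss_deriv :: "real poly \<Rightarrow> real poly" where
  "gauss_deriv p = pderiv p - pCons 0 p"

lemma continuous_on_gauss_poly [continuous_intros]: "continuous_on S f \<Longrightarrow> continuous_on S (\<lambda>x. gauss_poly p (f x))"
  unfolding gauss_poly_def normal_density_def by (intro continuous_intros) auto

lemma measurable_gauss_poly [measurable]: "gauss_poly p \<in> borel_measurable borel"
  by (intro borel_measurable_continuous_onI continuous_intros)

lemma integrable_gauss_poly: "integrable lborel (gauss_poly p)"
proof -
  have "integrable lborel (\<lambda>x. \<Sum>i\<le>degree p. coeff p i * (std_normal_density x * x ^ i))"
    by (intro Bochner_Integration.integrable_sum integrable_mult_right integrable_std_normal_moment)
  also have "(\<lambda>x. \<Sum>i\<le>degree p. coeff p i * (std_normal_density x * x ^ i)) = gauss_poly p"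
    by (auto simp: fun_eq_iff gauss_poly_def poly_altdef sum_distrib_right intro!: sum.cong)
  finally show ?thesis .
qed

lemma integral_gauss_poly_1: "(LINT y|lborel. gauss_poly 1 y) = 1"
  by (simp add: gauss_poly_def)

lemma gauss_poly_1_nonneg: "0 \<le> gauss_poly 1 y"
  by (simp add: gauss_poly_def)

lemma DERIV_gauss_poly [derivative_intros]:
  assumes "(f has_real_derivative f') (at x within S)"
  shows "((\<lambda>x. gauss_poly p (f x)) has_real_derivative (gauss_poly (gauss_deriv p) (f x) * f')) (at x within S)"
proof -
  have "((\<lambda>x. c * exp (- x\<^sup>2 / 2)) has_real_derivative - y * (c * exp (- y\<^sup>2 / 2))) (at y)" for c y :: real
    by (auto intro!: derivative_eq_intros)
  then have std: "(std_normal_density has_real_derivative - y * std_normal_density y) (at y)" for y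
    unfolding std_normal_density_def[abs_def] .
  have "(gauss_poly p has_real_derivative gauss_poly (gauss_deriv p) y) (at y)" for y
    unfolding gauss_poly_def[abs_def] gauss_deriv_def
    by (auto intro!: derivative_eq_intros std simp: algebra_simps)
  from DERIV_chain2[OF this assms] show ?thesis .
qed

text \<open>
Families that are jointly continuous and bounded uniformly in space, locally uniformly in the
parameter.  Solutions attain their initial values in this sense; in general they do not attain
them in the supremum norm.
\<close>

definition cont_bdd :: "'a::heine_borel set \<Rightarrow> ('a \<Rightarrow> real \<Rightarrow> real) \<Rightarrow> bool" where
  "cont_bdd S g \<longleftrightarrow> continuous_on (S \<times> UNIV) (\<lambda>(s, x). g s x) \<and>
     (\<forall>C. compact C \<longrightarrow> C \<subseteq> S \<longrightarrow> bounded ((\<lambda>(s, x). g s x) ` (C \<times> UNIV)))"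

lemma cont_bddI:
  assumes "continuous_on (S \<times> UNIV) (\<lambda>(s, x). g s x)"
    and "\<And>C. compact C \<Longrightarrow> C \<subseteq> S \<Longrightarrow> \<exists>B. \<forall>s\<in>C. \<forall>x. \<bar>g s x\<bar> \<le> B"
  shows "cont_bdd S g"
  unfolding cont_bdd_def bounded_iff using assms by force

lemma cont_bdd_boundE:
  assumes "cont_bdd S g" "compact C" "C \<subseteq> S"
  obtains B where "B > 0" "\<And>s x. s \<in> C \<Longrightarrow> \<bar>g s x\<bar> \<le> B"
proof -
  have "bounded ((\<lambda>(s, x). g s x) ` (C \<times> UNIV))" using assms by (auto simp: cont_bdd_def)
  then obtain B where "B > 0" "\<forall>y\<in>(\<lambda>(s, x). g s x) ` (C \<times> UNIV). norm y \<le> B"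
    by (auto simp: bounded_pos)
  then show ?thesis by (intro that[of B]) force+
qed

lemma cont_bdd_continuous: "cont_bdd S g \<Longrightarrow> continuous_on (S \<times> UNIV) (\<lambda>(s, x). g s x)"
  by (simp add: cont_bdd_def)

lemma cont_bdd_compose:
  assumes "cont_bdd S g" "continuous_on U s" "s ` U \<subseteq> S" "continuous_on U x"
  shows "continuous_on U (\<lambda>u. g (s u) (x u))"
  by (rule continuous_on_compose2[OF cont_bdd_continuous[OF assms(1)], of _ "\<lambda>u. (s u, x u)", simplified])
     (use assms in \<open>auto intro!: continuous_intros\<close>)

lemma cont_bdd_subset: "cont_bdd S g \<Longrightarrow> S' \<subseteq> S \<Longrightarrow> cont_bdd S' g"
  by (auto simp: cont_bdd_def intro: continuous_on_subset)

lemma cont_bdd_slice: "cont_bdd S g \<Longrightarrow> s \<in> S \<Longrightarrow> continuous_on U (g s)"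
  using cont_bdd_compose[of S g U "\<lambda>_. s" "\<lambda>x. x"] by (auto simp: image_subset_iff)

lemma cont_bdd_const:
  assumes "continuous_on UNIV w" "\<And>x. \<bar>w x\<bar> \<le> B"
  shows "cont_bdd S (\<lambda>_. w)"
proof (rule cont_bddI)
  have "continuous_on (S \<times> UNIV) (\<lambda>p. w (snd p))"
    by (rule continuous_on_compose2[OF assms(1)]) (auto intro!: continuous_intros)
  then show "continuous_on (S \<times> UNIV) (\<lambda>(s, x). w x)" by (simp add: split_beta')
qed (use assms in auto)

text \<open>
The heat semigroup at time \<open>t\<close> is the average with \<open>p = 1\<close> and \<open>r = sqrt (2 * t)\<close>.  In the variable
\<open>r\<close> the kernel is not singular at time 0.
\<close>

definition gauss_avg :: "real poly \<Rightarrow> real \<Rightarrow> (real \<Rightarrow> real) \<Rightarrow> real \<Rightarrow> real" where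
  "gauss_avg p r w x = (LINT y|lborel. w (x + r * y) * gauss_poly p y)"

definition gauss_poly_L1 :: "real poly \<Rightarrow> real" where
  "gauss_poly_L1 p = (LINT y|lborel. \<bar>gauss_poly p y\<bar>)"

lemma gauss_avg_integrable:
  assumes "continuous_on UNIV w" "\<And>x. \<bar>w x\<bar> \<le> B"
  shows "integrable lborel (\<lambda>y. w (x + r * y) * gauss_poly p y)"
proof (rule Bochner_Integration.integrable_bound[OF integrable_mult_right[OF integrable_gauss_poly, of B p]])
  have [measurable]: "w \<in> borel_measurable borel"
    using assms(1) by (rule borel_measurable_continuous_onI)
  show "(\<lambda>y. w (x + r * y) * gauss_poly p y) \<in> borel_measurable lborel" by measurable
  show "AE y in lborel. norm (w (x + r * y) * gauss_poly p y) \<le> norm (B * gauss_poly p y)"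
    using assms(2) by (auto simp: abs_mult intro!: mult_right_mono order_trans[OF assms(2)])
qed

lemma abs_gauss_avg_le_gauss_poly_L1:
  assumes "continuous_on UNIV w" "\<And>x. \<bar>w x\<bar> \<le> B"
  shows "\<bar>gauss_avg p r w x\<bar> \<le> B * gauss_poly_L1 p"
proof -
  have "\<bar>gauss_avg p r w x\<bar> \<le> (LINT y|lborel. \<bar>w (x + r * y) * gauss_poly p y\<bar>)"
    unfolding gauss_avg_def by (rule integral_abs_bound)
  also have "\<dots> \<le> (LINT y|lborel. B * \<bar>gauss_poly p y\<bar>)"
    by (intro integral_mono integrable_abs gauss_avg_integrable[OF assms] integrable_mult_right integrable_gauss_poly)
       (auto simp: abs_mult intro!: mult_right_mono assms)
  finally show ?thesis by (simp add: gauss_poly_L1_def)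
qed

lemma gauss_poly_L1_1 [simp]: "gauss_poly_L1 1 = 1"
  by (simp add: gauss_poly_L1_def gauss_poly_1_nonneg integral_gauss_poly_1)

lemma abs_gauss_avg_le: 
  assumes "continuous_on UNIV w" "\<And>x. \<bar>w x\<bar> \<le> B"
  shows "\<bar>gauss_avg 1 r w x\<bar> \<le> B"
  using abs_gauss_avg_le_gauss_poly_L1[OF assms, of 1] by simp

lemma gauss_avg_0 [simp]: "gauss_avg 1 0 w x = w x"
  by (simp add: gauss_avg_def integral_gauss_poly_1)

lemma gauss_avg_const: "gauss_avg 1 r (\<lambda>_. c) x = c"
  by (simp add: gauss_avg_def integral_gauss_poly_1)

lemma gauss_avg_add:
  assumes "continuous_on UNIV w" "\<And>x. \<bar>w x\<bar> \<le> B" "continuous_on UNIV w'" "\<And>x. \<bar>w' x\<bar> \<le> B'"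
  shows "gauss_avg p r (\<lambda>x. w x + w' x) x = gauss_avg p r w x + gauss_avg p r w' x"
  unfolding gauss_avg_def distrib_right
  by (intro Bochner_Integration.integral_add gauss_avg_integrable[OF assms(1,2)] gauss_avg_integrable[OF assms(3,4)])

lemma gauss_avg_diff:
  assumes "continuous_on UNIV w" "\<And>x. \<bar>w x\<bar> \<le> B" "continuous_on UNIV w'" "\<And>x. \<bar>w' x\<bar> \<le> B'"
  shows "gauss_avg p r (\<lambda>x. w x - w' x) x = gauss_avg p r w x - gauss_avg p r w' x"
  unfolding gauss_avg_def left_diff_distrib
  by (intro Bochner_Integration.integral_diff gauss_avg_integrable[OF assms(1,2)] gauss_avg_integrable[OF assms(3,4)])

text \<open>
Dominated convergence along sequences: the values of the parameter along a convergent sequence,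
together with the limit, form a compact set, on which the family is uniformly bounded.
\<close>

lemma continuous_on_gauss_avg:
  fixes s :: "'b::metric_space \<Rightarrow> 'a::heine_borel"
  assumes g: "cont_bdd S g" and s: "continuous_on U s" "s ` U \<subseteq> S"
    and r: "continuous_on U r" and x: "continuous_on U x"
  shows "continuous_on U (\<lambda>u. gauss_avg p (r u) (g (s u)) (x u))"
  unfolding continuous_on_sequentially comp_def
proof (intro allI ballI impI, elim conjE)
  fix v :: "nat \<Rightarrow> 'b" and u assume u: "u \<in> U" and v: "\<forall>n. v n \<in> U" "v \<longlonglongrightarrow> u"
  have lim: "(\<lambda>n. s (v n)) \<longlonglongrightarrow> s u" "(\<lambda>n. r (v n)) \<longlonglongrightarrow> r u" "(\<lambda>n. x (v n)) \<longlonglongrightarrow> x u"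
    using s(1) r x u v unfolding continuous_on_sequentially comp_def by blast+
  define C where "C = insert (s u) (range (\<lambda>n. s (v n)))"
  have C: "compact C" unfolding C_def by (rule compact_sequence_with_limit[OF lim(1)])
  have CS: "C \<subseteq> S" using s(2) u v(1) by (auto simp: C_def)
  obtain B where B: "\<And>t x. t \<in> C \<Longrightarrow> \<bar>g t x\<bar> \<le> B" using cont_bdd_boundE[OF g C CS] by metis
  have meas: "g t \<in> borel_measurable borel" if "t \<in> C" for t
    using cont_bdd_slice[OF g] that CS by (auto intro!: borel_measurable_continuous_onI)
  show "(\<lambda>n. gauss_avg p (r (v n)) (g (s (v n))) (x (v n))) \<longlonglongrightarrow> gauss_avg p (r u) (g (s u)) (x u)"
    unfolding gauss_avg_def
  proof (rule integral_dominated_convergence[where w = "\<lambda>y. B * \<bar>gauss_poly p y\<bar>"])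
    show "integrable lborel (\<lambda>y. B * \<bar>gauss_poly p y\<bar>)" by (intro integrable_mult_right integrable_abs integrable_gauss_poly)
    show "AE y in lborel. norm (g (s (v n)) (x (v n) + r (v n) * y) * gauss_poly p y) \<le> B * \<bar>gauss_poly p y\<bar>" for n
      by (auto simp: abs_mult C_def intro!: mult_right_mono B)
    have "(\<lambda>n. g (s (v n)) (x (v n) + r (v n) * y)) \<longlonglongrightarrow> g (s u) (x u + r u * y)" for y
    proof -
      have "(\<lambda>n. (s (v n), x (v n) + r (v n) * y)) \<longlonglongrightarrow> (s u, x u + r u * y)"
        by (intro tendsto_intros lim)
      then show ?thesis
        using cont_bdd_continuous[OF g, unfolded continuous_on_sequentially comp_def, rule_format,
            of "(s u, x u + r u * y)" "\<lambda>n. (s (v n), x (v n) + r (v n) * y)"] CS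
        by (auto simp: C_def)
    qed
    then show "AE y in lborel. (\<lambda>n. g (s (v n)) (x (v n) + r (v n) * y) * gauss_poly p y)
        \<longlonglongrightarrow> g (s u) (x u + r u * y) * gauss_poly p y"
      by (auto intro!: tendsto_intros)
    have [measurable]: "g (s u) \<in> borel_measurable borel" by (rule meas) (simp add: C_def)
    show "(\<lambda>y. g (s u) (x u + r u * y) * gauss_poly p y) \<in> borel_measurable lborel" by measurable
    fix n
    have [measurable]: "g (s (v n)) \<in> borel_measurable borel" by (rule meas) (simp add: C_def)
    show "(\<lambda>y. g (s (v n)) (x (v n) + r (v n) * y) * gauss_poly p y) \<in> borel_measurable lborel" by measurable
  qed
qed

lemma cont_bdd_gauss_avg:
  assumes g: "cont_bdd S g" and r: "continuous_on S r"
  shows "cont_bdd S (\<lambda>s. gauss_avg p (r s) (g s))"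
proof (rule cont_bddI)
  have "continuous_on (S \<times> UNIV) (\<lambda>q. gauss_avg p (r (fst q)) (g (fst q)) (snd q))"
    by (rule continuous_on_gauss_avg[OF g])
       (auto intro!: continuous_intros continuous_on_compose2[OF r])
  then show "continuous_on (S \<times> UNIV) (\<lambda>(s, x). gauss_avg p (r s) (g s) x)" by (simp add: split_beta')
  fix C assume C: "compact C" "C \<subseteq> S"
  obtain B where B: "\<And>t x. t \<in> C \<Longrightarrow> \<bar>g t x\<bar> \<le> B" using cont_bdd_boundE[OF g C] by metis
  show "\<exists>B. \<forall>s\<in>C. \<forall>x. \<bar>gauss_avg p (r s) (g s) x\<bar> \<le> B"
    using C B by (intro exI[of _ "B * gauss_poly_L1 p"] ballI allI abs_gauss_avg_le_gauss_poly_L1 cont_bdd_slice[OF g]) auto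
qed

text \<open>
After the substitution \<open>z = x + r * y\<close> the point \<open>x\<close> and the radius \<open>r\<close> occur only in the smooth
kernel, so averages of merely continuous functions can be differentiated.
\<close>

lemma
  assumes "r \<noteq> 0" and w: "continuous_on UNIV w" "\<And>x. \<bar>w x\<bar> \<le> B"
  shows kernel_integrable: "integrable lborel (\<lambda>z. w z * gauss_poly p ((z - x) / r))"
    and gauss_avg_kernel: "(LINT z|lborel. w z * gauss_poly p ((z - x) / r)) = \<bar>r\<bar> * gauss_avg p r w x"
    and kernel_bound: "(LINT z|lborel. \<bar>w z * gauss_poly p ((z - x) / r)\<bar>) \<le> \<bar>r\<bar> * (B * gauss_poly_L1 p)"
proof -
  show i: "integrable lborel (\<lambda>z. w z * gauss_poly p ((z - x) / r))"
    using gauss_avg_integrable[OF w, of x r p] assms(1)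
    by (subst lborel_integrable_real_affine_iff[symmetric, of r _ x]) auto
  show "(LINT z|lborel. w z * gauss_poly p ((z - x) / r)) = \<bar>r\<bar> * gauss_avg p r w x"
    using assms(1) by (subst lborel_integral_real_affine[of r _ x]) (auto simp: gauss_avg_def)
  have "(LINT z|lborel. \<bar>w z * gauss_poly p ((z - x) / r)\<bar>) = \<bar>r\<bar> * (LINT y|lborel. \<bar>w (x + r * y) * gauss_poly p y\<bar>)"
    using assms(1) by (subst lborel_integral_real_affine[of r _ x]) auto
  also have "(LINT y|lborel. \<bar>w (x + r * y) * gauss_poly p y\<bar>) \<le> (LINT y|lborel. B * \<bar>gauss_poly p y\<bar>)"
    by (intro integral_mono integrable_abs gauss_avg_integrable[OF w] integrable_mult_right integrable_gauss_poly)
       (auto simp: abs_mult intro!: mult_right_mono w)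
  finally show "(LINT z|lborel. \<bar>w z * gauss_poly p ((z - x) / r)\<bar>) \<le> \<bar>r\<bar> * (B * gauss_poly_L1 p)"
    by (simp add: gauss_poly_L1_def mult_left_mono)
qed

lemma gauss_avg_DERIV_x:
  assumes r: "r > 0" and w: "continuous_on UNIV w" "\<And>x. \<bar>w x\<bar> \<le> B"
  shows "((\<lambda>x. gauss_avg p r w x) has_real_derivative (- gauss_avg (gauss_deriv p) r w x / r)) (at x)"
proof -
  define A' where "A' x z = (- 1 / r\<^sup>2) * (w z * gauss_poly (gauss_deriv p) ((z - x) / r))" for x z
  have l: "cont_bdd (UNIV::real set) (\<lambda>_. w)" by (rule cont_bdd_const[OF w])
  have kA: "(LINT z|lborel. A' x z) = - gauss_avg (gauss_deriv p) r w x / r" for x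
    using gauss_avg_kernel[OF _ w, of r "gauss_deriv p" x] r unfolding A'_def
    by (simp add: power2_eq_square field_simps)
  have "((\<lambda>x. LINT z|lborel. (1 / r) * (w z * gauss_poly p ((z - x) / r))) has_real_derivative (LINT z|lborel. A' x z))
      (at x within {x - 1..x + 1})"
  proof (rule lebesgue_integral_has_real_derivative[where C = "(1 / r\<^sup>2) * (\<bar>r\<bar> * (B * gauss_poly_L1 (gauss_deriv p)))"])
    show "((\<lambda>x. (1 / r) * (w z * gauss_poly p ((z - x) / r))) has_real_derivative A' x z) (at x within {y - 1..y + 1})" for x y z
      using r by (auto intro!: derivative_eq_intros simp: A'_def power2_eq_square field_simps)
    have "continuous_on ({x - 1..x + 1} \<times> UNIV) (\<lambda>q. (- 1 / r\<^sup>2) * (w (snd q) * gauss_poly (gauss_deriv p) ((snd q - fst q) / r)))"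
      using r by (intro continuous_intros continuous_on_compose2[OF w(1)]) auto
    then show "continuous_on ({x - 1..x + 1} \<times> UNIV) (\<lambda>(x, z). A' x z)"
      by (simp add: A'_def split_beta')
    show "integrable lborel (\<lambda>z. (1 / r) * (w z * gauss_poly p ((z - x) / r)))" for x
      using r by (intro integrable_mult_right kernel_integrable[OF _ w]) auto
    show "integrable lborel (A' x)" for x
      using r unfolding A'_def by (intro integrable_mult_right kernel_integrable[OF _ w]) auto
    have "(LINT z|lborel. \<bar>A' x z\<bar>) = (1 / r\<^sup>2) * (LINT z|lborel. \<bar>w z * gauss_poly (gauss_deriv p) ((z - x) / r)\<bar>)" for x
      unfolding A'_def abs_mult[of "- 1 / r\<^sup>2"] by simp
    then show "(LINT z|lborel. \<bar>A' x z\<bar>) \<le> (1 / r\<^sup>2) * (\<bar>r\<bar> * (B * gauss_poly_L1 (gauss_deriv p)))" for x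
      using kernel_bound[OF _ w, of r "gauss_deriv p" x] r by (simp add: divide_right_mono)
    show "continuous_on {x - 1..x + 1} (\<lambda>x. LINT z|lborel. A' x z)"
      unfolding kA using r by (intro continuous_intros continuous_on_gauss_avg[OF l]) auto
  qed auto
  moreover have "(LINT z|lborel. (1 / r) * (w z * gauss_poly p ((z - x) / r))) = gauss_avg p r w x" for x
    using gauss_avg_kernel[OF _ w, of r p x] r by simp
  ultimately show ?thesis
    by (simp add: kA at_within_Icc_at)
qed

text \<open>
The kernel identity \<open>(r\<^sup>-\<^sup>1\<gamma>(z/r))' = r\<^sup>-\<^sup>2\<gamma>''(z/r)\<close> for the Gaussian density \<open>\<gamma>\<close> and the derivative in \<open>r\<close>:
this is the heat equation in the variable \<open>r\<close>.
\<close>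

lemma gauss_avg_DERIV_r:
  assumes r: "r > 0" and w: "continuous_on UNIV w" "\<And>x. \<bar>w x\<bar> \<le> B"
  shows "((\<lambda>r. gauss_avg 1 r w x) has_real_derivative (gauss_avg (gauss_deriv (gauss_deriv 1)) r w x / r)) (at r)"
proof -
  have gauss_poly: "gauss_poly (gauss_deriv 1) y = - y * gauss_poly 1 y" "gauss_poly (gauss_deriv (gauss_deriv 1)) y = (y\<^sup>2 - 1) * gauss_poly 1 y" for y
    by (auto simp: gauss_poly_def gauss_deriv_def pderiv_pCons one_pCons power2_eq_square algebra_simps)
  define A' where "A' r z = (1 / r\<^sup>2) * (w z * gauss_poly (gauss_deriv (gauss_deriv 1)) ((z - x) / r))" for r z
  let ?q = "gauss_deriv (gauss_deriv 1)"
  have l: "cont_bdd (UNIV::real set) (\<lambda>_. w)" by (rule cont_bdd_const[OF w])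
  have gauss_poly_L1: "0 \<le> B" "0 \<le> gauss_poly_L1 ?q" using w(2)[of 0] by (auto simp: gauss_poly_L1_def)
  have kA: "(LINT z|lborel. A' r z) = gauss_avg ?q r w x / r" if "r > 0" for r
    using gauss_avg_kernel[OF _ w, of r ?q x] that unfolding A'_def
    by (simp add: power2_eq_square field_simps)
  have "((\<lambda>r. LINT z|lborel. (1 / r) * (w z * gauss_poly 1 ((z - x) / r))) has_real_derivative (LINT z|lborel. A' r z))
      (at r within {r/2..2*r})"
  proof (rule lebesgue_integral_has_real_derivative[where C = "2 * (B * gauss_poly_L1 ?q) / r"])
    show "((\<lambda>r. (1 / r) * (w z * gauss_poly 1 ((z - x) / r))) has_real_derivative A' s z) (at s within {r/2..2*r})"
      if "s \<in> {r/2..2*r}" for s z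
      using that r
      by (auto intro!: derivative_eq_intros simp: A'_def gauss_poly)
         (simp add: power2_eq_square field_simps)
    have "continuous_on ({r/2..2*r} \<times> UNIV) (\<lambda>q. (1 / (fst q)\<^sup>2) * (w (snd q) * gauss_poly ?q ((snd q - x) / fst q)))"
      using r by (intro continuous_intros continuous_on_compose2[OF w(1)]) auto
    then show "continuous_on ({r/2..2*r} \<times> UNIV) (\<lambda>(r, z). A' r z)"
      by (simp add: A'_def split_beta')
    show "integrable lborel (\<lambda>z. (1 / s) * (w z * gauss_poly 1 ((z - x) / s)))" if "s \<in> {r/2..2*r}" for s
      using r that by (intro integrable_mult_right kernel_integrable[OF _ w]) auto
    show "integrable lborel (A' s)" if "s \<in> {r/2..2*r}" for s
      using r that unfolding A'_def by (intro integrable_mult_right kernel_integrable[OF _ w]) auto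
    show "(LINT z|lborel. \<bar>A' s z\<bar>) \<le> 2 * (B * gauss_poly_L1 ?q) / r" if s: "s \<in> {r/2..2*r}" for s
    proof -
      have s0: "s > 0" using s r by auto
      have "(LINT z|lborel. \<bar>A' s z\<bar>) = (1 / s\<^sup>2) * (LINT z|lborel. \<bar>w z * gauss_poly ?q ((z - x) / s)\<bar>)"
        unfolding A'_def abs_mult[of "1 / s\<^sup>2"] by simp
      also have "\<dots> \<le> (1 / s\<^sup>2) * (\<bar>s\<bar> * (B * gauss_poly_L1 ?q))"
        using s0 by (intro mult_left_mono kernel_bound[OF _ w]) auto
      also have "\<dots> = (B * gauss_poly_L1 ?q) / s" using s0 by (simp add: power2_eq_square)
      also have "\<dots> \<le> (B * gauss_poly_L1 ?q) / (r / 2)" using s r gauss_poly_L1 by (intro divide_left_mono) auto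
      finally show ?thesis by (simp add: mult_ac)
    qed
    have "continuous_on {r/2..2*r} (\<lambda>r. gauss_avg ?q r w x / r)"
      using r by (intro continuous_intros continuous_on_gauss_avg[OF l]) auto
    then show "continuous_on {r/2..2*r} (\<lambda>r. LINT z|lborel. A' r z)"
      by (rule continuous_on_eq) (use r kA in auto)
  qed (use r in auto)
  then have "((\<lambda>r. LINT z|lborel. (1 / r) * (w z * gauss_poly 1 ((z - x) / r))) has_real_derivative gauss_avg ?q r w x / r) (at r)"
    using kA[OF r] r by (simp add: at_within_Icc_at)
  then show ?thesis
  proof (rule has_field_derivative_transform_within_open[of _ _ _ "{0<..}"])
    show "(LINT z|lborel. (1 / r) * (w z * gauss_poly 1 ((z - x) / r))) = gauss_avg 1 r w x" if "r \<in> {0<..}" for r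
      using gauss_avg_kernel[OF _ w, of r 1 x] that by simp
  qed (use r in auto)
qed

lemma gauss_avg_DERIV_param:
  fixes g g' :: "real \<Rightarrow> real \<Rightarrow> real"
  assumes g: "cont_bdd {a..b} g" and g': "cont_bdd {a..b} g'"
    and der: "\<And>s x. s \<in> {a..b} \<Longrightarrow> ((\<lambda>s. g s x) has_real_derivative g' s x) (at s within {a..b})"
    and s: "s \<in> {a..b}"
  shows "((\<lambda>s. gauss_avg p r (g s) x) has_real_derivative gauss_avg p r (g' s) x) (at s within {a..b})"
proof -
  obtain B where B: "\<And>t x. t \<in> {a..b} \<Longrightarrow> \<bar>g t x\<bar> \<le> B" using cont_bdd_boundE[OF g, of "{a..b}"] by (metis compact_Icc order_refl)
  obtain B' where B': "\<And>t x. t \<in> {a..b} \<Longrightarrow> \<bar>g' t x\<bar> \<le> B'" using cont_bdd_boundE[OF g', of "{a..b}"] by (metis compact_Icc order_refl)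
  note slice = cont_bdd_slice[OF g] cont_bdd_slice[OF g']
  show ?thesis unfolding gauss_avg_def
  proof (rule lebesgue_integral_has_real_derivative[where C = "B' * gauss_poly_L1 p"])
    show "((\<lambda>s. g s (x + r * z) * gauss_poly p z) has_real_derivative g' s (x + r * z) * gauss_poly p z) (at s within {a..b})"
      if "s \<in> {a..b}" for s z using that by (auto intro!: derivative_eq_intros der)
    have "continuous_on ({a..b} \<times> UNIV) (\<lambda>q. g' (fst q) (x + r * snd q) * gauss_poly p (snd q))"
      by (intro continuous_intros cont_bdd_compose[OF g']) auto
    then show "continuous_on ({a..b} \<times> UNIV) (\<lambda>(s, z). g' s (x + r * z) * gauss_poly p z)"
      by (simp add: split_beta')
    show "continuous_on {a..b} (\<lambda>s. LINT z|lborel. g' s (x + r * z) * gauss_poly p z)"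
      unfolding gauss_avg_def[symmetric] by (intro continuous_on_gauss_avg[OF g'] continuous_intros) auto
    fix s assume s: "s \<in> {a..b}"
    show "integrable lborel (\<lambda>z. g s (x + r * z) * gauss_poly p z)"
      using B s by (intro gauss_avg_integrable[of _ B] slice)
    show i: "integrable lborel (\<lambda>z. g' s (x + r * z) * gauss_poly p z)"
      using B' s by (intro gauss_avg_integrable[of _ B'] slice)
    have "(LINT z|lborel. \<bar>g' s (x + r * z) * gauss_poly p z\<bar>) \<le> (LINT y|lborel. B' * \<bar>gauss_poly p y\<bar>)"
      by (intro integral_mono integrable_abs i integrable_mult_right integrable_gauss_poly)
         (use B' s in \<open>auto simp: abs_mult intro!: mult_right_mono\<close>)
    then show "(LINT z|lborel. \<bar>g' s (x + r * z) * gauss_poly p z\<bar>) \<le> B' * gauss_poly_L1 p" by (simp add: gauss_poly_L1_def)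
  qed (use s in auto)
qed

text \<open>
A space derivative is a derivative with respect to a translation of the averaged function.
\<close>

lemma gauss_avg_DERIV_x_smooth:
  assumes w: "continuous_on UNIV w" "\<And>x. \<bar>w x\<bar> \<le> B"
    and w': "continuous_on UNIV w'" "\<And>x. \<bar>w' x\<bar> \<le> B'"
    and der: "\<And>x. (w has_real_derivative w' x) (at x)"
  shows "((\<lambda>x. gauss_avg p r w x) has_real_derivative gauss_avg p r w' x) (at x)"
proof -
  have shift: "cont_bdd {-1..1::real} (\<lambda>s x. v (s + x))" if "continuous_on UNIV v" "\<And>x. \<bar>v x\<bar> \<le> B" for v B
  proof (rule cont_bddI)
    show "continuous_on ({-1..1} \<times> UNIV) (\<lambda>(s, x). v (s + x))"
      unfolding split_beta' by (intro continuous_on_compose2[OF that(1)] continuous_intros) auto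
  qed (use that in auto)
  have "((\<lambda>s. gauss_avg p r (\<lambda>x. w (s + x)) x) has_real_derivative gauss_avg p r (\<lambda>x. w' (0 + x)) x) (at 0 within {-1..1})"
  proof (rule gauss_avg_DERIV_param[OF shift[OF w] shift[OF w']])
    have "((\<lambda>s. s + y) has_real_derivative 1) (at s within {-1..1})" for s y :: real
      by (auto intro!: derivative_eq_intros)
    from DERIV_chain2[OF der this]
    show "((\<lambda>s. w (s + y)) has_real_derivative w' (s + y)) (at s within {-1..1})" for s y
      by simp
  qed auto
  then have "((\<lambda>s. gauss_avg p r w (s + x)) has_real_derivative gauss_avg p r w' x) (at 0)"
    by (simp add: at_within_Icc_at gauss_avg_def add_ac)
  then show ?thesis by (simp add: DERIV_shift[where z = x and x = 0, simplified] add_ac)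
qed

section \<open>Families of functions that are regular in space\<close>

lemma cont_bdd_bound_at:
  assumes "cont_bdd S g" "s \<in> S"
  shows "\<exists>B. \<forall>x. \<bar>g s x\<bar> \<le> B"
proof -
  have "compact {s}" "{s} \<subseteq> S" using assms(2) by auto
  from cont_bdd_boundE[OF assms(1) this] show ?thesis by (metis singletonI)
qed

text \<open>
The flag distinguishes functions of \<open>(t, x)\<close> that have to be bounded in space (\<open>b\<close> true) from
functions of \<open>(t, a)\<close> that are not, such as the flow \<open>y(t, a)\<close> of the equation \<open>y' = f(y)\<close>.
\<close>

definition contb :: "real set \<Rightarrow> bool \<Rightarrow> (real \<Rightarrow> real \<Rightarrow> real) \<Rightarrow> bool" where
  "contb I b u \<longleftrightarrow> (if b then cont_bdd I u else continuous_on (I \<times> UNIV) (\<lambda>(t, x). u t x))"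

text \<open>
Time derivatives do not occur here; wherever one is needed it is expressed by space derivatives
through the equation that the function solves.
\<close>

primrec regular :: "real set \<Rightarrow> bool \<Rightarrow> nat \<Rightarrow> (real \<Rightarrow> real \<Rightarrow> real) \<Rightarrow> bool" where
  "regular I b 0 u = contb I b u"
| "regular I b (Suc k) u = (contb I b u \<and> (\<forall>t\<in>I. \<forall>x. u t field_differentiable at x) \<and>
     regular I b k (\<lambda>t. deriv (u t)))"

lemma contb_cong: "(\<And>t. t \<in> I \<Longrightarrow> u t = v t) \<Longrightarrow> contb I b u = contb I b v"
proof -
  assume *: "\<And>t. t \<in> I \<Longrightarrow> u t = v t"
  have c: "continuous_on (I \<times> UNIV) (\<lambda>(t, x). u t x) = continuous_on (I \<times> UNIV) (\<lambda>(t, x). v t x)"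
    by (rule continuous_on_cong) (auto simp: *)
  have "(\<lambda>(t, x). u t x) ` (C \<times> UNIV) = (\<lambda>(t, x). v t x) ` (C \<times> UNIV)" if "C \<subseteq> I" for C
    using that * by (intro image_cong) auto
  then show ?thesis by (auto simp: contb_def cont_bdd_def c)
qed

lemma regular_cong: "(\<And>t. t \<in> I \<Longrightarrow> u t = v t) \<Longrightarrow> regular I b k u = regular I b k v"
proof (induction k arbitrary: u v)
  case 0
  then show ?case using contb_cong[of I u v] by simp
next
  case (Suc k)
  from Suc.prems show ?case
    using Suc.IH[of "\<lambda>t. deriv (u t)" "\<lambda>t. deriv (v t)"] contb_cong[of I u v] by auto
qed

lemma contb_continuous: "contb I b u \<Longrightarrow> continuous_on (I \<times> UNIV) (\<lambda>(t, x). u t x)"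
  by (auto simp: contb_def cont_bdd_def split: if_splits)

lemma contb_compose:
  assumes "contb I b g" "continuous_on U s" "s ` U \<subseteq> I" "continuous_on U x"
  shows "continuous_on U (\<lambda>u. g (s u) (x u))"
  by (rule continuous_on_compose2[OF contb_continuous[OF assms(1)], of _ "\<lambda>u. (s u, x u)", simplified])
     (use assms in \<open>auto intro!: continuous_intros\<close>)

lemma contbI:
  assumes "continuous_on (I \<times> UNIV) (\<lambda>(t, x). u t x)"
    and "\<And>C. b \<Longrightarrow> compact C \<Longrightarrow> C \<subseteq> I \<Longrightarrow> \<exists>B. \<forall>s\<in>C. \<forall>x. \<bar>u s x\<bar> \<le> B"
  shows "contb I b u"
  using assms cont_bddI[of I u] by (auto simp: contb_def)

lemma contb_boundE:
  assumes "contb I b u" b "compact C" "C \<subseteq> I"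
  obtains B where "B > 0" "\<And>s x. s \<in> C \<Longrightarrow> \<bar>u s x\<bar> \<le> B"
  using assms cont_bdd_boundE[of I u C] by (auto simp: contb_def)

lemma regular_contb: "regular I b k u \<Longrightarrow> contb I b u"
  by (cases k) auto

lemma regular_cont_bdd: "regular I True k u \<Longrightarrow> cont_bdd I u"
  using regular_contb by (auto simp: contb_def)

lemma cont_bdd_regular: "cont_bdd I u \<Longrightarrow> regular I True 0 u"
  by (simp add: contb_def)

lemma regular_SucI:
  assumes "contb I b u" "\<And>t x. t \<in> I \<Longrightarrow> (u t has_real_derivative v t x) (at x)" "regular I b k v"
  shows "regular I b (Suc k) u"
proof -
  have "deriv (u t) = v t" if "t \<in> I" for t
    using assms(2)[OF that] DERIV_imp_deriv by blast
  then have "regular I b k (\<lambda>t. deriv (u t))" using assms(3) regular_cong[of I "\<lambda>t. deriv (u t)" v b k] by simp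
  then show ?thesis using assms by (auto simp: field_differentiable_def)
qed

lemma regular_Suc_DERIV: "regular I b (Suc k) u \<Longrightarrow> t \<in> I \<Longrightarrow> (u t has_real_derivative deriv (u t) x) (at x)"
  by (simp add: DERIV_deriv_iff_field_differentiable)

lemma regular_deriv: "regular I b (Suc k) u \<Longrightarrow> regular I b k (\<lambda>t. deriv (u t))"
  by simp

lemma regular_SucD: "regular I b (Suc k) u \<Longrightarrow> regular I b k u"
proof (induction k arbitrary: u)
  case (Suc k)
  have "regular I b k (\<lambda>t. deriv (u t))" by (rule Suc.IH) (use Suc.prems in simp)
  then show ?case using Suc.prems by simp
qed simp

lemma contb_subset: "contb I b u \<Longrightarrow> J \<subseteq> I \<Longrightarrow> contb J b u"
  by (cases b) (auto simp: contb_def intro: cont_bdd_subset continuous_on_subset)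

lemma regular_subset: "regular I b k u \<Longrightarrow> J \<subseteq> I \<Longrightarrow> regular J b k u"
  by (induction k arbitrary: u) (auto intro: contb_subset)

lemma contb_time: "continuous_on I c \<Longrightarrow> contb I b (\<lambda>t x. c t)"
proof (rule contbI)
  assume c: "continuous_on I c"
  then show "continuous_on (I \<times> UNIV) (\<lambda>(t, x). c t)"
    unfolding split_beta' by (rule continuous_on_compose2) (auto intro!: continuous_intros)
  fix C assume "compact C" "C \<subseteq> I"
  then have "bounded (c ` C)"
    using compact_imp_bounded[OF compact_continuous_image[OF continuous_on_subset[OF c]]] by blast
  then show "\<exists>B. \<forall>s\<in>C. \<forall>x. \<bar>c s\<bar> \<le> B" by (auto simp: bounded_iff)
qed

lemma contb_add: "contb I b u \<Longrightarrow> contb I b v \<Longrightarrow> contb I b (\<lambda>t x. u t x + v t x)"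
proof (rule contbI)
  assume u: "contb I b u" and v: "contb I b v"
  then show "continuous_on (I \<times> UNIV) (\<lambda>(t, x). u t x + v t x)"
    using contb_continuous[OF u] contb_continuous[OF v] by (auto simp: split_beta' intro!: continuous_intros)
  fix C assume C: b "compact C" "C \<subseteq> I"
  obtain B where "\<And>s x. s \<in> C \<Longrightarrow> \<bar>u s x\<bar> \<le> B" using contb_boundE[OF u C] by metis
  moreover obtain B' where "\<And>s x. s \<in> C \<Longrightarrow> \<bar>v s x\<bar> \<le> B'" using contb_boundE[OF v C] by metis
  ultimately show "\<exists>B. \<forall>s\<in>C. \<forall>x. \<bar>u s x + v s x\<bar> \<le> B"
    by (intro exI[of _ "B + B'"] ballI allI order_trans[OF abs_triangle_ineq] add_mono) auto
qed

lemma contb_mult: "contb I b u \<Longrightarrow> contb I b v \<Longrightarrow> contb I b (\<lambda>t x. u t x * v t x)"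
proof (rule contbI)
  assume u: "contb I b u" and v: "contb I b v"
  then show "continuous_on (I \<times> UNIV) (\<lambda>(t, x). u t x * v t x)"
    using contb_continuous[OF u] contb_continuous[OF v] by (auto simp: split_beta' intro!: continuous_intros)
  fix C assume C: b "compact C" "C \<subseteq> I"
  obtain B where "B > 0" "\<And>s x. s \<in> C \<Longrightarrow> \<bar>u s x\<bar> \<le> B" using contb_boundE[OF u C] by metis
  moreover obtain B' where "\<And>s x. s \<in> C \<Longrightarrow> \<bar>v s x\<bar> \<le> B'" using contb_boundE[OF v C] by metis
  ultimately show "\<exists>B. \<forall>s\<in>C. \<forall>x. \<bar>u s x * v s x\<bar> \<le> B"
    unfolding abs_mult by (intro exI[of _ "B * B'"] ballI allI mult_mono) (auto intro: less_imp_le)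
qed

lemma contb_comp: "contb I False F \<Longrightarrow> contb I b h \<Longrightarrow> contb I b (\<lambda>t x. F t (h t x))"
proof (rule contbI)
  assume F: "contb I False F" and h: "contb I b h"
  show "continuous_on (I \<times> UNIV) (\<lambda>(t, x). F t (h t x))"
    unfolding split_beta'
    by (rule contb_compose[OF F]) (auto intro!: continuous_intros contb_compose[OF h])
  fix C assume C: b "compact C" "C \<subseteq> I"
  obtain B where B: "\<And>s x. s \<in> C \<Longrightarrow> \<bar>h s x\<bar> \<le> B" using contb_boundE[OF h C] by metis
  have "bounded ((\<lambda>(t, x). F t x) ` (C \<times> {-B..B}))"
    using C by (intro compact_imp_bounded compact_continuous_image compact_Times
        continuous_on_subset[OF contb_continuous[OF F]]) auto
  then obtain D where "\<forall>t\<in>C. \<forall>x\<in>{-B..B}. \<bar>F t x\<bar> \<le> D" by (auto simp: bounded_iff)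
  then have D: "\<And>t x. t \<in> C \<Longrightarrow> x \<in> {-B..B} \<Longrightarrow> \<bar>F t x\<bar> \<le> D" by blast
  have "h s x \<in> {-B..B}" if "s \<in> C" for s x using B[OF that, of x] by auto
  then show "\<exists>B. \<forall>s\<in>C. \<forall>x. \<bar>F s (h s x)\<bar> \<le> B"
    using D by blast
qed

lemma regular_time: "continuous_on I c \<Longrightarrow> regular I b k (\<lambda>t x. c t)"
proof (induction k arbitrary: c)
  case (Suc k)
  show ?case
    by (rule regular_SucI[where v = "\<lambda>_ _. 0"])
       (auto intro!: Suc.IH[of "\<lambda>_. 0"] contb_time[OF Suc.prems] continuous_intros)
qed (simp add: contb_time)

lemma regular_add: "regular I b k u \<Longrightarrow> regular I b k v \<Longrightarrow> regular I b k (\<lambda>t x. u t x + v t x)"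
proof (induction k arbitrary: u v)
  case (Suc k)
  show ?case
    by (rule regular_SucI[where v = "\<lambda>t x. deriv (u t) x + deriv (v t) x"])
       (use Suc.prems in \<open>auto intro!: Suc.IH contb_add derivative_eq_intros regular_Suc_DERIV[OF Suc.prems(1)]
          regular_Suc_DERIV[OF Suc.prems(2)]\<close>)
qed (simp add: contb_add)

lemma regular_mult: "regular I b k u \<Longrightarrow> regular I b k v \<Longrightarrow> regular I b k (\<lambda>t x. u t x * v t x)"
proof (induction k arbitrary: u v)
  case (Suc k)
  show ?case
  proof (rule regular_SucI[where v = "\<lambda>t x. deriv (u t) x * v t x + u t x * deriv (v t) x"])
    show "contb I b (\<lambda>t x. u t x * v t x)" using Suc.prems by (intro contb_mult) auto
    show "regular I b k (\<lambda>t x. deriv (u t) x * v t x + u t x * deriv (v t) x)"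
      using Suc.prems by (intro regular_add Suc.IH regular_SucD[OF Suc.prems(1)] regular_SucD[OF Suc.prems(2)]) auto
    show "((\<lambda>x. u t x * v t x) has_real_derivative deriv (u t) x * v t x + u t x * deriv (v t) x) (at x)"
      if "t \<in> I" for t x
      using that by (auto intro!: derivative_eq_intros regular_Suc_DERIV[OF Suc.prems(1)] regular_Suc_DERIV[OF Suc.prems(2)])
  qed
qed (simp add: contb_mult)

lemma regular_cmult: "regular I b k u \<Longrightarrow> regular I b k (\<lambda>t x. c * u t x)"
  using regular_mult[OF regular_time[of I "\<lambda>_. c"]] by simp

lemma regular_minus: "regular I b k u \<Longrightarrow> regular I b k (\<lambda>t x. - u t x)"
  using regular_cmult[of I b k u "- 1"] by simp

lemma regular_diff: "regular I b k u \<Longrightarrow> regular I b k v \<Longrightarrow> regular I b k (\<lambda>t x. u t x - v t x)"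
  using regular_add[OF _ regular_minus] by fastforce

text \<open>
The outer function is only evaluated on the bounded range of the inner one, so boundedness is
inherited from the inner function alone.
\<close>

lemma regular_comp: "regular I False k F \<Longrightarrow> regular I b k h \<Longrightarrow> regular I b k (\<lambda>t x. F t (h t x))"
proof (induction k arbitrary: F h)
  case (Suc k)
  show ?case
  proof (rule regular_SucI[where v = "\<lambda>t x. deriv (F t) (h t x) * deriv (h t) x"])
    show "contb I b (\<lambda>t x. F t (h t x))" using Suc.prems contb_comp[of I F b h] by simp
    show "regular I b k (\<lambda>t x. deriv (F t) (h t x) * deriv (h t) x)"
      by (rule regular_mult[OF Suc.IH[OF regular_deriv[OF Suc.prems(1)] regular_SucD[OF Suc.prems(2)]]
            regular_deriv[OF Suc.prems(2)]])
    show "((\<lambda>x. F t (h t x)) has_real_derivative deriv (F t) (h t x) * deriv (h t) x) (at x)"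
      if "t \<in> I" for t x
      by (rule DERIV_chain2[OF regular_Suc_DERIV[OF Suc.prems(1) that] regular_Suc_DERIV[OF Suc.prems(2) that]])
  qed
qed (simp add: contb_comp)

lemma smooth_deriv: "smooth g \<Longrightarrow> smooth (deriv g)"
  unfolding smooth_def by (metis funpow_Suc_right comp_apply)

lemma smooth_DERIV: "smooth g \<Longrightarrow> (g has_real_derivative deriv g x) (at x)"
  unfolding DERIV_deriv_iff_field_differentiable smooth_def by (metis funpow_0)

lemma smooth_continuous: "smooth g \<Longrightarrow> continuous_on S g"
  using smooth_DERIV by (meson DERIV_continuous continuous_at_imp_continuous_on)

lemma regular_smooth: "smooth g \<Longrightarrow> regular I False k (\<lambda>t. g)"
proof (induction k arbitrary: g)
  case 0
  have "continuous_on (I \<times> UNIV) (\<lambda>q. g (snd q))"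
    by (rule continuous_on_compose2[OF smooth_continuous[OF 0, of UNIV]]) (auto intro!: continuous_intros)
  then show ?case by (simp add: contb_def split_beta')
next
  case (Suc k)
  show ?case
    by (rule regular_SucI[OF regular_contb[OF Suc.IH[OF Suc.prems]] smooth_DERIV[OF Suc.prems]
          Suc.IH[OF smooth_deriv[OF Suc.prems]]])
qed

lemma regular_smooth_comp: "smooth g \<Longrightarrow> regular I b k u \<Longrightarrow> regular I b k (\<lambda>t x. g (u t x))"
  using regular_comp[OF regular_smooth] .

text \<open>
This and \<open>regular_smooth\<close> connect the classes with the notion \<open>smooth\<close> used for \<open>Cb\<close>.
\<close>

lemma regular_imp_smooth:
  assumes "\<And>k. regular I b k u" "t \<in> I"
  shows "smooth (u t)"
  unfolding smooth_def
proof (intro allI)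
  fix n x
  have "regular I b (Suc n) u \<Longrightarrow> (deriv ^^ n) (u t) field_differentiable at x" for u
  proof (induction n arbitrary: u)
    case 0
    then show ?case using \<open>t \<in> I\<close> by simp
  next
    case (Suc n)
    have "(deriv ^^ n) (deriv (u t)) field_differentiable at x"
      by (rule Suc.IH) (use Suc.prems in simp)
    then show ?case by (simp add: funpow_Suc_right del: funpow.simps)
  qed
  then show "(deriv ^^ n) (u t) field_differentiable at x" using assms(1) .
qed

text \<open>
Smoothing is proved on \<open>{d<..}\<close> for each \<open>d > 0\<close>, because Duhamel integrals are restarted at time \<open>d\<close>.
\<close>

lemma regular_exhaust:
  assumes "\<And>d. d > 0 \<Longrightarrow> regular {d<..} b k u"
  shows "regular {0<..} b k u"
  using assms
proof (induction k arbitrary: u)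
  case 0
  show ?case unfolding regular.simps
  proof (rule contbI)
    have "{0<..} \<times> (UNIV :: real set) = (\<Union>d\<in>{0::real<..}. {d<..} \<times> (UNIV :: real set))"
    proof (intro equalityI subsetI)
      fix q assume "q \<in> {0::real<..} \<times> (UNIV :: real set)"
      then show "q \<in> (\<Union>d\<in>{0::real<..}. {d<..} \<times> (UNIV :: real set))"
        by (cases q) (auto intro!: bexI[of _ "fst q / 2"])
    qed auto
    moreover have "continuous_on (\<Union>d\<in>{0::real<..}. {d<..} \<times> (UNIV :: real set)) (\<lambda>(t, x). u t x)"
      using 0 by (intro continuous_on_open_UN open_Times) (auto dest: contb_continuous)
    ultimately show "continuous_on ({0<..} \<times> UNIV) (\<lambda>(t, x). u t x)" by simp
    fix C :: "real set" assume C: b "compact C" "C \<subseteq> {0<..}"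
    show "\<exists>B. \<forall>s\<in>C. \<forall>x. \<bar>u s x\<bar> \<le> B"
    proof (cases "C = {}")
      case False
      obtain m where m: "m \<in> C" "\<And>t. t \<in> C \<Longrightarrow> m \<le> t" using compact_attains_inf[OF C(2) False] by auto
      have "m > 0" using m C by auto
      then have sub: "C \<subseteq> {m/2<..}" using m(2) by force
      have "contb {m/2<..} b u" using 0[of "m/2"] \<open>m > 0\<close> by simp
      from contb_boundE[OF this C(1,2) sub] show ?thesis by metis
    qed auto
  qed
next
  case (Suc k)
  have 1: "regular {0<..} b k (\<lambda>t. deriv (u t))" by (rule Suc.IH) (use Suc.prems in auto)
  have 2: "regular {0<..} b k u" by (rule Suc.IH) (use Suc.prems regular_SucD in blast)
  have "u t field_differentiable at x" if "t > 0" for t x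
    using Suc.prems[of "t/2"] that by auto
  then show ?case using 1 regular_contb[OF 2] by simp
qed

text \<open>
Each space derivative falls on the kernel and costs one factor \<open>1 / r\<close>; a power of \<open>r\<close> in the
statement makes the induction go through.
\<close>

lemma regular_gauss_avg:
  assumes w: "cont_bdd I w" and r: "continuous_on I r" "\<And>t. t \<in> I \<Longrightarrow> r t > 0"
  shows "regular I True k (\<lambda>t x. gauss_avg p (r t) (w t) x / r t ^ j)"
proof (induction k arbitrary: p j)
  have contb: "contb I True (\<lambda>t x. gauss_avg p (r t) (w t) x / r t ^ j)" for p j
    using contb_mult[of I True "\<lambda>t x. gauss_avg p (r t) (w t) x" "\<lambda>t x. 1 / r t ^ j"] r
      cont_bdd_gauss_avg[OF w r(1)] contb_time[of I "\<lambda>t. 1 / r t ^ j"]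
    by (force simp: contb_def intro!: continuous_intros)
  case 0
  show ?case using contb by simp
  case (Suc k)
  show ?case
  proof (rule regular_SucI[OF contb])
    show "regular I True k (\<lambda>t x. - (gauss_avg (gauss_deriv p) (r t) (w t) x / r t ^ Suc j))"
      by (intro regular_minus Suc.IH)
    fix t x assume t: "t \<in> I"
    obtain B where "\<And>x. \<bar>w t x\<bar> \<le> B" using cont_bdd_bound_at[OF w t] by blast
    from gauss_avg_DERIV_x[OF r(2)[OF t] cont_bdd_slice[OF w t] this] r(2)[OF t]
    show "((\<lambda>x. gauss_avg p (r t) (w t) x / r t ^ j) has_real_derivative
        - (gauss_avg (gauss_deriv p) (r t) (w t) x / r t ^ Suc j)) (at x)"
      by (auto intro!: derivative_eq_intros)
  qed
qed

section \<open>The maximum principle\<close>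

lemma second_derivative_at_max:
  fixes g g' :: "real \<Rightarrow> real"
  assumes g: "\<And>x. (g has_real_derivative g' x) (at x)" and g': "(g' has_real_derivative D) (at c)"
    and max: "\<And>x. g x \<le> g c"
  shows "D \<le> 0"
proof (rule ccontr)
  assume "\<not> D \<le> 0"
  have "g' c = 0" by (rule DERIV_local_max[OF g, of 1 c]) (use max in auto)
  obtain d where d: "d > 0" "\<And>h. 0 < h \<Longrightarrow> h < d \<Longrightarrow> g' c < g' (c + h)"
    using DERIV_pos_inc_right[OF g'] \<open>\<not> D \<le> 0\<close> by auto
  have "\<exists>z>c. z < c + d/2 \<and> g (c + d/2) - g c = (c + d/2 - c) * g' z"
    using d g by (intro MVT2) auto
  then obtain z where z: "c < z" "z < c + d/2" "g (c + d/2) - g c = d/2 * g' z" by auto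
  have "g' c < g' (c + (z - c))" by (rule d(2)) (use z d(1) in auto)
  then have "g' z > 0" using \<open>g' c = 0\<close> by simp
  then have "g c < g (c + d/2)" using z(3) d(1) mult_pos_pos[of "d/2" "g' z"] by linarith
  then show False using max[of "c + d/2"] by simp
qed

text \<open>
After multiplication by \<open>exp (- K * t)\<close> and subtraction of \<open>e * (1 + x\<^sup>2 + 3 * t)\<close>, a function that is
positive somewhere attains a positive maximum at some \<open>(s, y)\<close>.  There the time derivative is
nonnegative and the second space derivative is nonpositive, and the term \<open>3 * e\<close> against \<open>2 * e\<close>
contradicts the differential inequality.
\<close>

lemma max_principle:
  fixes w wt w1 w2 :: "real \<Rightarrow> real \<Rightarrow> real"
  assumes cont: "continuous_on ({0..T} \<times> UNIV) (\<lambda>(t, x). w t x)"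
    and bound: "\<And>t x. t \<in> {0..T} \<Longrightarrow> w t x \<le> B"
    and init: "\<And>x. w 0 x \<le> 0"
    and dt: "\<And>t x. t \<in> {0<..T} \<Longrightarrow> ((\<lambda>s. w s x) has_real_derivative wt t x) (at t within {0..T})"
    and d1: "\<And>t x. t \<in> {0<..T} \<Longrightarrow> (w t has_real_derivative w1 t x) (at x)"
    and d2: "\<And>t x. t \<in> {0<..T} \<Longrightarrow> (w1 t has_real_derivative w2 t x) (at x)"
    and ineq: "\<And>t x. t \<in> {0<..T} \<Longrightarrow> w t x > 0 \<Longrightarrow> wt t x \<le> w2 t x + K * w t x"
    and t: "t \<in> {0..T}"
  shows "w t x \<le> 0"
proof (rule ccontr)
  assume pos: "\<not> w t x \<le> 0"
  \<comment> \<open>half of the value for which \<open>u\<close> would vanish at \<open>(t, x)\<close>\<close>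
  define e where "e = exp (- K * t) * w t x / (2 * (1 + x\<^sup>2 + 3 * t))"
  define u where "u s y = exp (- K * s) * w s y - e * (1 + y\<^sup>2 + 3 * s)" for s y
  have den: "1 + x\<^sup>2 + 3 * t > 0" using t by (intro add_pos_nonneg) auto
  have e: "e > 0" unfolding e_def using pos den by (intro divide_pos_pos mult_pos_pos) auto
  have "e * (1 + x\<^sup>2 + 3 * t) = exp (- K * t) * w t x / 2" using den by (simp add: e_def field_simps)
  moreover have "exp (- K * t) * w t x > 0" using pos by simp
  ultimately have u0: "u t x > 0" unfolding u_def by linarith
  define E where "E = exp (\<bar>K\<bar> * T) * \<bar>B\<bar>"
  have wE: "exp (- K * s) * w s y \<le> E" if "s \<in> {0..T}" for s y
  proof -
    have "exp (- K * s) * w s y \<le> exp (- K * s) * \<bar>B\<bar>"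
      using bound[OF that, of y] by (intro mult_left_mono) auto
    also have "- K * s \<le> \<bar>K\<bar> * T" using that by (intro mult_mono) auto
    then have "exp (- K * s) * \<bar>B\<bar> \<le> E" unfolding E_def by (intro mult_right_mono) auto
    finally show ?thesis .
  qed
  define R where "R = \<bar>x\<bar> + E / e + 1"
  have "E \<ge> 0" by (simp add: E_def)
  have far: "u s y \<le> 0" if "s \<in> {0..T}" "\<bar>y\<bar> > R" for s y
  proof -
    have "R \<ge> 1" "R \<ge> E / e" using \<open>E \<ge> 0\<close> e by (auto simp: R_def)
    then have "E / e \<le> \<bar>y\<bar> * 1" using that by simp
    also have "\<dots> \<le> \<bar>y\<bar> * \<bar>y\<bar>" using that \<open>R \<ge> 1\<close> by (intro mult_left_mono) auto
    finally have "E \<le> e * y\<^sup>2" using e by (simp add: field_simps power2_eq_square)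
    also have "\<dots> \<le> e * (1 + y\<^sup>2 + 3 * s)" using e that by (intro mult_left_mono) auto
    finally show ?thesis using wE[OF that(1), of y] by (simp add: u_def)
  qed
  have cu: "continuous_on ({0..T} \<times> {-R..R}) (\<lambda>q. u (fst q) (snd q))"
    unfolding u_def
    by (intro continuous_intros continuous_on_subset[OF cont[unfolded split_beta']]) auto
  have "\<bar>x\<bar> \<le> R" using \<open>E \<ge> 0\<close> e by (simp add: R_def)
  then have xin: "(t, x) \<in> {0..T} \<times> {-R..R}" using t by auto
  obtain q where q: "q \<in> {0..T} \<times> {-R..R}"
      "\<And>q'. q' \<in> {0..T} \<times> {-R..R} \<Longrightarrow> u (fst q') (snd q') \<le> u (fst q) (snd q)"
    using continuous_attains_sup[OF _ _ cu] xin by (auto simp: compact_Times)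
  obtain s y where sy: "q = (s, y)" by force
  have s: "s \<in> {0..T}" using q(1) sy by auto
  have upos: "u s y > 0" using q(2)[OF xin] sy u0 by simp
  have max: "u s' y' \<le> u s y" if "s' \<in> {0..T}" for s' y'
  proof (cases "\<bar>y'\<bar> > R")
    case True
    then show ?thesis using far[OF that True] upos by simp
  next
    case False
    then have "- R \<le> y' \<and> y' \<le> R" by linarith
    then show ?thesis using q(2)[of "(s', y')"] that sy by auto
  qed
  have wpos: "w s y > 0"
  proof -
    have "e * (1 + y\<^sup>2 + 3 * s) \<ge> 0" using e s by (intro mult_nonneg_nonneg) auto
    then have "exp (- K * s) * w s y > 0" using upos by (simp add: u_def)
    then show ?thesis by (simp add: zero_less_mult_iff)
  qed
  have s0: "s \<in> {0<..T}" using s init[of y] wpos by (cases "s = 0") auto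
  have "((\<lambda>s. u s y) has_real_derivative
      (exp (- K * s) * (wt s y - K * w s y) - 3 * e)) (at s within {0..T})"
    unfolding u_def by (auto intro!: derivative_eq_intros dt s0 simp: algebra_simps)
  then have "exp (- K * s) * (wt s y - K * w s y) - 3 * e \<ge> 0" (is "?a \<ge> 0")
  proof (rule_tac ccontr)
    assume der: "((\<lambda>s. u s y) has_real_derivative ?a) (at s within {0..T})" and "\<not> ?a \<ge> 0"
    from has_real_derivative_neg_dec_left[OF der] this(2)
    obtain d where d: "d > 0" "\<And>h. h > 0 \<Longrightarrow> s - h \<in> {0..T} \<Longrightarrow> h < d \<Longrightarrow> u s y < u (s - h) y" by auto
    define h where "h = min (d/2) s"
    have "u s y < u (s - h) y" by (rule d(2)) (use d(1) s0 in \<open>auto simp: h_def\<close>)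
    moreover have "u (s - h) y \<le> u s y" by (rule max) (use d(1) s0 in \<open>auto simp: h_def\<close>)
    ultimately show False by simp
  qed
  moreover have "exp (- K * s) * w2 s y - 2 * e \<le> 0"
  proof (rule second_derivative_at_max)
    show "((\<lambda>y. u s y) has_real_derivative (exp (- K * s) * w1 s y - e * (2 * y))) (at y)" for y
      unfolding u_def by (auto intro!: derivative_eq_intros d1 s0)
    show "((\<lambda>y. exp (- K * s) * w1 s y - e * (2 * y)) has_real_derivative (exp (- K * s) * w2 s y - 2 * e)) (at y)"
      by (auto intro!: derivative_eq_intros d2 s0)
  qed (use max s in auto)
  moreover have "exp (- K * s) * (wt s y - K * w s y) \<le> exp (- K * s) * w2 s y"
    using ineq[OF s0 wpos] by (intro mult_left_mono) auto
  ultimately show False using e by linarith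
qed

text \<open>
Comparison with \<open>exp (K * t) * (a + b * t) * (1 + m * (x\<^sup>2 + 2 * t))\<close>, which is a supersolution since
\<open>\<partial>\<^sub>t(x\<^sup>2 + 2 * t) = \<partial>\<^sub>x\<^sup>2(x\<^sup>2 + 2 * t)\<close>.  With \<open>m = 0\<close> this is an estimate in the supremum norm, with \<open>m = 1\<close> an
estimate for locally uniform convergence.
\<close>

lemma weighted_upper:
  fixes z zt z1 z2 :: "real \<Rightarrow> real \<Rightarrow> real"
  assumes cont: "continuous_on ({0..T} \<times> UNIV) (\<lambda>(t, x). z t x)"
    and bound: "\<And>t x. t \<in> {0..T} \<Longrightarrow> z t x \<le> B"
    and dt: "\<And>t x. t \<in> {0<..T} \<Longrightarrow> ((\<lambda>s. z s x) has_real_derivative zt t x) (at t within {0..T})"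
    and d1: "\<And>t x. t \<in> {0<..T} \<Longrightarrow> (z t has_real_derivative z1 t x) (at x)"
    and d2: "\<And>t x. t \<in> {0<..T} \<Longrightarrow> (z1 t has_real_derivative z2 t x) (at x)"
    and init: "\<And>x. z 0 x \<le> a * (1 + m * x\<^sup>2)"
    and ineq: "\<And>t x. t \<in> {0<..T} \<Longrightarrow> z t x > 0 \<Longrightarrow> zt t x - z2 t x \<le> K * z t x + b * (1 + m * x\<^sup>2)"
    and nonneg: "a \<ge> 0" "b \<ge> 0" "K \<ge> 0" "m \<ge> 0"
    and t: "t \<in> {0..T}"
  shows "z t x \<le> exp (K * t) * (a + b * t) * (1 + m * (x\<^sup>2 + 2 * t))"
proof -
  define P where "P t x = exp (K * t) * (a + b * t) * (1 + m * (x\<^sup>2 + 2 * t))" for t x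
  define Pt where "Pt t x = K * P t x + exp (K * t) * b * (1 + m * (x\<^sup>2 + 2 * t)) + exp (K * t) * (a + b * t) * (m * 2)" for t x
  have P0: "P t x \<ge> 0" if "t \<ge> 0" for t x
    using nonneg that by (auto simp: P_def)
  have "z t x - P t x \<le> 0"
  proof (rule max_principle[where T = T and w = "\<lambda>t x. z t x - P t x" and B = B and K = K
      and wt = "\<lambda>t x. zt t x - Pt t x" and ?w1.0 = "\<lambda>t x. z1 t x - exp (K * t) * (a + b * t) * (m * (2 * x))"
      and ?w2.0 = "\<lambda>t x. z2 t x - exp (K * t) * (a + b * t) * (m * 2)"])
    show "continuous_on ({0..T} \<times> UNIV) (\<lambda>(t, x). z t x - P t x)"
      using cont unfolding P_def split_beta' by (intro continuous_intros)
    show "z t x - P t x \<le> B" if "t \<in> {0..T}" for t x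
      using bound[OF that, of x] P0[of t x] that by simp
    show "z 0 x - P 0 x \<le> 0" for x using init[of x] by (simp add: P_def)
    show "((\<lambda>t. z t x - P t x) has_real_derivative zt t x - Pt t x) (at t within {0..T})" if "t \<in> {0<..T}" for t x
      unfolding Pt_def P_def by (auto intro!: derivative_eq_intros dt that simp: algebra_simps)
    show "((\<lambda>x. z t x - P t x) has_real_derivative z1 t x - exp (K * t) * (a + b * t) * (m * (2 * x))) (at x)"
      if "t \<in> {0<..T}" for t x
      unfolding P_def by (auto intro!: derivative_eq_intros d1 that)
    show "((\<lambda>x. z1 t x - exp (K * t) * (a + b * t) * (m * (2 * x))) has_real_derivative
        z2 t x - exp (K * t) * (a + b * t) * (m * 2)) (at x)"
      if "t \<in> {0<..T}" for t x
      by (auto intro!: derivative_eq_intros d2 that)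
    fix t x assume t: "t \<in> {0<..T}" and pos: "z t x - P t x > 0"
    have "z t x > 0" using pos P0[of t x] t by auto
    from ineq[OF t this]
    have "zt t x \<le> z2 t x + K * z t x + b * (1 + m * x\<^sup>2)" by simp
    moreover have "b * (1 + m * x\<^sup>2) \<le> exp (K * t) * (b * (1 + m * (x\<^sup>2 + 2 * t)))"
    proof -
      have "1 * (b * (1 + m * x\<^sup>2)) \<le> exp (K * t) * (b * (1 + m * (x\<^sup>2 + 2 * t)))"
        using nonneg t by (intro mult_mono mult_left_mono add_left_mono) auto
      then show ?thesis by simp
    qed
    ultimately show "zt t x - Pt t x \<le> z2 t x - exp (K * t) * (a + b * t) * (m * 2) + K * (z t x - P t x)"
      unfolding Pt_def by (simp add: algebra_simps)
  qed (use t in auto)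
  then show ?thesis by (simp add: P_def)
qed

lemma weighted_estimate:
  fixes z zt z1 z2 :: "real \<Rightarrow> real \<Rightarrow> real"
  assumes cont: "continuous_on ({0..T} \<times> UNIV) (\<lambda>(t, x). z t x)"
    and bound: "\<And>t x. t \<in> {0..T} \<Longrightarrow> \<bar>z t x\<bar> \<le> B"
    and dt: "\<And>t x. t \<in> {0<..T} \<Longrightarrow> ((\<lambda>s. z s x) has_real_derivative zt t x) (at t within {0..T})"
    and d1: "\<And>t x. t \<in> {0<..T} \<Longrightarrow> (z t has_real_derivative z1 t x) (at x)"
    and d2: "\<And>t x. t \<in> {0<..T} \<Longrightarrow> (z1 t has_real_derivative z2 t x) (at x)"
    and init: "\<And>x. \<bar>z 0 x\<bar> \<le> a * (1 + m * x\<^sup>2)"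
    and ineq: "\<And>t x. t \<in> {0<..T} \<Longrightarrow> \<bar>zt t x - z2 t x\<bar> \<le> K * \<bar>z t x\<bar> + b * (1 + m * x\<^sup>2)"
    and nonneg: "a \<ge> 0" "b \<ge> 0" "K \<ge> 0" "m \<ge> 0"
    and t: "t \<in> {0..T}"
  shows "\<bar>z t x\<bar> \<le> exp (K * t) * (a + b * t) * (1 + m * (x\<^sup>2 + 2 * t))"
proof -
  have "z t x \<le> exp (K * t) * (a + b * t) * (1 + m * (x\<^sup>2 + 2 * t))"
  proof (rule weighted_upper[OF cont _ dt d1 d2 _ _ nonneg t])
    show "z t x \<le> B" if "t \<in> {0..T}" for t x using bound[OF that, of x] by simp
    show "z 0 x \<le> a * (1 + m * x\<^sup>2)" for x using init[of x] by simp
    show "zt t x - z2 t x \<le> K * z t x + b * (1 + m * x\<^sup>2)" if "t \<in> {0<..T}" "z t x > 0" for t x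
      using ineq[OF that(1), of x] that(2) by simp
  qed
  moreover have "- z t x \<le> exp (K * t) * (a + b * t) * (1 + m * (x\<^sup>2 + 2 * t))"
  proof (rule weighted_upper[where z = "\<lambda>t x. - z t x" and zt = "\<lambda>t x. - zt t x"
      and ?z1.0 = "\<lambda>t x. - z1 t x" and ?z2.0 = "\<lambda>t x. - z2 t x", OF _ _ _ _ _ _ _ nonneg t])
    show "continuous_on ({0..T} \<times> UNIV) (\<lambda>(t, x). - z t x)"
      using cont unfolding split_beta' by (intro continuous_intros)
    show "- z t x \<le> B" if "t \<in> {0..T}" for t x using bound[OF that, of x] by simp
    show "- z 0 x \<le> a * (1 + m * x\<^sup>2)" for x using init[of x] by simp
    show "- zt t x - - z2 t x \<le> K * - z t x + b * (1 + m * x\<^sup>2)" if "t \<in> {0<..T}" "- z t x > 0" for t x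
      using ineq[OF that(1), of x] that(2) by simp
  qed (auto intro!: derivative_eq_intros dt d1 d2)
  ultimately show ?thesis by simp
qed

section \<open>Integrals with variable limits\<close>

text \<open>
The chain rule along a curve \<open>(\<alpha> r, \<beta> r)\<close>; it is used for limits and sources of integrals that
move together and for averages whose radius and function both depend on time.
\<close>

lemma diagonal_DERIV:
  fixes I Ib :: "real \<Rightarrow> real \<Rightarrow> real"
  assumes a: "((\<lambda>a. I a (\<beta> r)) has_real_derivative Ia) (at (\<alpha> r) within A)"
    and b: "\<And>a b. a \<in> A \<Longrightarrow> b \<in> B \<Longrightarrow> ((\<lambda>b. I a b) has_real_derivative Ib a b) (at b within B)"
    and cont: "continuous_on (A \<times> B) (\<lambda>(a, b). Ib a b)"
    and curves: "(\<alpha> has_real_derivative a') (at r within R)" "(\<beta> has_real_derivative b') (at r within R)"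
      "\<alpha> ` R \<subseteq> A" "\<beta> ` R \<subseteq> B" "r \<in> R"
    and B: "convex B"
  shows "((\<lambda>r. I (\<alpha> r) (\<beta> r)) has_real_derivative Ia * a' + Ib (\<alpha> r) (\<beta> r) * b') (at r within R)"
proof -
  have rin: "\<alpha> r \<in> A" "\<beta> r \<in> B" using curves by auto
  have "((\<lambda>(a, b). I a b) has_derivative (\<lambda>(ta, tb). Ia * ta + blinfun_mult_right (Ib (\<alpha> r) (\<beta> r)) tb))
      (at (\<alpha> r, \<beta> r) within A \<times> B)"
  proof (rule has_derivative_partialsI)
    show "((\<lambda>a. I a (\<beta> r)) has_derivative (*) Ia) (at (\<alpha> r) within A)"
      using a by (simp add: has_field_derivative_def)
    show "((\<lambda>b. I a b) has_derivative blinfun_apply (blinfun_mult_right (Ib a b))) (at b within B)"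
      if "a \<in> A" "b \<in> B" for a b
      using b[OF that] by (simp add: has_field_derivative_def)
    have "continuous_on (A \<times> B) (\<lambda>q. blinfun_mult_right ((\<lambda>(a, b). Ib a b) q))"
      by (intro bounded_linear.continuous_on[OF bounded_linear_blinfun_mult_right] cont)
    then show "continuous (at (\<alpha> r, \<beta> r) within A \<times> B) (\<lambda>(a, b). blinfun_mult_right (Ib a b))"
      using rin by (auto simp: continuous_on_eq_continuous_within split_beta')
  qed (use rin B in auto)
  then have 1: "((\<lambda>(a, b). I a b) has_derivative (\<lambda>(ta, tb). Ia * ta + Ib (\<alpha> r) (\<beta> r) * tb))
      (at (\<alpha> r, \<beta> r) within (\<lambda>r. (\<alpha> r, \<beta> r)) ` R)"
    using curves(3,4) by (auto intro: has_derivative_subset)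
  have 2: "((\<lambda>r. (\<alpha> r, \<beta> r)) has_derivative (\<lambda>h. (a' * h, b' * h))) (at r within R)"
    using curves(1,2) by (intro has_derivative_Pair) (auto simp: has_field_derivative_def)
  have "((\<lambda>r. I (\<alpha> r) (\<beta> r)) has_derivative (\<lambda>h. Ia * (a' * h) + Ib (\<alpha> r) (\<beta> r) * (b' * h))) (at r within R)"
    using has_derivative_in_compose[OF 2 1] by simp
  moreover have "(\<lambda>h. Ia * (a' * h) + Ib (\<alpha> r) (\<beta> r) * (b' * h)) = (*) (Ia * a' + Ib (\<alpha> r) (\<beta> r) * b')"
    by (auto simp: fun_eq_iff algebra_simps)
  ultimately show ?thesis by (simp add: has_field_derivative_def)
qed

lemma integral_to_unit:
  fixes f :: "real \<Rightarrow> real"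
  assumes "continuous_on {a..b} f" "a \<le> b"
  shows "integral {a..b} f = integral {0..1} (\<lambda>\<theta>. (b - a) * f (a + \<theta> * (b - a)))"
proof -
  have sub: "(\<lambda>\<theta>. a + \<theta> * (b - a)) ` {0..1} \<subseteq> {a..b}"
  proof safe
    fix \<theta> :: real assume "\<theta> \<in> {0..1}"
    then have "0 \<le> \<theta> * (b - a)" "\<theta> * (b - a) \<le> 1 * (b - a)"
      using assms(2) mult_right_mono[of \<theta> 1 "b - a"] by auto
    then show "a + \<theta> * (b - a) \<in> {a..b}" by auto
  qed
  have "((\<lambda>\<theta>. (b - a) *\<^sub>R f (a + \<theta> * (b - a))) has_integral (integral {a + 0 * (b - a)..a + 1 * (b - a)} f)) {0..1}"
    by (rule has_integral_substitution[where c = a and d = b])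
       (use assms sub in \<open>auto intro!: derivative_eq_intros\<close>)
  then show ?thesis by (auto dest: integral_unique)
qed

lemma continuous_on_integral_variable_end:
  fixes H :: "real \<Rightarrow> real \<Rightarrow> real"
  assumes H: "continuous_on (A \<times> {d..T}) (\<lambda>(a, s). H a s)"
  shows "continuous_on (A \<times> {d..T}) (\<lambda>(a, b). integral {d..b} (H a))"
proof -
  have in01: "d + \<theta> * (b - d) \<in> {d..T}" if "\<theta> \<in> {0..1}" "b \<in> {d..T}" for \<theta> b
  proof -
    have "0 \<le> \<theta> * (b - d)" "\<theta> * (b - d) \<le> 1 * (b - d)"
      using that mult_right_mono[of \<theta> 1 "b - d"] by auto
    then show ?thesis using that by auto
  qed
  have "continuous_on ((A \<times> {d..T}) \<times> cbox 0 1)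
      (\<lambda>(q, \<theta>). (snd q - d) * (\<lambda>(a, s). H a s) (fst q, d + \<theta> * (snd q - d)))"
    unfolding split_beta'[where f = "\<lambda>q \<theta>. (snd q - d) * (\<lambda>(a, s). H a s) (fst q, d + \<theta> * (snd q - d))"]
    by (intro continuous_intros continuous_on_compose2[OF H]) (auto dest: in01)
  from integral_continuous_on_param[OF this]
  have "continuous_on (A \<times> {d..T}) (\<lambda>q. integral {0..1} (\<lambda>\<theta>. (snd q - d) * H (fst q) (d + \<theta> * (snd q - d))))"
    by simp
  then show ?thesis
  proof (rule continuous_on_eq)
    fix q assume q: "q \<in> A \<times> {d..T}"
    have "continuous_on {d..snd q} (H (fst q))"
      by (rule continuous_on_compose2[OF H, of _ "\<lambda>s. (fst q, s)", simplified])
         (use q in \<open>auto intro!: continuous_intros\<close>)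
    from integral_to_unit[OF this] q
    show "integral {0..1} (\<lambda>\<theta>. (snd q - d) * H (fst q) (d + \<theta> * (snd q - d))) = (\<lambda>(a, b). integral {d..b} (H a)) q"
      by (auto simp: split_beta')
  qed
qed

text \<open>
The derivative of \<open>t \<mapsto> \<integral>\<^bsub>d\<^esub>\<^sup>t \<Psi> t s ds\<close>.  The integrand is only given for \<open>s \<le> t\<close>; its
extension \<open>P\<close> by the oriented integral is continuously differentiable in \<open>t\<close> across the diagonal, so
the usual rule for an integral with a parameter and a variable limit applies.
\<close>

lemma triangle_DERIV:
  fixes \<Psi> H :: "real \<Rightarrow> real \<Rightarrow> real" and g :: "real \<Rightarrow> real"
  assumes H: "continuous_on ({d..T} \<times> {d..T}) (\<lambda>(t, s). H t s)"
    and g: "continuous_on {d..T} g"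
    and \<Psi>: "\<And>s t. s \<in> {d..T} \<Longrightarrow> t \<in> {s..T} \<Longrightarrow> \<Psi> t s = g s + integral {s..t} (\<lambda>\<tau>. H \<tau> s)"
    and t: "t \<in> {d..T}"
  shows "((\<lambda>t. integral {d..t} (\<Psi> t)) has_real_derivative g t + integral {d..t} (H t)) (at t within {d..T})"
proof -
  have H': "continuous_on ({d..T} \<times> {d..T}) (\<lambda>(s, t). H t s)"
    by (rule continuous_on_swap_args[OF H])
  define P where "P t s = g s - integral {d..s} (\<lambda>\<tau>. H \<tau> s) + integral {d..t} (\<lambda>\<tau>. H \<tau> s)" for t s
  have cH1: "continuous_on {d..T} (\<lambda>\<tau>. H \<tau> s)" if "s \<in> {d..T}" for s
    by (rule continuous_on_compose2[OF H, of _ "\<lambda>\<tau>. (\<tau>, s)", simplified])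
       (use that in \<open>auto intro!: continuous_intros\<close>)
  have cJ: "continuous_on ({d..T} \<times> {d..T}) (\<lambda>(s, t). integral {d..t} (\<lambda>\<tau>. H \<tau> s))"
    by (rule continuous_on_integral_variable_end[OF H'])
  have cP: "continuous_on ({d..T} \<times> {d..T}) (\<lambda>(t, s). P t s)"
    unfolding P_def split_beta'
    by (intro continuous_intros continuous_on_compose2[OF g]
        continuous_on_compose2[OF cJ, of _ "\<lambda>q. (snd q, snd q)", simplified]
        continuous_on_compose2[OF cJ, of _ "\<lambda>q. (snd q, fst q)", simplified]) auto
  have P_eq: "P t s = \<Psi> t s" if "s \<in> {d..T}" "t \<in> {s..T}" for s t
  proof -
    have "integral {d..s} (\<lambda>\<tau>. H \<tau> s) + integral {s..t} (\<lambda>\<tau>. H \<tau> s) = integral {d..t} (\<lambda>\<tau>. H \<tau> s)"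
      using that by (intro Henstock_Kurzweil_Integration.integral_combine integrable_continuous_real
          continuous_on_subset[OF cH1[of s]]) auto
    then show ?thesis using \<Psi>[OF that] by (simp add: P_def)
  qed
  have "((\<lambda>r. integral {d..r} (P r)) has_real_derivative integral {d..t} (H t) * 1 + P t t * 1) (at t within {d..T})"
  proof (rule diagonal_DERIV[where I = "\<lambda>a b. integral {d..b} (P a)" and Ib = P and \<alpha> = "\<lambda>x. x" and \<beta> = "\<lambda>x. x"
        and A = "{d..T}" and B = "{d..T}"])
    have "((\<lambda>a. integral (cbox d t) (P a)) has_field_derivative integral (cbox d t) (H t)) (at t within {d..T})"
    proof (rule leibniz_rule_field_derivative)
      show "((\<lambda>t. P t s) has_field_derivative H u s) (at u within {d..T})" if "u \<in> {d..T}" "s \<in> cbox d t" for u s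
        unfolding P_def using that t
        by (auto intro!: derivative_eq_intros integral_has_real_derivative[OF cH1])
      show "P a integrable_on cbox d t" if "a \<in> {d..T}" for a
        using that t by (auto intro!: integrable_continuous_interval continuous_on_compose2[OF cP, of _ "\<lambda>s. (a, s)", simplified] continuous_intros)
      show "continuous_on ({d..T} \<times> cbox d t) (\<lambda>(t, s). H t s)"
        by (rule continuous_on_subset[OF H]) (use t in auto)
    qed (use t in auto)
    then show "((\<lambda>a. integral {d..t} (P a)) has_real_derivative integral {d..t} (H t)) (at t within {d..T})" by simp
    show "((\<lambda>b. integral {d..b} (P a)) has_real_derivative P a b) (at b within {d..T})"
      if "a \<in> {d..T}" "b \<in> {d..T}" for a b
      by (rule integral_has_real_derivative)
         (use that in \<open>auto intro!: continuous_on_compose2[OF cP, of _ "\<lambda>s. (a, s)", simplified] continuous_intros\<close>)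
  qed (use cP t in auto)
  moreover have "P t t = g t" by (simp add: P_def)
  ultimately have "((\<lambda>r. integral {d..r} (P r)) has_real_derivative g t + integral {d..t} (H t)) (at t within {d..T})"
    by (simp add: add.commute)
  then show ?thesis
    by (rule has_field_derivative_transform_within[OF _ zero_less_one t])
       (auto intro!: integral_cong simp: P_eq)
qed

section \<open>Duhamel integrals and mild solutions\<close>

definition heat :: "real \<Rightarrow> (real \<Rightarrow> real) \<Rightarrow> real \<Rightarrow> real" where
  "heat t w = gauss_avg 1 (sqrt (2 * t)) w"

text \<open>
The diffusion coefficient \<open>\<kappa>\<close> is 1 for the heat equation; \<open>\<kappa> = 0\<close> turns a mild solution into the
integral form of an ordinary differential equation.
\<close>

definition duhamel :: "real \<Rightarrow> real \<Rightarrow> (real \<Rightarrow> real \<Rightarrow> real) \<Rightarrow> real \<Rightarrow> real \<Rightarrow> real" where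
  "duhamel \<kappa> d g t x = integral {d..t} (\<lambda>s. gauss_avg 1 (sqrt (2 * \<kappa> * (t - s))) (g s) x)"

lemma duhamel_heat: "duhamel 1 d g t x = integral {d..t} (\<lambda>s. heat (t - s) (g s) x)"
  by (simp add: duhamel_def heat_def)

lemma duhamel_integrand_continuous:
  assumes "cont_bdd {d..} g" "\<kappa> \<ge> 0"
  shows "continuous_on {d..t} (\<lambda>s. gauss_avg 1 (sqrt (2 * \<kappa> * (t - s))) (g s) x)"
  by (intro continuous_on_gauss_avg[OF assms(1)] continuous_intros) auto

text \<open>
The substitution \<open>s = t - \<theta>\<^sup>2 * (t - d)\<close> moves all parameters into the integrand and cancels the
singularity \<open>1 / sqrt (t - s)\<close> that a space derivative produces.
\<close>

lemma duhamel_unit: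
  assumes g: "cont_bdd {d..} g" and t: "d \<le> t" and k: "\<kappa> \<ge> 0"
  shows "duhamel \<kappa> d g t x = integral {0..1} (\<lambda>\<theta>. (2 * \<theta> * (t - d)) *
    gauss_avg 1 (\<theta> * sqrt (2 * \<kappa> * (t - d))) (g (t - \<theta>\<^sup>2 * (t - d))) x)"
proof (cases "t = d")
  case True
  then show ?thesis by (simp add: duhamel_def)
next
  case False
  then have dt: "d < t" using t by simp
  define f where "f s = gauss_avg 1 (sqrt (2 * \<kappa> * (t - s))) (g s) x" for s
  have sub: "(\<lambda>\<theta>. t - \<theta>\<^sup>2 * (t - d)) ` {0..1} \<subseteq> {d..t}"
  proof safe
    fix \<theta> :: real assume "\<theta> \<in> {0..1}"
    then have "0 \<le> \<theta>\<^sup>2 * (t - d)" "\<theta>\<^sup>2 * (t - d) \<le> 1 * (t - d)"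
      using t mult_right_mono[of "\<theta>\<^sup>2" 1 "t - d"] by (auto simp: power_le_one)
    then show "t - \<theta>\<^sup>2 * (t - d) \<in> {d..t}" by auto
  qed
  have "((\<lambda>\<theta>. (- (2 * \<theta> * (t - d))) *\<^sub>R f (t - \<theta>\<^sup>2 * (t - d))) has_integral
      (integral {t - 0\<^sup>2 * (t - d)..t - 1\<^sup>2 * (t - d)} f - integral {t - 1\<^sup>2 * (t - d)..t - 0\<^sup>2 * (t - d)} f)) {0..1}"
    by (rule has_integral_substitution_general[where s = "{}" and c = d and d = t])
       (use sub duhamel_integrand_continuous[OF g k] in
         \<open>auto simp: f_def intro!: derivative_eq_intros continuous_intros\<close>)
  then have "((\<lambda>\<theta>. - ((2 * \<theta> * (t - d)) * f (t - \<theta>\<^sup>2 * (t - d)))) has_integral (- integral {d..t} f)) {0..1}"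
    using dt by simp
  then have "((\<lambda>\<theta>. (2 * \<theta> * (t - d)) * f (t - \<theta>\<^sup>2 * (t - d))) has_integral (integral {d..t} f)) {0..1}"
    by (simp add: has_integral_neg_iff)
  moreover have "(2 * \<theta> * (t - d)) * f (t - \<theta>\<^sup>2 * (t - d)) = (2 * \<theta> * (t - d)) *
    gauss_avg 1 (\<theta> * sqrt (2 * \<kappa> * (t - d))) (g (t - \<theta>\<^sup>2 * (t - d))) x" if "\<theta> \<in> {0..1}" for \<theta>
  proof -
    have "sqrt (2 * \<kappa> * (t - (t - \<theta>\<^sup>2 * (t - d)))) = sqrt (\<theta>\<^sup>2 * (2 * \<kappa> * (t - d)))"
      by (simp add: algebra_simps)
    also have "\<dots> = \<theta> * sqrt (2 * \<kappa> * (t - d))"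
      using that by (subst real_sqrt_mult) simp
    finally show ?thesis by (simp add: f_def)
  qed
  ultimately have "((\<lambda>\<theta>. (2 * \<theta> * (t - d)) *
    gauss_avg 1 (\<theta> * sqrt (2 * \<kappa> * (t - d))) (g (t - \<theta>\<^sup>2 * (t - d))) x) has_integral (integral {d..t} f)) {0..1}"
    by (rule has_integral_eq[rotated])
  then show ?thesis unfolding duhamel_def f_def[symmetric] by (rule integral_unique[symmetric])
qed

lemma unit_in: "\<theta> \<in> {0..1} \<Longrightarrow> d \<le> t \<Longrightarrow> d \<le> t - \<theta>\<^sup>2 * (t - d)" for \<theta> d t :: real
  using mult_right_mono[of "\<theta>\<^sup>2" 1 "t - d"] by (auto simp: power_le_one)

lemma abs_duhamel_le:
  assumes g: "cont_bdd {d..} g" and t: "d \<le> t" and k: "\<kappa> \<ge> 0"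
    and b: "continuous_on {d..t} b" "\<And>s x. s \<in> {d..t} \<Longrightarrow> \<bar>g s x\<bar> \<le> b s"
  shows "\<bar>duhamel \<kappa> d g t x\<bar> \<le> integral {d..t} b"
proof -
  have "norm (integral {d..t} (\<lambda>s. gauss_avg 1 (sqrt (2 * \<kappa> * (t - s))) (g s) x)) \<le> integral {d..t} b"
  proof (rule integral_norm_bound_integral)
    show "norm (gauss_avg 1 (sqrt (2 * \<kappa> * (t - s))) (g s) x) \<le> b s" if "s \<in> {d..t}" for s
      using abs_gauss_avg_le[OF cont_bdd_slice[OF g] b(2)[OF that]] that by auto
  qed (use b duhamel_integrand_continuous[OF g k] in \<open>auto intro!: integrable_continuous_real\<close>)
  then show ?thesis by (simp add: duhamel_def)
qed

lemma continuous_unit_integrand: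
  assumes g: "cont_bdd {d..} g" and k: "\<kappa> \<ge> 0" and U: "U \<subseteq> {d..} \<times> UNIV"
    and c: "continuous_on (U \<times> cbox 0 1) c"
  shows "continuous_on (U \<times> cbox 0 1) (\<lambda>(q, \<theta>). c (q, \<theta>) *
    gauss_avg p (\<theta> * sqrt (2 * \<kappa> * (fst q - d))) (g (fst q - \<theta>\<^sup>2 * (fst q - d))) (snd q))"
proof -
  have "continuous_on (U \<times> cbox 0 1) (\<lambda>v. c v *
    gauss_avg p (snd v * sqrt (2 * \<kappa> * (fst (fst v) - d)))
      (g (fst (fst v) - (snd v)\<^sup>2 * (fst (fst v) - d))) (snd (fst v)))"
    by (intro continuous_intros c continuous_on_gauss_avg[OF g]) (use U unit_in in \<open>force simp: subset_iff\<close>)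
  then show ?thesis by (simp add: split_beta')
qed

lemma cont_bdd_duhamel:
  assumes g: "cont_bdd {d..} g" and k: "\<kappa> \<ge> 0"
  shows "cont_bdd {d..} (duhamel \<kappa> d g)"
proof (rule cont_bddI)
  have "continuous_on (({d..} \<times> UNIV) \<times> cbox 0 1) (\<lambda>(q, \<theta>). (2 * \<theta> * (fst q - d)) *
    gauss_avg 1 (\<theta> * sqrt (2 * \<kappa> * (fst q - d))) (g (fst q - \<theta>\<^sup>2 * (fst q - d))) (snd q))"
    using continuous_unit_integrand[OF g k order_refl, of "\<lambda>v. 2 * snd v * (fst (fst v) - d)" 1]
    by (simp add: continuous_intros)
  from integral_continuous_on_param[OF this]
  show "continuous_on ({d..} \<times> UNIV) (\<lambda>(t, x). duhamel \<kappa> d g t x)"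
    by (rule continuous_on_eq) (auto simp: duhamel_unit[OF g _ k])
  fix C assume C: "compact C" "C \<subseteq> {d..}"
  then obtain T where T: "C \<subseteq> {d..T}"
    using compact_imp_bounded[OF C(1)] by (auto simp: bounded_iff subset_iff) (metis abs_le_D1)
  obtain B where B: "B > 0" "\<And>s x. s \<in> {d..T} \<Longrightarrow> \<bar>g s x\<bar> \<le> B"
    using cont_bdd_boundE[OF g, of "{d..T}"] by auto
  have "\<bar>duhamel \<kappa> d g s x\<bar> \<le> (T - d) * B" if "s \<in> C" for s x
  proof -
    have s: "s \<in> {d..T}" using that T by auto
    have "\<bar>duhamel \<kappa> d g s x\<bar> \<le> integral {d..s} (\<lambda>_. B)"
      using s by (intro abs_duhamel_le[OF g _ k] B) auto
    also have "\<dots> = (s - d) * B" using s by simp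
    also have "\<dots> \<le> (T - d) * B" using s B(1) by (intro mult_right_mono) auto
    finally show ?thesis .
  qed
  then show "\<exists>B. \<forall>s\<in>C. \<forall>x. \<bar>duhamel \<kappa> d g s x\<bar> \<le> B" by blast
qed

lemma duhamel_diff:
  assumes g: "cont_bdd {d..} g" and h: "cont_bdd {d..} h" and t: "d \<le> t" and k: "\<kappa> \<ge> 0"
  shows "duhamel \<kappa> d g t x - duhamel \<kappa> d h t x = duhamel \<kappa> d (\<lambda>s x. g s x - h s x) t x"
proof -
  have "gauss_avg 1 r (\<lambda>x. g s x - h s x) x = gauss_avg 1 r (g s) x - gauss_avg 1 r (h s) x" if s: "s \<in> {d..t}" for s r
  proof -
    have s': "s \<in> {d..}" using s by simp
    obtain B where B: "\<And>x. \<bar>g s x\<bar> \<le> B" using cont_bdd_bound_at[OF g s'] by blast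
    obtain B' where B': "\<And>x. \<bar>h s x\<bar> \<le> B'" using cont_bdd_bound_at[OF h s'] by blast
    show ?thesis by (rule gauss_avg_diff[OF cont_bdd_slice[OF g s'] B cont_bdd_slice[OF h s'] B'])
  qed
  then have "duhamel \<kappa> d (\<lambda>s x. g s x - h s x) t x = integral {d..t} (\<lambda>s. gauss_avg 1 (sqrt (2 * \<kappa> * (t - s))) (g s) x
     - gauss_avg 1 (sqrt (2 * \<kappa> * (t - s))) (h s) x)"
    unfolding duhamel_def by (intro integral_cong) auto
  then show ?thesis
    unfolding duhamel_def
    by (simp add: integral_diff integrable_continuous_real duhamel_integrand_continuous[OF g k] duhamel_integrand_continuous[OF h k])
qed

lemma exp_integral: "\<mu> > 0 \<Longrightarrow> t \<ge> 0 \<Longrightarrow> integral {0..t} (\<lambda>s. c * exp (\<mu> * s)) = c * (exp (\<mu> * t) - 1) / \<mu>" for \<mu> t :: real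
proof (rule integral_unique)
  assume "\<mu> > 0" "t \<ge> 0"
  then have "((\<lambda>s. c * exp (\<mu> * s)) has_integral (c * exp (\<mu> * t) / \<mu> - c * exp (\<mu> * 0) / \<mu>)) {0..t}"
    by (intro fundamental_theorem_of_calculus)
       (auto intro!: derivative_eq_intros simp: has_real_derivative_iff_has_vector_derivative[symmetric])
  then show "((\<lambda>s. c * exp (\<mu> * s)) has_integral (c * (exp (\<mu> * t) - 1) / \<mu>)) {0..t}"
    by (simp add: diff_divide_distrib right_diff_distrib)
qed

text \<open>
Banach's fixed point theorem in the space of bounded continuous functions of \<open>(t, x)\<close>.  The unknown
is \<open>exp (- \<mu> * t) * u t x\<close>; for \<open>\<mu> = 2 * L + 1\<close> the map is a contraction with constant \<open>1/2\<close> on the whole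
half line, so that no continuation argument is necessary.  Negative times are identified with 0.
\<close>

lemma mild_solution_exists:
  fixes F :: "real \<Rightarrow> real \<Rightarrow> real \<Rightarrow> real"
  assumes u0: "continuous_on UNIV u0" "\<And>x. \<bar>u0 x\<bar> \<le> B" and k: "\<kappa> \<ge> 0"
    and F: "continuous_on ({0..} \<times> UNIV \<times> UNIV) (\<lambda>(t, x, v). F t x v)"
    and lip: "\<And>t x v v'. t \<ge> 0 \<Longrightarrow> \<bar>F t x v - F t x v'\<bar> \<le> L * \<bar>v - v'\<bar>"
    and F0: "\<And>t x. t \<ge> 0 \<Longrightarrow> F t x 0 = 0"
  obtains u where "cont_bdd {0..} u"
    "\<And>t x. t \<ge> 0 \<Longrightarrow> u t x = gauss_avg 1 (sqrt (2 * \<kappa> * t)) u0 x + duhamel \<kappa> 0 (\<lambda>s x. F s x (u s x)) t x"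
proof -
  have L: "L \<ge> 0" using order_trans[OF abs_ge_zero lip[of 0 0 1 0]] by simp
  define \<mu> where "\<mu> = 2 * L + 1"
  have \<mu>: "\<mu> > 0" using L by (simp add: \<mu>_def)
  have LF: "\<bar>F t x v\<bar> \<le> L * \<bar>v\<bar>" if "t \<ge> 0" for t x v
    using lip[OF that, of x v 0] F0[OF that, of x] by simp
  define G where "G v s x = F s x (exp (\<mu> * s) * apply_bcontfun v (s, x))" for v s x
  have Gb: "\<bar>G v s x\<bar> \<le> L * norm v * exp (\<mu> * s)" if "s \<ge> 0" for v s x
  proof -
    have "\<bar>G v s x\<bar> \<le> L * \<bar>exp (\<mu> * s) * apply_bcontfun v (s, x)\<bar>"
      unfolding G_def by (rule LF[OF that])
    also have "\<dots> \<le> L * (exp (\<mu> * s) * norm v)"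
      using norm_bounded[of v "(s, x)"] L unfolding abs_mult
      by (intro mult_left_mono mult_mono) auto
    finally show ?thesis by (simp add: mult_ac)
  qed
  have G: "cont_bdd {0..} (G v)" for v
  proof (rule cont_bddI)
    have "continuous_on ({0..} \<times> UNIV) (\<lambda>q. (\<lambda>(t, x, v). F t x v) (fst q, snd q, exp (\<mu> * fst q) * apply_bcontfun v q))"
      by (rule continuous_on_compose2[OF F]) (auto intro!: continuous_intros)
    then show "continuous_on ({0..} \<times> UNIV) (\<lambda>(s, x). G v s x)" by (simp add: G_def split_beta')
    fix C :: "real set" assume C: "compact C" "C \<subseteq> {0..}"
    then obtain T where T: "\<And>s. s \<in> C \<Longrightarrow> s \<le> T"
      using compact_imp_bounded[OF C(1)] by (auto simp: bounded_iff) (metis abs_le_D1)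
    have "\<bar>G v s x\<bar> \<le> L * norm v * exp (\<mu> * T)" if "s \<in> C" for s x
    proof -
      have "\<bar>G v s x\<bar> \<le> L * norm v * exp (\<mu> * s)" using C that by (intro Gb) auto
      also have "\<dots> \<le> L * norm v * exp (\<mu> * T)"
        using T[OF that] \<mu> L by (intro mult_left_mono) auto
      finally show ?thesis .
    qed
    then show "\<exists>B. \<forall>s\<in>C. \<forall>x. \<bar>G v s x\<bar> \<le> B" by blast
  qed
  have duhamel_exp: "exp (- \<mu> * t) * \<bar>duhamel \<kappa> 0 g t x\<bar> \<le> c / \<mu>"
    if g: "cont_bdd {0..} g" and t: "t \<ge> 0" and c: "c \<ge> 0" "\<And>s x. s \<ge> 0 \<Longrightarrow> \<bar>g s x\<bar> \<le> c * exp (\<mu> * s)" for g t x c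
  proof -
    have "\<bar>duhamel \<kappa> 0 g t x\<bar> \<le> integral {0..t} (\<lambda>s. c * exp (\<mu> * s))"
      using t c by (intro abs_duhamel_le[OF g _ k] continuous_intros) auto
    also have "\<dots> = c * (exp (\<mu> * t) - 1) / \<mu>" by (rule exp_integral[OF \<mu> t])
    also have "\<dots> \<le> c * exp (\<mu> * t) / \<mu>" using c \<mu> by (intro divide_right_mono mult_left_mono) auto
    finally have "exp (- \<mu> * t) * \<bar>duhamel \<kappa> 0 g t x\<bar> \<le> exp (- \<mu> * t) * (c * exp (\<mu> * t) / \<mu>)"
      by (intro mult_left_mono) auto
    also have "\<dots> = c / \<mu>" by (simp add: exp_minus field_simps)
    finally show ?thesis .
  qed
  define S where "S v = (\<lambda>q. exp (- \<mu> * max (fst q) 0) * (gauss_avg 1 (sqrt (2 * \<kappa> * max (fst q) 0)) u0 (snd q)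
      + duhamel \<kappa> 0 (G v) (max (fst q) 0) (snd q)))" for v :: "(real \<times> real) \<Rightarrow>\<^sub>C real"
  have u0l: "cont_bdd (UNIV :: real set) (\<lambda>_. u0)" by (rule cont_bdd_const[OF u0])
  have S: "S v \<in> bcontfun" for v
  proof (rule bcontfun_normI)
    show "continuous_on UNIV (S v)" unfolding S_def
      by (intro continuous_intros continuous_on_gauss_avg[OF u0l] cont_bdd_compose[OF cont_bdd_duhamel[OF G k]]) auto
    show "norm (S v q) \<le> B + L * norm v / \<mu>" for q
    proof -
      let ?t = "max (fst q) 0"
      have "norm (S v q) \<le> exp (- \<mu> * ?t) * \<bar>gauss_avg 1 (sqrt (2 * \<kappa> * ?t)) u0 (snd q)\<bar>
          + exp (- \<mu> * ?t) * \<bar>duhamel \<kappa> 0 (G v) ?t (snd q)\<bar>"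
        unfolding S_def by (simp add: abs_mult flip: distrib_left)
      also have "\<dots> \<le> 1 * B + L * norm v / \<mu>"
        using \<mu> L by (intro add_mono mult_mono abs_gauss_avg_le u0 duhamel_exp G Gb) auto
      finally show ?thesis by simp
    qed
  qed
  define \<Phi> where "\<Phi> v = Bcontfun (S v)" for v
  have \<Phi>: "apply_bcontfun (\<Phi> v) q = S v q" for v q
    unfolding \<Phi>_def by (simp add: Bcontfun_inverse[OF S])
  have "\<exists>!v. \<Phi> v = v"
  proof (rule banach_fix_type[of "1/2"])
    show "\<forall>v w. dist (\<Phi> v) (\<Phi> w) \<le> 1 / 2 * dist v w"
    proof (intro allI dist_bound)
      fix v w :: "(real \<times> real) \<Rightarrow>\<^sub>C real" and q :: "real \<times> real"
      let ?t = "max (fst q) 0"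
      have "dist (S v q) (S w q) = exp (- \<mu> * ?t) * \<bar>duhamel \<kappa> 0 (\<lambda>s x. G v s x - G w s x) ?t (snd q)\<bar>"
        using duhamel_diff[OF G[of v] G[of w] _ k, of ?t "snd q"]
        by (simp add: S_def dist_real_def abs_mult flip: right_diff_distrib)
      also have "\<dots> \<le> (L * dist v w) / \<mu>"
      proof (rule duhamel_exp)
        show "cont_bdd {0..} (\<lambda>s x. G v s x - G w s x)"
          using contb_add[of "{0..}" True "G v" "\<lambda>t x. (- 1) * G w t x"] contb_mult[of "{0..}" True "\<lambda>_ _. - 1" "G w"]
            contb_time[of "{0..}" "\<lambda>_. - 1" True] G by (simp add: contb_def)
        fix s x :: real assume s: "s \<ge> 0"
        have "\<bar>G v s x - G w s x\<bar> \<le> L * \<bar>exp (\<mu> * s) * apply_bcontfun v (s, x) - exp (\<mu> * s) * apply_bcontfun w (s, x)\<bar>"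
          unfolding G_def by (rule lip[OF s])
        also have "\<dots> = L * (exp (\<mu> * s) * dist (apply_bcontfun v (s, x)) (apply_bcontfun w (s, x)))"
          by (simp add: dist_real_def abs_mult flip: right_diff_distrib)
        also have "\<dots> \<le> L * (exp (\<mu> * s) * dist v w)"
          using L by (intro mult_left_mono dist_bounded) auto
        finally show "\<bar>G v s x - G w s x\<bar> \<le> L * dist v w * exp (\<mu> * s)" by (simp add: mult_ac)
      qed (use L in auto)
      also have "\<dots> = L / \<mu> * dist v w" by simp
      also have "\<dots> \<le> 1 / 2 * dist v w"
        using L \<mu> by (intro mult_right_mono) (auto simp: \<mu>_def field_simps)
      finally show "dist (apply_bcontfun (\<Phi> v) q) (apply_bcontfun (\<Phi> w) q) \<le> 1 / 2 * dist v w"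
        by (simp add: \<Phi>)
    qed
  qed auto
  then obtain v where v: "\<Phi> v = v" by auto
  define u where "u t x = exp (\<mu> * t) * apply_bcontfun v (t, x)" for t x
  have Gu: "G v = (\<lambda>s x. F s x (u s x))" by (simp add: G_def u_def fun_eq_iff)
  have eq: "u t x = gauss_avg 1 (sqrt (2 * \<kappa> * t)) u0 x + duhamel \<kappa> 0 (G v) t x" if t: "t \<ge> 0" for t x
  proof -
    have "apply_bcontfun v (t, x) = S v (t, x)" using \<Phi>[of v "(t, x)"] v by simp
    then show ?thesis using t by (simp add: u_def S_def exp_minus field_simps)
  qed
  show ?thesis
  proof (rule that)
    have "contb {0..} True (\<lambda>t x. gauss_avg 1 (sqrt (2 * \<kappa> * t)) u0 x + duhamel \<kappa> 0 (G v) t x)"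
      by (intro contb_add) (auto simp: contb_def intro!: cont_bdd_gauss_avg cont_bdd_duhamel G k continuous_intros cont_bdd_subset[OF u0l])
    moreover have "contb {0..} True u = contb {0..} True (\<lambda>t x. gauss_avg 1 (sqrt (2 * \<kappa> * t)) u0 x + duhamel \<kappa> 0 (G v) t x)"
      by (rule contb_cong) (auto simp: eq)
    ultimately show "cont_bdd {0..} u" by (simp add: contb_def)
    show "u t x = gauss_avg 1 (sqrt (2 * \<kappa> * t)) u0 x + duhamel \<kappa> 0 (\<lambda>s x. F s x (u s x)) t x" if "t \<ge> 0" for t x
      using eq[OF that] by (simp add: Gu)
  qed
qed

section \<open>The heat semigroup and parabolic smoothing\<close>

context
  fixes w :: "real \<Rightarrow> real" and B :: real
  assumes w: "continuous_on UNIV w" "\<And>x. \<bar>w x\<bar> \<le> B"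
begin

lemma heat_DERIV_x:
  assumes "t > 0"
  shows "(heat t w has_real_derivative (- gauss_avg (gauss_deriv 1) (sqrt (2 * t)) w x / sqrt (2 * t))) (at x)"
  using gauss_avg_DERIV_x[OF _ w, of "sqrt (2 * t)" 1 x] assms by (simp add: heat_def)

lemma heat_DERIV_xx:
  assumes "t > 0"
  shows "((\<lambda>x. - gauss_avg (gauss_deriv 1) (sqrt (2 * t)) w x / sqrt (2 * t)) has_real_derivative
    gauss_avg (gauss_deriv (gauss_deriv 1)) (sqrt (2 * t)) w x / (2 * t)) (at x)"
  using assms by (auto intro!: derivative_eq_intros gauss_avg_DERIV_x[OF _ w])

lemma heat_DERIV_t:
  assumes "t > 0"
  shows "((\<lambda>t. heat t w x) has_real_derivative gauss_avg (gauss_deriv (gauss_deriv 1)) (sqrt (2 * t)) w x / (2 * t)) (at t)"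
proof -
  have "((\<lambda>t. sqrt (2 * t)) has_real_derivative 1 / sqrt (2 * t)) (at t)"
    using assms by (auto intro!: derivative_eq_intros simp: field_simps)
  from DERIV_chain2[OF gauss_avg_DERIV_r[OF _ w] this, of x] assms show ?thesis
    by (simp add: heat_def)
qed

lemma heat_continuous: "continuous_on ({0..} \<times> UNIV) (\<lambda>(t, x). heat t w x)"
  unfolding heat_def split_beta'
  by (intro continuous_on_gauss_avg[OF cont_bdd_const[OF w, of "UNIV :: real set"]] continuous_intros) auto

lemma heat_continuous_x: "t \<ge> 0 \<Longrightarrow> continuous_on UNIV (heat t w)"
  by (rule continuous_on_compose2[OF heat_continuous, of _ "\<lambda>x. (t, x)", simplified])
     (auto intro!: continuous_intros)

lemma abs_heat_le: "\<bar>heat t w x\<bar> \<le> B"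
  unfolding heat_def by (rule abs_gauss_avg_le[OF w])

end

lemma heat_0 [simp]: "heat 0 w x = w x"
  by (simp add: heat_def)

text \<open>
Both sides solve the heat equation with the same initial value; the maximum principle replaces
the convolution identity for Gaussian densities.
\<close>

lemma heat_add:
  assumes w: "continuous_on UNIV w" "\<And>x. \<bar>w x\<bar> \<le> B" and b: "b \<ge> 0" and t: "t \<ge> 0"
  shows "heat t (heat b w) x = heat (t + b) w x"
proof -
  note hb = heat_continuous_x[OF w b] abs_heat_le[OF w, of b]
  define q where "q t w x = gauss_avg (gauss_deriv (gauss_deriv 1)) (sqrt (2 * t)) w x / (2 * t)" for t w x
  define q1 where "q1 t w x = - gauss_avg (gauss_deriv 1) (sqrt (2 * t)) w x / sqrt (2 * t)" for t w x
  have "\<bar>heat t (heat b w) x - heat (t + b) w x\<bar> \<le> exp (0 * t) * (0 + 0 * t) * (1 + 0 * (x\<^sup>2 + 2 * t))"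
  proof (rule weighted_estimate[where T = t and z = "\<lambda>t x. heat t (heat b w) x - heat (t + b) w x" and B = "B + B"
      and zt = "\<lambda>t x. q t (heat b w) x - q (t + b) w x" and ?z2.0 = "\<lambda>t x. q t (heat b w) x - q (t + b) w x"
      and ?z1.0 = "\<lambda>t x. q1 t (heat b w) x - q1 (t + b) w x"])
    show "continuous_on ({0..t} \<times> UNIV) (\<lambda>(t, x). heat t (heat b w) x - heat (t + b) w x)"
      unfolding split_beta'
      by (intro continuous_intros continuous_on_compose2[OF heat_continuous[OF hb], of _ "\<lambda>q. q", simplified split_beta']
          continuous_on_compose2[OF heat_continuous[OF w], of _ "\<lambda>q. (fst q + b, snd q)", simplified])
         (use b in auto)
    show "\<bar>heat s (heat b w) x - heat (s + b) w x\<bar> \<le> B + B" for s x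
      by (intro order_trans[OF abs_triangle_ineq4] add_mono abs_heat_le[OF hb] abs_heat_le[OF w])
    fix s x assume s: "s \<in> {0<..t}"
    have "((\<lambda>t. heat (t + b) w x) has_real_derivative q (s + b) w x) (at s within {0..t})"
    proof -
      have "((\<lambda>t. heat t w x) has_real_derivative q (s + b) w x) (at (s + b))"
        unfolding q_def by (rule heat_DERIV_t[OF w]) (use s b in auto)
      moreover have "((\<lambda>t. t + b) has_real_derivative 1) (at s within {0..t})"
        by (auto intro!: derivative_eq_intros)
      ultimately have "((\<lambda>t. heat (t + b) w x) has_real_derivative q (s + b) w x * 1) (at s within {0..t})"
        by (rule DERIV_chain2)
      then show ?thesis by simp
    qed
    then show "((\<lambda>t. heat t (heat b w) x - heat (t + b) w x) has_real_derivative q s (heat b w) x - q (s + b) w x)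
        (at s within {0..t})"
      unfolding q_def using s
      by (intro DERIV_diff) (auto intro!: has_field_derivative_at_within[OF heat_DERIV_t[OF hb]])
    show "((\<lambda>x. heat s (heat b w) x - heat (s + b) w x) has_real_derivative q1 s (heat b w) x - q1 (s + b) w x) (at x)"
      unfolding q1_def using s b by (intro DERIV_diff heat_DERIV_x[OF hb] heat_DERIV_x[OF w]) auto
    show "((\<lambda>x. q1 s (heat b w) x - q1 (s + b) w x) has_real_derivative q s (heat b w) x - q (s + b) w x) (at x)"
      unfolding q1_def q_def using s b by (intro DERIV_diff heat_DERIV_xx[OF hb] heat_DERIV_xx[OF w]) auto
  qed (use t in auto)
  then show ?thesis by simp
qed

lemma gauss_poly_gauss_deriv_1_integral: "(LINT y|lborel. gauss_poly (gauss_deriv 1) y) = 0"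
proof -
  have "gauss_poly (gauss_deriv 1) y = - (std_normal_density y * y ^ (2 * 0 + 1))" for y
    by (simp add: gauss_poly_def gauss_deriv_def pderiv_pCons one_pCons)
  then show ?thesis using integral_std_normal_moment_odd[of 0] by simp
qed

lemma gauss_avg_gauss_deriv_1_0: "gauss_avg (gauss_deriv 1) 0 w x = 0"
  by (simp add: gauss_avg_def gauss_poly_gauss_deriv_1_integral)

text \<open>
The space derivative of \<open>duhamel 1 d g\<close> in the variable \<open>\<theta>\<close> of \<open>duhamel_unit\<close>.
\<close>

definition duhamel_dx :: "real \<Rightarrow> (real \<Rightarrow> real \<Rightarrow> real) \<Rightarrow> real \<Rightarrow> real \<Rightarrow> real" where
  "duhamel_dx d g t x = integral {0..1} (\<lambda>\<theta>. (- sqrt (2 * (t - d))) *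
     gauss_avg (gauss_deriv 1) (\<theta> * sqrt (2 * (t - d))) (g (t - \<theta>\<^sup>2 * (t - d))) x)"

text \<open>
One derivative is gained: the factor \<open>2 * \<theta> * (t - d)\<close> absorbs the factor \<open>1 / (\<theta> * sqrt (2 * (t - d)))\<close> coming
from the kernel.  At \<open>\<theta> = 0\<close> the formula remains true because the first moment of the Gaussian
density vanishes.
\<close>

lemma duhamel_DERIV_x:
  assumes g: "cont_bdd {d..} g" and t: "d < t"
  shows "(duhamel 1 d g t has_real_derivative duhamel_dx d g t x) (at x)"
proof -
  define l where "l = sqrt (2 * (t - d))"
  have l: "l > 0" "2 * (t - d) = l * l" using t by (auto simp: l_def)
  have gin: "t - \<theta>\<^sup>2 * (t - d) \<in> {d..}" if "\<theta> \<in> {0..1}" for \<theta> using unit_in[OF that] t by auto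
  have "((\<lambda>x. integral (cbox 0 1) (\<lambda>\<theta>. (2 * \<theta> * (t - d)) * gauss_avg 1 (\<theta> * l) (g (t - \<theta>\<^sup>2 * (t - d))) x))
      has_field_derivative integral (cbox 0 1) (\<lambda>\<theta>. (- l) * gauss_avg (gauss_deriv 1) (\<theta> * l) (g (t - \<theta>\<^sup>2 * (t - d))) x)) (at x within UNIV)"
  proof (rule leibniz_rule_field_derivative)
    fix x \<theta> :: real assume th: "\<theta> \<in> cbox 0 1"
    have s: "t - \<theta>\<^sup>2 * (t - d) \<in> {d..}" using gin th by simp
    obtain B where B: "\<And>x. \<bar>g (t - \<theta>\<^sup>2 * (t - d)) x\<bar> \<le> B" using cont_bdd_bound_at[OF g s] by blast
    show "((\<lambda>x. (2 * \<theta> * (t - d)) * gauss_avg 1 (\<theta> * l) (g (t - \<theta>\<^sup>2 * (t - d))) x) has_real_derivative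
        (- l) * gauss_avg (gauss_deriv 1) (\<theta> * l) (g (t - \<theta>\<^sup>2 * (t - d))) x) (at x within UNIV)"
    proof (cases "\<theta> = 0")
      case True
      then show ?thesis by (simp add: gauss_avg_gauss_deriv_1_0)
    next
      case False
      then have "\<theta> * l > 0" using th l by auto
      from gauss_avg_DERIV_x[OF this cont_bdd_slice[OF g s] B, of 1 x]
      have "((\<lambda>x. (2 * \<theta> * (t - d)) * gauss_avg 1 (\<theta> * l) (g (t - \<theta>\<^sup>2 * (t - d))) x) has_real_derivative
          (2 * \<theta> * (t - d)) * (- gauss_avg (gauss_deriv 1) (\<theta> * l) (g (t - \<theta>\<^sup>2 * (t - d))) x / (\<theta> * l))) (at x)"
        by (rule DERIV_cmult)
      moreover have "2 * \<theta> * (t - d) = \<theta> * (l * l)" unfolding l(2)[symmetric] by simp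
      then have "(2 * \<theta> * (t - d)) * (- A / (\<theta> * l)) = (- l) * A" for A using False l(1) by (simp add: field_simps)
      ultimately show ?thesis by simp
    qed
  next
    show "(\<lambda>\<theta>. (2 * \<theta> * (t - d)) * gauss_avg 1 (\<theta> * l) (g (t - \<theta>\<^sup>2 * (t - d))) x) integrable_on cbox 0 1" for x
      by (intro integrable_continuous continuous_intros continuous_on_gauss_avg[OF g]) (use gin in auto)
    show "continuous_on (UNIV \<times> cbox 0 1) (\<lambda>(x, \<theta>). (- l) * gauss_avg (gauss_deriv 1) (\<theta> * l) (g (t - \<theta>\<^sup>2 * (t - d))) x)"
      unfolding split_beta' by (intro continuous_intros continuous_on_gauss_avg[OF g]) (use gin in auto)
  qed auto
  moreover have "duhamel 1 d g t = (\<lambda>x. integral (cbox 0 1) (\<lambda>\<theta>. (2 * \<theta> * (t - d)) * gauss_avg 1 (\<theta> * l) (g (t - \<theta>\<^sup>2 * (t - d))) x))"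
    using duhamel_unit[OF g, of t 1] t by (simp add: fun_eq_iff l_def)
  ultimately show ?thesis by (simp add: duhamel_dx_def l_def)
qed

lemma compact_subset_atLeast:
  assumes "compact C" "C \<subseteq> {d..}"
  shows "\<exists>T::real. C \<subseteq> {d..T}"
proof -
  obtain T where "\<And>s. s \<in> C \<Longrightarrow> \<bar>s\<bar> \<le> T" using compact_imp_bounded[OF assms(1)] by (auto simp: bounded_iff)
  then have "C \<subseteq> {d..T}" using assms(2) by force
  then show ?thesis by blast
qed

lemma cont_bdd_duhamel_dx:
  assumes g: "cont_bdd {d..} g"
  shows "cont_bdd {d..} (duhamel_dx d g)"
proof (rule cont_bddI)
  have "continuous_on (({d..} \<times> UNIV) \<times> cbox 0 1) (\<lambda>(q, \<theta>). (- sqrt (2 * (fst q - d))) *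
    gauss_avg (gauss_deriv 1) (\<theta> * sqrt (2 * 1 * (fst q - d))) (g (fst q - \<theta>\<^sup>2 * (fst q - d))) (snd q))"
    using continuous_unit_integrand[OF g zero_le_one order_refl, of "\<lambda>v. - sqrt (2 * (fst (fst v) - d))" "gauss_deriv 1"]
    by (simp add: continuous_intros)
  from integral_continuous_on_param[OF this]
  show "continuous_on ({d..} \<times> UNIV) (\<lambda>(t, x). duhamel_dx d g t x)"
    by (simp add: duhamel_dx_def split_beta')
  fix C assume C: "compact C" "C \<subseteq> {d..}"
  then obtain T where T: "C \<subseteq> {d..T}" using compact_subset_atLeast by blast
  have "compact {d..T}" "{d..T} \<subseteq> {d..}" by auto
  from cont_bdd_boundE[OF g this] obtain B where B: "B > 0" "\<And>s x. s \<in> {d..T} \<Longrightarrow> \<bar>g s x\<bar> \<le> B" by metis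
  have "\<bar>duhamel_dx d g t x\<bar> \<le> sqrt (2 * (T - d)) * (B * gauss_poly_L1 (gauss_deriv 1))" if "t \<in> C" for t x
  proof -
    have t: "t \<in> {d..T}" using that T by auto
    have gin: "t - \<theta>\<^sup>2 * (t - d) \<in> {d..T}" if "\<theta> \<in> {0..1}" for \<theta>
    proof -
      have "0 \<le> \<theta>\<^sup>2 * (t - d)" using t by (intro mult_nonneg_nonneg) auto
      then have "t - \<theta>\<^sup>2 * (t - d) \<le> T" using t unfolding atLeastAtMost_iff by linarith
      then show ?thesis using unit_in[OF that, of d t] t by auto
    qed
    have "norm (duhamel_dx d g t x) \<le> integral {0..1::real} (\<lambda>_. sqrt (2 * (T - d)) * (B * gauss_poly_L1 (gauss_deriv 1)))"
      unfolding duhamel_dx_def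
    proof (rule integral_norm_bound_integral)
      show "(\<lambda>\<theta>. (- sqrt (2 * (t - d))) * gauss_avg (gauss_deriv 1) (\<theta> * sqrt (2 * (t - d))) (g (t - \<theta>\<^sup>2 * (t - d))) x) integrable_on {0..1}"
        by (intro integrable_continuous_real continuous_intros continuous_on_gauss_avg[OF g]) (use gin in auto)
      show "norm ((- sqrt (2 * (t - d))) * gauss_avg (gauss_deriv 1) (\<theta> * sqrt (2 * (t - d))) (g (t - \<theta>\<^sup>2 * (t - d))) x)
          \<le> sqrt (2 * (T - d)) * (B * gauss_poly_L1 (gauss_deriv 1))" if th: "\<theta> \<in> {0..1}" for \<theta>
      proof -
        have "\<bar>gauss_avg (gauss_deriv 1) (\<theta> * sqrt (2 * (t - d))) (g (t - \<theta>\<^sup>2 * (t - d))) x\<bar> \<le> B * gauss_poly_L1 (gauss_deriv 1)"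
          using gin[OF th] by (intro abs_gauss_avg_le_gauss_poly_L1 cont_bdd_slice[OF g] B(2)) auto
        then show ?thesis using t by (auto simp: abs_mult intro!: mult_mono)
      qed
    qed auto
    then show ?thesis by simp
  qed
  then show "\<exists>B. \<forall>s\<in>C. \<forall>x. \<bar>duhamel_dx d g s x\<bar> \<le> B" by blast
qed

lemma regular_cont_bdd_atLeast: "regular {0<..} True k g \<Longrightarrow> d > 0 \<Longrightarrow> cont_bdd {d..} g"
  by (rule cont_bdd_subset[OF regular_cont_bdd]) auto

lemma duhamel_DERIV_x_smooth:
  assumes g: "regular {0<..} True (Suc k) g" and d: "d > 0"
  shows "(duhamel 1 d g t has_real_derivative duhamel 1 d (\<lambda>s. deriv (g s)) t x) (at x)"
proof -
  have g': "regular {0<..} True k (\<lambda>s. deriv (g s))" using g by simp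
  note l = regular_cont_bdd_atLeast[OF g d] and l' = regular_cont_bdd_atLeast[OF g' d]
  have "((\<lambda>x. integral (cbox d t) (\<lambda>s. gauss_avg 1 (sqrt (2 * 1 * (t - s))) (g s) x)) has_field_derivative
    integral (cbox d t) (\<lambda>s. gauss_avg 1 (sqrt (2 * 1 * (t - s))) (deriv (g s)) x)) (at x within UNIV)"
  proof (rule leibniz_rule_field_derivative)
    fix x s assume s: "s \<in> cbox d t"
    then have s': "s \<in> {d..}" "s \<in> {0<..}" using d by auto
    obtain B where B: "\<And>x. \<bar>g s x\<bar> \<le> B" using cont_bdd_bound_at[OF l s'(1)] by blast
    obtain B' where B': "\<And>x. \<bar>deriv (g s) x\<bar> \<le> B'" using cont_bdd_bound_at[OF l' s'(1)] by blast
    show "((\<lambda>x. gauss_avg 1 (sqrt (2 * 1 * (t - s))) (g s) x) has_real_derivative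
        gauss_avg 1 (sqrt (2 * 1 * (t - s))) (deriv (g s)) x) (at x within UNIV)"
      using gauss_avg_DERIV_x_smooth[OF cont_bdd_slice[OF l s'(1)] B cont_bdd_slice[OF l' s'(1)] B' regular_Suc_DERIV[OF g s'(2)]]
      by simp
  next
    show "(\<lambda>s. gauss_avg 1 (sqrt (2 * 1 * (t - s))) (g s) x) integrable_on cbox d t" for x
      using duhamel_integrand_continuous[OF l, of 1 t x] by (auto intro!: integrable_continuous_real)
    show "continuous_on (UNIV \<times> cbox d t) (\<lambda>(x, s). gauss_avg 1 (sqrt (2 * 1 * (t - s))) (deriv (g s)) x)"
      unfolding split_beta' by (intro continuous_on_gauss_avg[OF l'] continuous_intros) auto
  qed auto
  then show ?thesis by (simp add: duhamel_def[abs_def])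
qed

text \<open>
All derivatives but the last fall on the source \<open>g\<close>, the last one on the kernel.  The derivatives of \<open>g\<close>
may blow up at time 0, hence \<open>d > 0\<close>.
\<close>

lemma regular_duhamel: "regular {0<..} True k g \<Longrightarrow> d > 0 \<Longrightarrow> regular {d<..} True (Suc k) (duhamel 1 d g)"
proof (induction k arbitrary: g)
  case 0
  note l = regular_cont_bdd_atLeast[OF 0]
  show ?case
    by (rule regular_SucI[where v = "duhamel_dx d g"])
       (auto simp: contb_def intro!: cont_bdd_subset[OF cont_bdd_duhamel[OF l]] cont_bdd_subset[OF cont_bdd_duhamel_dx[OF l]] duhamel_DERIV_x[OF l])
next
  case (Suc k)
  note l = regular_cont_bdd_atLeast[OF Suc.prems]
  show ?case
  proof (rule regular_SucI)
    show "regular {d<..} True (Suc k) (duhamel 1 d (\<lambda>s. deriv (g s)))"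
      by (rule Suc.IH) (use Suc.prems in auto)
    show "(duhamel 1 d g t has_real_derivative duhamel 1 d (\<lambda>s. deriv (g s)) t x) (at x)" for t x
      by (rule duhamel_DERIV_x_smooth[OF Suc.prems])
    show "contb {d<..} True (duhamel 1 d g)"
      by (auto simp: contb_def intro!: cont_bdd_subset[OF cont_bdd_duhamel[OF l]])
  qed
qed

text \<open>
Restarting at time \<open>d\<close> replaces the sources before \<open>d\<close> by one Gaussian average of the solution at
time \<open>d\<close>, which is smooth for later times.  The proof is the semigroup law under the integral.
\<close>

lemma duhamel_restart:
  assumes u0: "continuous_on UNIV u0" "\<And>x. \<bar>u0 x\<bar> \<le> B" and g: "cont_bdd {0..} g"
    and d: "0 \<le> d" "d \<le> t"
  shows "heat t u0 x + duhamel 1 0 g t x = heat (t - d) (\<lambda>x. heat d u0 x + duhamel 1 0 g d x) x + duhamel 1 d g t x"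
proof -
  have D: "cont_bdd {0..} (duhamel 1 0 g)" by (rule cont_bdd_duhamel[OF g]) simp
  have d0: "d \<in> {0..}" using d by simp
  obtain B' where B': "\<And>x. \<bar>duhamel 1 0 g d x\<bar> \<le> B'" using cont_bdd_bound_at[OF D d0] by blast
  have "compact {0..d}" "{0..d} \<subseteq> {0..}" by auto
  from cont_bdd_boundE[OF g this] obtain Bg where Bg: "Bg > 0" "\<And>s x. s \<in> {0..d} \<Longrightarrow> \<bar>g s x\<bar> \<le> Bg" by metis
  define r where "r = sqrt (2 * (t - d))"
  have hl: "cont_bdd {0..d} (\<lambda>s. heat (d - s) (g s))"
    unfolding heat_def by (intro cont_bdd_gauss_avg cont_bdd_subset[OF g] continuous_intros) auto
  have hb: "\<bar>heat (d - s) (g s) x\<bar> \<le> Bg" if "s \<in> {0..d}" for s x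
    using that by (intro abs_heat_le cont_bdd_slice[OF g] Bg) auto
  have "heat (t - d) (\<lambda>x. heat d u0 x + duhamel 1 0 g d x) x = heat (t - d) (heat d u0) x + heat (t - d) (duhamel 1 0 g d) x"
    unfolding heat_def[of "t - d"]
    using d0 by (intro gauss_avg_add[OF heat_continuous_x[OF u0] abs_heat_le[OF u0] cont_bdd_slice[OF D] B']) auto
  also have "heat (t - d) (heat d u0) x = heat t u0 x"
    using heat_add[OF u0, of d "t - d" x] d by simp
  also have "heat (t - d) (duhamel 1 0 g d) x = integral {0..d} (\<lambda>s. heat (t - s) (g s) x)"
  proof -
    have "heat (t - d) (duhamel 1 0 g d) x = (LINT y|lborel. integral {0..d} (\<lambda>s. heat (d - s) (g s) (x + r * y) * gauss_poly 1 y))"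
      by (simp add: heat_def[of "t - d"] gauss_avg_def duhamel_heat r_def)
    also have "\<dots> = integral {0..d} (\<lambda>s. LINT y|lborel. heat (d - s) (g s) (x + r * y) * gauss_poly 1 y)"
    proof (rule strip_integral_swap(2)[where C = "Bg * gauss_poly_L1 1"])
      show "continuous_on ({0..d} \<times> UNIV) (\<lambda>(s, y). heat (d - s) (g s) (x + r * y) * gauss_poly 1 y)"
        unfolding split_beta' by (intro continuous_intros cont_bdd_compose[OF hl]) auto
      show "continuous_on {0..d} (\<lambda>s. LINT y|lborel. heat (d - s) (g s) (x + r * y) * gauss_poly 1 y)"
        unfolding gauss_avg_def[symmetric] by (intro continuous_on_gauss_avg[OF hl] continuous_intros) auto
      fix s assume s: "s \<in> {0..d}"
      show i: "integrable lborel (\<lambda>y. heat (d - s) (g s) (x + r * y) * gauss_poly 1 y)"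
        by (rule gauss_avg_integrable[OF cont_bdd_slice[OF hl s] hb[OF s]])
      have "(LINT y|lborel. \<bar>heat (d - s) (g s) (x + r * y) * gauss_poly 1 y\<bar>) \<le> (LINT y|lborel. Bg * \<bar>gauss_poly 1 y\<bar>)"
        by (intro integral_mono integrable_abs i integrable_mult_right integrable_gauss_poly)
           (auto simp: abs_mult intro!: mult_right_mono hb[OF s])
      then show "(LINT y|lborel. \<bar>heat (d - s) (g s) (x + r * y) * gauss_poly 1 y\<bar>) \<le> Bg * gauss_poly_L1 1"
        by (simp add: gauss_poly_L1_def)
    qed
    also have "\<dots> = integral {0..d} (\<lambda>s. heat (t - d) (heat (d - s) (g s)) x)"
      by (simp add: heat_def[of "t - d"] gauss_avg_def r_def)
    also have "\<dots> = integral {0..d} (\<lambda>s. heat (t - s) (g s) x)"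
    proof (rule integral_cong)
      fix s assume s: "s \<in> {0..d}"
      then show "heat (t - d) (heat (d - s) (g s)) x = heat (t - s) (g s) x"
        using heat_add[OF cont_bdd_slice[OF g] Bg(2)[OF s], of "d - s" "t - d" x] d by simp
    qed
    finally show ?thesis .
  qed
  finally have "heat (t - d) (\<lambda>x. heat d u0 x + duhamel 1 0 g d x) x
      = heat t u0 x + integral {0..d} (\<lambda>s. heat (t - s) (g s) x)" .
  moreover have "integral {0..d} (\<lambda>s. heat (t - s) (g s) x) + duhamel 1 d g t x = duhamel 1 0 g t x"
    unfolding duhamel_heat using d duhamel_integrand_continuous[OF g, of 1 t x]
    by (intro Henstock_Kurzweil_Integration.integral_combine integrable_continuous_real) (auto simp: heat_def)
  ultimately show ?thesis by simp
qed

text \<open>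
For a twice differentiable function the two space derivatives can be moved from the kernel to
the function; the right-hand side then stays bounded as \<open>t\<close> tends to 0.
\<close>

lemma heat_DERIV_t_smooth:
  assumes w: "continuous_on UNIV w" "\<And>x. \<bar>w x\<bar> \<le> B"
    and w1: "continuous_on UNIV w1" "\<And>x. \<bar>w1 x\<bar> \<le> B1"
    and w2: "continuous_on UNIV w2" "\<And>x. \<bar>w2 x\<bar> \<le> B2"
    and d1: "\<And>x. (w has_real_derivative w1 x) (at x)" and d2: "\<And>x. (w1 has_real_derivative w2 x) (at x)"
    and t: "t > 0"
  shows "((\<lambda>t. heat t w x) has_real_derivative heat t w2 x) (at t)"
proof -
  have "(heat t w has_real_derivative heat t w1 x) (at x)" for x
    unfolding heat_def by (rule gauss_avg_DERIV_x_smooth[OF w w1 d1])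
  then have "heat t w1 x = - gauss_avg (gauss_deriv 1) (sqrt (2 * t)) w x / sqrt (2 * t)" for x
    using heat_DERIV_x[OF w t] DERIV_unique by blast
  then have "heat t w1 = (\<lambda>x. - gauss_avg (gauss_deriv 1) (sqrt (2 * t)) w x / sqrt (2 * t))" by (simp add: fun_eq_iff)
  moreover have "(heat t w1 has_real_derivative heat t w2 x) (at x)" for x
    unfolding heat_def by (rule gauss_avg_DERIV_x_smooth[OF w1 w2 d2])
  ultimately have "heat t w2 x = gauss_avg (gauss_deriv (gauss_deriv 1)) (sqrt (2 * t)) w x / (2 * t)"
    using heat_DERIV_xx[OF w t] DERIV_unique by metis
  then show ?thesis using heat_DERIV_t[OF w t] by simp
qed

lemma heat_FTC_smooth:
  assumes g: "regular {0<..} True (Suc (Suc k)) g" and s: "s > 0" "s \<le> t"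
  shows "heat (t - s) (g s) x = g s x + integral {s..t} (\<lambda>\<tau>. heat (max (\<tau> - s) 0) (deriv (deriv (g s))) x)"
proof -
  have s': "s \<in> {0<..}" using s by simp
  note l0 = regular_cont_bdd[OF g] and l1 = regular_cont_bdd[OF regular_deriv[OF g]] and l2 = regular_cont_bdd[OF regular_deriv[OF regular_deriv[OF g]]]
  obtain B0 where B0: "\<And>x. \<bar>g s x\<bar> \<le> B0" using cont_bdd_bound_at[OF l0 s'] by blast
  obtain B1 where B1: "\<And>x. \<bar>deriv (g s) x\<bar> \<le> B1" using cont_bdd_bound_at[OF l1 s'] by blast
  obtain B2 where B2: "\<And>x. \<bar>deriv (deriv (g s)) x\<bar> \<le> B2" using cont_bdd_bound_at[OF l2 s'] by blast
  note w = cont_bdd_slice[OF l0 s'] B0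
  have "((\<lambda>\<tau>. heat (max (\<tau> - s) 0) (deriv (deriv (g s))) x) has_integral heat (t - s) (g s) x - heat (s - s) (g s) x) {s..t}"
  proof (rule fundamental_theorem_of_calculus_interior)
    show "continuous_on {s..t} (\<lambda>\<tau>. heat (\<tau> - s) (g s) x)"
      by (rule continuous_on_compose2[OF heat_continuous[OF w], of _ "\<lambda>\<tau>. (\<tau> - s, x)", simplified])
         (auto intro!: continuous_intros)
    fix \<tau> assume \<tau>: "\<tau> \<in> {s<..<t}"
    have "((\<lambda>\<tau>. heat \<tau> (g s) x) has_real_derivative heat (\<tau> - s) (deriv (deriv (g s))) x) (at (\<tau> - s))"
      by (rule heat_DERIV_t_smooth[OF w cont_bdd_slice[OF l1 s'] B1 cont_bdd_slice[OF l2 s'] B2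
            regular_Suc_DERIV[OF g s'] regular_Suc_DERIV[OF regular_deriv[OF g] s']]) (use \<tau> in auto)
    moreover have "((\<lambda>\<tau>. \<tau> - s) has_real_derivative 1) (at \<tau>)" by (auto intro!: derivative_eq_intros)
    ultimately have "((\<lambda>\<tau>. heat (\<tau> - s) (g s) x) has_real_derivative heat (\<tau> - s) (deriv (deriv (g s))) x * 1) (at \<tau>)"
      by (rule DERIV_chain2)
    then show "((\<lambda>\<tau>. heat (\<tau> - s) (g s) x) has_vector_derivative heat (max (\<tau> - s) 0) (deriv (deriv (g s))) x) (at \<tau>)"
      using \<tau> by (simp add: has_real_derivative_iff_has_vector_derivative max_def)
  qed (use s in auto)
  then show ?thesis by (simp add: integral_unique)
qed

text \<open>
By \<open>heat_FTC_smooth\<close> the integrand is of the form required by \<open>triangle_DERIV\<close>.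
\<close>

lemma duhamel_DERIV_t:
  assumes g: "regular {0<..} True (Suc (Suc k)) g" and d: "d > 0" and t: "t > d"
  shows "((\<lambda>t. duhamel 1 d g t x) has_real_derivative
    g t x + duhamel 1 d (\<lambda>s. deriv (deriv (g s))) t x) (at t)"
proof -
  define T where "T = t + 1"
  note l0 = regular_cont_bdd_atLeast[OF g d] and l2 = regular_cont_bdd_atLeast[OF regular_deriv[OF regular_deriv[OF g]] d]
  have "((\<lambda>t. integral {d..t} (\<lambda>s. heat (t - s) (g s) x)) has_real_derivative
      g t x + integral {d..t} (\<lambda>s. heat (max (t - s) 0) (deriv (deriv (g s))) x)) (at t within {d..T})"
  proof (rule triangle_DERIV)
    show "continuous_on ({d..T} \<times> {d..T}) (\<lambda>(t, s). heat (max (t - s) 0) (deriv (deriv (g s))) x)"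
      unfolding split_beta' heat_def by (intro continuous_on_gauss_avg[OF l2] continuous_intros) auto
    show "continuous_on {d..T} (\<lambda>s. g s x)"
      by (intro cont_bdd_compose[OF l0] continuous_intros) auto
    show "heat (t - s) (g s) x = g s x + integral {s..t} (\<lambda>\<tau>. heat (max (\<tau> - s) 0) (deriv (deriv (g s))) x)"
      if "s \<in> {d..T}" "t \<in> {s..T}" for s t
      by (rule heat_FTC_smooth[OF g]) (use that d in auto)
  qed (use t in \<open>auto simp: T_def\<close>)
  moreover have "integral {d..t} (\<lambda>s. heat (max (t - s) 0) (deriv (deriv (g s))) x) = duhamel 1 d (\<lambda>s. deriv (deriv (g s))) t x"
    unfolding duhamel_heat by (intro integral_cong) (auto simp: max_def)
  ultimately show ?thesis
    using t by (simp add: duhamel_heat T_def at_within_Icc_at)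
qed

text \<open>
The bootstrap: \<open>u = heat (t - d) (u d) + duhamel 1 d g t\<close> has one more space derivative than \<open>g\<close>, and \<open>g\<close> has as
many as \<open>u\<close>.  Once two derivatives of \<open>g\<close> are available, both terms can be differentiated in time.
\<close>

lemma mild_solution_classical:
  fixes u g :: "real \<Rightarrow> real \<Rightarrow> real"
  assumes u0: "continuous_on UNIV u0" "\<And>x. \<bar>u0 x\<bar> \<le> B" and g: "cont_bdd {0..} g"
    and u: "\<And>t x. t \<ge> 0 \<Longrightarrow> u t x = heat t u0 x + duhamel 1 0 g t x"
    and bootstrap: "\<And>k. regular {0<..} True k u \<Longrightarrow> regular {0<..} True k g"
  shows "cont_bdd {0..} u" "regular {0<..} True k u"
    "t > 0 \<Longrightarrow> ((\<lambda>s. u s x) has_real_derivative deriv (deriv (u t)) x + g t x) (at t)"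
proof -
  have "contb {0..} True (\<lambda>t x. heat t u0 x + duhamel 1 0 g t x)"
    unfolding heat_def
    by (intro contb_add) (auto simp: contb_def intro!: cont_bdd_gauss_avg cont_bdd_duhamel g continuous_intros cont_bdd_const[OF u0])
  moreover have "contb {0..} True u = contb {0..} True (\<lambda>t x. heat t u0 x + duhamel 1 0 g t x)"
    by (rule contb_cong) (auto simp: u)
  ultimately show lu: "cont_bdd {0..} u" by (simp add: contb_def)
  have restart: "u t = (\<lambda>x. heat (t - d) (u d) x + duhamel 1 d g t x)" if "0 \<le> d" "d \<le> t" for d t
  proof -
    have "u d = (\<lambda>x. heat d u0 x + duhamel 1 0 g d x)" using u that by (simp add: fun_eq_iff)
    then show ?thesis using duhamel_restart[OF u0 g that] u that by (intro ext) simp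
  qed
  have ud: "continuous_on UNIV (u d)" "\<exists>B. \<forall>x. \<bar>u d x\<bar> \<le> B" if "d \<ge> 0" for d
    using cont_bdd_slice[OF lu, of d] cont_bdd_bound_at[OF lu, of d] that by auto
  have regheat: "regular {d<..} True k (\<lambda>t. heat (t - d) (u d))" if d: "d > 0" for d k
  proof -
    obtain B where "\<And>x. \<bar>u d x\<bar> \<le> B" using ud(2)[of d] d by auto
    then have "cont_bdd {d<..} (\<lambda>_. u d)" using d by (intro cont_bdd_const ud(1)) auto
    from regular_gauss_avg[OF this, where r = "\<lambda>t. sqrt (2 * (t - d))" and k = k and p = 1 and j = 0] d
    show ?thesis by (simp add: heat_def continuous_intros)
  qed
  have step: "regular {0<..} True (Suc k) u" if "regular {0<..} True k u" for k
  proof (rule regular_exhaust)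
    fix d :: real assume d: "d > 0"
    have "regular {d<..} True (Suc k) (\<lambda>t x. heat (t - d) (u d) x + duhamel 1 d g t x)"
      by (rule regular_add[OF regheat[OF d] regular_duhamel[OF bootstrap[OF that] d]])
    moreover have "regular {d<..} True (Suc k) u = regular {d<..} True (Suc k) (\<lambda>t x. heat (t - d) (u d) x + duhamel 1 d g t x)"
      by (rule regular_cong) (use restart d in auto)
    ultimately show "regular {d<..} True (Suc k) u" by simp
  qed
  have base: "regular {0<..} True 0 u" by (rule cont_bdd_regular[OF cont_bdd_subset[OF lu]]) auto
  have all: "regular {0<..} True k u" for k
    by (induction k) (use base step in \<open>blast+\<close>)
  show "regular {0<..} True k u" by (rule all)
  assume t: "t > 0"
  \<comment> \<open>any restarting time strictly between 0 and \<open>t\<close> will do\<close>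
  define d where "d = t / 2"
  have d: "d > 0" "d < t" using t by (auto simp: d_def)
  obtain Bd where Bd: "\<And>x. \<bar>u d x\<bar> \<le> Bd" using ud(2)[of d] d by auto
  have ud1: "continuous_on UNIV (u d)" using ud(1)[of d] d by simp
  have g2: "regular {0<..} True (Suc (Suc 0)) g" by (rule bootstrap[OF all])
  let ?q = "gauss_avg (gauss_deriv (gauss_deriv 1)) (sqrt (2 * (t - d))) (u d) x / (2 * (t - d))"
  let ?D = "duhamel 1 d (\<lambda>s. deriv (deriv (g s))) t x"
  have eq: "u t = (\<lambda>x. heat (t - d) (u d) x + duhamel 1 d g t x)" by (rule restart) (use d in auto)
  have "(u t has_real_derivative - gauss_avg (gauss_deriv 1) (sqrt (2 * (t - d))) (u d) x / sqrt (2 * (t - d))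
      + duhamel 1 d (\<lambda>s. deriv (g s)) t x) (at x)" for x
    unfolding eq using d by (intro DERIV_add heat_DERIV_x[OF ud1 Bd] duhamel_DERIV_x_smooth[OF g2]) auto
  then have "deriv (u t) = (\<lambda>x. - gauss_avg (gauss_deriv 1) (sqrt (2 * (t - d))) (u d) x / sqrt (2 * (t - d))
      + duhamel 1 d (\<lambda>s. deriv (g s)) t x)"
    using DERIV_imp_deriv by blast
  moreover have "((\<lambda>x. - gauss_avg (gauss_deriv 1) (sqrt (2 * (t - d))) (u d) x / sqrt (2 * (t - d))
      + duhamel 1 d (\<lambda>s. deriv (g s)) t x) has_real_derivative ?q + ?D) (at x)"
    using d by (intro DERIV_add heat_DERIV_xx[OF ud1 Bd] duhamel_DERIV_x_smooth[OF regular_deriv[OF g2]]) auto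
  ultimately have xx: "deriv (deriv (u t)) x = ?q + ?D" using DERIV_imp_deriv by simp
  have "((\<lambda>s. heat s (u d) x) has_real_derivative ?q) (at (t - d))"
    by (rule heat_DERIV_t[OF ud1 Bd]) (use d in auto)
  then have "((\<lambda>s. heat (s - d) (u d) x) has_real_derivative ?q * 1) (at t)"
    by (rule DERIV_chain2) (auto intro!: derivative_eq_intros)
  then have "((\<lambda>s. heat (s - d) (u d) x + duhamel 1 d g s x) has_real_derivative ?q * 1 + (g t x + ?D)) (at t)"
    using d by (intro DERIV_add duhamel_DERIV_t[OF g2]) auto
  then have "((\<lambda>s. heat (s - d) (u d) x + duhamel 1 d g s x) has_real_derivative deriv (deriv (u t)) x + g t x) (at t)"
    by (simp add: xx algebra_simps)
  then show "((\<lambda>s. u s x) has_real_derivative deriv (deriv (u t)) x + g t x) (at t)"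
  proof (rule has_field_derivative_transform_within_open[of _ _ _ "{d<..}"])
    show "heat (s - d) (u d) x + duhamel 1 d g s x = u s x" if "s \<in> {d<..}" for s
      using restart[of d s] that d by simp
  qed (use d in auto)
qed

section \<open>Uniqueness and comparison for parabolic problems\<close>

lemma abs_Cb_le_norm: "\<bar>apply_Cb g x\<bar> \<le> norm g"
  unfolding norm_Cb_def by (rule cSUP_upper[OF _ bdd_above_abs_Cb]) simp

lemma norm_Cb_le: "(\<And>x. \<bar>apply_Cb g x\<bar> \<le> b) \<Longrightarrow> norm g \<le> b"
  unfolding norm_Cb_def by (rule cSUP_least) auto

lemma smooth_Cb: "smooth (apply_Cb g)"
  using apply_Cb by auto

lemma apply_to_Cb: "smooth g \<Longrightarrow> (\<And>x. \<bar>g x\<bar> \<le> B) \<Longrightarrow> apply_Cb (to_Cb g) = g"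
  by (rule to_Cb_inverse) (auto simp: bounded_iff)

lemma smooth_lipschitz_on_interval:
  assumes "smooth f"
  shows "\<exists>K>0. \<forall>a\<in>{-M..M}. \<forall>b\<in>{-M..M}. \<bar>f a - f b\<bar> \<le> K * \<bar>a - b\<bar>"
proof -
  have "compact (deriv f ` {-M..M})"
    by (intro compact_continuous_image smooth_continuous smooth_deriv assms) auto
  then obtain K where K: "K > 0" "\<And>x. x \<in> {-M..M} \<Longrightarrow> \<bar>deriv f x\<bar> \<le> K"
    using compact_imp_bounded by (force simp: bounded_pos)
  have "\<bar>f a - f b\<bar> \<le> K * \<bar>a - b\<bar>" if "a \<in> {-M..M}" "b \<in> {-M..M}" for a b
    using field_differentiable_bound[of "{-M..M}" f "deriv f" K a b] that K(2)
      has_field_derivative_at_within[OF smooth_DERIV[OF assms]] by simp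
  then show ?thesis using K(1) by blast
qed

text \<open>
This controls the quadratic remainder in the linearisation of the flow.
\<close>

lemma smooth_taylor2_on_interval:
  assumes "smooth f"
  shows "\<exists>K>0. \<forall>a\<in>{-M..M}. \<forall>b\<in>{-M..M}. \<bar>f a - f b - deriv f b * (a - b)\<bar> \<le> K * \<bar>a - b\<bar>\<^sup>2"
proof -
  obtain K where K: "K > 0" "\<And>a b. a \<in> {-M..M} \<Longrightarrow> b \<in> {-M..M} \<Longrightarrow> \<bar>deriv f a - deriv f b\<bar> \<le> K * \<bar>a - b\<bar>"
    using smooth_lipschitz_on_interval[OF smooth_deriv[OF assms], of M] by blast
  have "\<bar>f a - f b - deriv f b * (a - b)\<bar> \<le> K * \<bar>a - b\<bar>\<^sup>2" if ab: "a \<in> {-M..M}" "b \<in> {-M..M}" for a b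
  proof -
    let ?S = "closed_segment a b"
    have sub: "?S \<subseteq> {-M..M}" using ab by (auto simp: closed_segment_eq_real_ivl split: if_splits)
    have "norm ((f a - deriv f b * a) - (f b - deriv f b * b)) \<le> (K * \<bar>a - b\<bar>) * norm (a - b)"
    proof (rule field_differentiable_bound[of ?S _ "\<lambda>x. deriv f x - deriv f b"])
      show "((\<lambda>x. f x - deriv f b * x) has_field_derivative deriv f x - deriv f b) (at x within ?S)" for x
        by (auto intro!: derivative_eq_intros has_field_derivative_at_within[OF smooth_DERIV[OF assms]])
      show "norm (deriv f x - deriv f b) \<le> K * \<bar>a - b\<bar>" if "x \<in> ?S" for x
      proof -
        have "\<bar>deriv f x - deriv f b\<bar> \<le> K * \<bar>x - b\<bar>" using that sub ab by (intro K) auto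
        also have "\<dots> \<le> K * \<bar>a - b\<bar>" using that K(1)
          by (intro mult_left_mono) (auto simp: closed_segment_eq_real_ivl split: if_splits)
        finally show ?thesis by simp
      qed
    qed auto
    moreover have "(f a - deriv f b * a) - (f b - deriv f b * b) = f a - f b - deriv f b * (a - b)"
      by (simp add: algebra_simps)
    ultimately show ?thesis by (simp add: power2_eq_square mult_ac)
  qed
  then show ?thesis using K(1) by blast
qed

text \<open>
The inhomogeneous heat equation \<open>\<partial>\<^sub>tu = \<partial>\<^sub>x\<^sup>2u + r\<close> on \<open>(0, T] \<times> \<real>\<close>.  Nonlinear and linear problems become
instances in which \<open>r\<close> depends on the solution, and differences of solutions can be formed freely.
\<close>

definition parabolic :: "real \<Rightarrow> (real \<Rightarrow> real \<Rightarrow> real) \<Rightarrow> (real \<Rightarrow> real \<Rightarrow> real) \<Rightarrow> bool" where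
  "parabolic T u r \<longleftrightarrow> cont_bdd {0..T} u \<and>
    (\<forall>t\<in>{0<..T}. \<forall>x. (u t has_real_derivative deriv (u t) x) (at x) \<and>
      (deriv (u t) has_real_derivative deriv (deriv (u t)) x) (at x) \<and>
      ((\<lambda>s. u s x) has_real_derivative deriv (deriv (u t)) x + r t x) (at t within {0..T}))"

lemma parabolic_I:
  assumes "cont_bdd {0..T} u"
    and "\<And>t x. t \<in> {0<..T} \<Longrightarrow> (u t has_real_derivative u1 t x) (at x)"
    and "\<And>t x. t \<in> {0<..T} \<Longrightarrow> (u1 t has_real_derivative u2 t x) (at x)"
    and "\<And>t x. t \<in> {0<..T} \<Longrightarrow> ((\<lambda>s. u s x) has_real_derivative u2 t x + r t x) (at t within {0..T})"
  shows "parabolic T u r"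
proof -
  have "deriv (u t) = u1 t" if "t \<in> {0<..T}" for t using DERIV_imp_deriv[OF assms(2)[OF that]] by auto
  moreover have "deriv (u1 t) = u2 t" if "t \<in> {0<..T}" for t using DERIV_imp_deriv[OF assms(3)[OF that]] by auto
  ultimately show ?thesis using assms by (simp add: parabolic_def)
qed

lemma parabolic_cont_bdd: "parabolic T u r \<Longrightarrow> cont_bdd {0..T} u"
  by (simp add: parabolic_def)

lemma parabolic_D:
  assumes "parabolic T u r" "t \<in> {0<..T}"
  shows "(u t has_real_derivative deriv (u t) x) (at x)"
    "(deriv (u t) has_real_derivative deriv (deriv (u t)) x) (at x)"
    "((\<lambda>s. u s x) has_real_derivative deriv (deriv (u t)) x + r t x) (at t within {0..T})"
  using assms by (auto simp: parabolic_def)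

lemma cont_bdd_diff: "cont_bdd (I :: real set) u \<Longrightarrow> cont_bdd I v \<Longrightarrow> cont_bdd I (\<lambda>t x. u t x - v t x)"
  using regular_diff[of I True 0 u v] by (simp add: contb_def)

lemma cont_bdd_add: "cont_bdd (I :: real set) u \<Longrightarrow> cont_bdd I v \<Longrightarrow> cont_bdd I (\<lambda>t x. u t x + v t x)"
  using regular_add[of I True 0 u v] by (simp add: contb_def)

lemma cont_bdd_mult: "cont_bdd (I :: real set) u \<Longrightarrow> cont_bdd I v \<Longrightarrow> cont_bdd I (\<lambda>t x. u t x * v t x)"
  using regular_mult[of I True 0 u v] by (simp add: contb_def)

lemma cont_bdd_cmult: "cont_bdd (I :: real set) u \<Longrightarrow> cont_bdd I (\<lambda>t x. c * u t x)"
  using regular_cmult[of I True 0 u c] by (simp add: contb_def)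

lemma cont_bdd_smooth_comp: "smooth g \<Longrightarrow> cont_bdd (I :: real set) u \<Longrightarrow> cont_bdd I (\<lambda>t x. g (u t x))"
  using regular_smooth_comp[of g I True 0 u] by (simp add: contb_def)

lemma cont_bdd_Cb: "cont_bdd S (\<lambda>_. apply_Cb g)"
  by (rule cont_bdd_const[OF smooth_continuous[OF smooth_Cb] abs_Cb_le_norm])

lemma cont_bdd_shift:
  fixes R S :: "real set"
  assumes "cont_bdd S u" "(\<lambda>t. t + a) ` R \<subseteq> S"
  shows "cont_bdd R (\<lambda>t. u (t + a))"
proof (rule cont_bddI)
  show "continuous_on (R \<times> UNIV) (\<lambda>(t, x). u (t + a) x)"
    unfolding split_beta' using assms(2) by (intro cont_bdd_compose[OF assms(1)] continuous_intros) auto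
  fix C assume C: "compact C" "C \<subseteq> R"
  have "compact ((\<lambda>t. t + a) ` C)" using C by (intro compact_continuous_image continuous_intros)
  moreover have "(\<lambda>t. t + a) ` C \<subseteq> S" using C assms(2) by blast
  ultimately obtain B where "\<And>s x. s \<in> (\<lambda>t. t + a) ` C \<Longrightarrow> \<bar>u s x\<bar> \<le> B"
    using cont_bdd_boundE[OF assms(1)] by metis
  then show "\<exists>B. \<forall>s\<in>C. \<forall>x. \<bar>u (s + a) x\<bar> \<le> B" by blast
qed

lemma parabolic_diff:
  assumes "parabolic T u r" "parabolic T v q"
  shows "parabolic T (\<lambda>t x. u t x - v t x) (\<lambda>t x. r t x - q t x)"
proof (rule parabolic_I)
  show "cont_bdd {0..T} (\<lambda>t x. u t x - v t x)" using assms by (intro cont_bdd_diff parabolic_cont_bdd)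
  fix t x assume t: "t \<in> {0<..T}"
  show "((\<lambda>x. u t x - v t x) has_real_derivative deriv (u t) x - deriv (v t) x) (at x)"
    by (intro DERIV_diff parabolic_D[OF assms(1) t] parabolic_D[OF assms(2) t])
  show "((\<lambda>x. deriv (u t) x - deriv (v t) x) has_real_derivative deriv (deriv (u t)) x - deriv (deriv (v t)) x) (at x)"
    by (intro DERIV_diff parabolic_D[OF assms(1) t] parabolic_D[OF assms(2) t])
  show "((\<lambda>s. u s x - v s x) has_real_derivative
      deriv (deriv (u t)) x - deriv (deriv (v t)) x + (r t x - q t x)) (at t within {0..T})"
    using DERIV_diff[OF parabolic_D(3)[OF assms(1) t] parabolic_D(3)[OF assms(2) t], of x x]
    by (simp add: algebra_simps)
qed

lemma parabolic_add:
  assumes "parabolic T u r" "parabolic T v q"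
  shows "parabolic T (\<lambda>t x. u t x + v t x) (\<lambda>t x. r t x + q t x)"
proof (rule parabolic_I)
  show "cont_bdd {0..T} (\<lambda>t x. u t x + v t x)" using assms by (intro cont_bdd_add parabolic_cont_bdd)
  fix t x assume t: "t \<in> {0<..T}"
  show "((\<lambda>x. u t x + v t x) has_real_derivative deriv (u t) x + deriv (v t) x) (at x)"
    by (intro DERIV_add parabolic_D[OF assms(1) t] parabolic_D[OF assms(2) t])
  show "((\<lambda>x. deriv (u t) x + deriv (v t) x) has_real_derivative deriv (deriv (u t)) x + deriv (deriv (v t)) x) (at x)"
    by (intro DERIV_add parabolic_D[OF assms(1) t] parabolic_D[OF assms(2) t])
  show "((\<lambda>s. u s x + v s x) has_real_derivative
      deriv (deriv (u t)) x + deriv (deriv (v t)) x + (r t x + q t x)) (at t within {0..T})"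
    using DERIV_add[OF parabolic_D(3)[OF assms(1) t] parabolic_D(3)[OF assms(2) t], of x x]
    by (simp add: algebra_simps)
qed

lemma parabolic_cmult:
  assumes "parabolic T u r"
  shows "parabolic T (\<lambda>t x. c * u t x) (\<lambda>t x. c * r t x)"
proof (rule parabolic_I)
  show "cont_bdd {0..T} (\<lambda>t x. c * u t x)" using assms by (intro cont_bdd_cmult parabolic_cont_bdd)
  fix t x assume t: "t \<in> {0<..T}"
  show "((\<lambda>x. c * u t x) has_real_derivative c * deriv (u t) x) (at x)"
    by (intro DERIV_cmult parabolic_D[OF assms(1) t])
  show "((\<lambda>x. c * deriv (u t) x) has_real_derivative c * deriv (deriv (u t)) x) (at x)"
    by (intro DERIV_cmult parabolic_D[OF assms(1) t])
  show "((\<lambda>s. c * u s x) has_real_derivative c * deriv (deriv (u t)) x + c * r t x) (at t within {0..T})"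
    using DERIV_cmult[OF parabolic_D(3)[OF assms(1) t], of c x] by (simp add: algebra_simps)
qed

lemma parabolic_shift:
  assumes u: "parabolic T u r" and a: "a \<ge> 0" and T': "T' + a \<le> T"
  shows "parabolic T' (\<lambda>t. u (t + a)) (\<lambda>t. r (t + a))"
proof (rule parabolic_I)
  have sub: "(\<lambda>t. t + a) ` {0..T'} \<subseteq> {0..T}" using a T' by auto
  show "cont_bdd {0..T'} (\<lambda>t. u (t + a))" by (rule cont_bdd_shift[OF parabolic_cont_bdd[OF u] sub])
  fix t x assume "t \<in> {0<..T'}"
  then have t: "t + a \<in> {0<..T}" using a T' by auto
  show "(u (t + a) has_real_derivative deriv (u (t + a)) x) (at x)"
    "(deriv (u (t + a)) has_real_derivative deriv (deriv (u (t + a))) x) (at x)"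
    by (rule parabolic_D[OF u t])+
  have "((\<lambda>s. u s x) has_real_derivative deriv (deriv (u (t + a))) x + r (t + a) x) (at (t + a) within (\<lambda>t. t + a) ` {0..T'})"
    by (rule DERIV_subset[OF parabolic_D(3)[OF u t] sub])
  moreover have "((\<lambda>t. t + a) has_real_derivative 1) (at t within {0..T'})"
    by (auto intro!: derivative_eq_intros)
  ultimately have "((\<lambda>s. u s x) \<circ> (\<lambda>t. t + a) has_real_derivative (deriv (deriv (u (t + a))) x + r (t + a) x) * 1) (at t within {0..T'})"
    by (rule DERIV_image_chain)
  then show "((\<lambda>s. u (s + a) x) has_real_derivative deriv (deriv (u (t + a))) x + r (t + a) x) (at t within {0..T'})"
    by (simp add: comp_def)
qed

text \<open>
The growth hypothesis on \<open>r\<close> is what differences of solutions of a semilinear equation satisfy,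
with \<open>K\<close> a Lipschitz constant of the nonlinearity.
\<close>

lemma parabolic_estimate:
  assumes z: "parabolic T z r"
    and init: "\<And>x. \<bar>z 0 x\<bar> \<le> a * (1 + m * x\<^sup>2)"
    and ineq: "\<And>t x. t \<in> {0<..T} \<Longrightarrow> \<bar>r t x\<bar> \<le> K * \<bar>z t x\<bar> + b * (1 + m * x\<^sup>2)"
    and nonneg: "a \<ge> 0" "b \<ge> 0" "K \<ge> 0" "m \<ge> 0"
    and t: "t \<in> {0..T}"
  shows "\<bar>z t x\<bar> \<le> exp (K * t) * (a + b * t) * (1 + m * (x\<^sup>2 + 2 * t))"
proof -
  have "compact {0..T}" "{0..T} \<subseteq> {0..T}" by auto
  from cont_bdd_boundE[OF parabolic_cont_bdd[OF z] this] obtain B where B: "\<And>t x. t \<in> {0..T} \<Longrightarrow> \<bar>z t x\<bar> \<le> B" by metis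
  show ?thesis
    by (rule weighted_estimate[OF cont_bdd_continuous[OF parabolic_cont_bdd[OF z]] B parabolic_D(3)[OF z] parabolic_D(1)[OF z]
          parabolic_D(2)[OF z] init _ nonneg t])
       (use ineq in auto)
qed

lemma parabolic_estimate_sup:
  assumes z: "parabolic T z r"
    and init: "\<And>x. \<bar>z 0 x\<bar> \<le> a"
    and ineq: "\<And>t x. t \<in> {0<..T} \<Longrightarrow> \<bar>r t x\<bar> \<le> K * \<bar>z t x\<bar> + b"
    and nonneg: "a \<ge> 0" "b \<ge> 0" "K \<ge> 0"
    and t: "t \<in> {0..T}"
  shows "\<bar>z t x\<bar> \<le> exp (K * t) * (a + b * t)"
  using parabolic_estimate[OF z, of a 0 K b t x] assms by simp

lemma bounded_solution_parabolic:
  assumes "bounded_solution (\<lambda>v x. deriv (deriv (apply_Cb v)) x + f (apply_Cb v x)) u0 u"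
  shows "parabolic T (\<lambda>t. apply_Cb (u t)) (\<lambda>t x. f (apply_Cb (u t) x))"
proof (rule parabolic_I)
  have c: "continuous_on ({0..} \<times> UNIV) (\<lambda>(t, x). apply_Cb (u t) x)"
    and b: "bounded ((\<lambda>(t, x). apply_Cb (u t) x) ` ({0..} \<times> UNIV))"
    using assms by (auto simp: bounded_solution_def)
  have "cont_bdd {0..} (\<lambda>t. apply_Cb (u t))"
    unfolding cont_bdd_def using c by (auto intro: bounded_subset[OF b])
  then show "cont_bdd {0..T} (\<lambda>t. apply_Cb (u t))" by (rule cont_bdd_subset) auto
  fix t x assume t: "t \<in> {0<..T}"
  show "(apply_Cb (u t) has_real_derivative deriv (apply_Cb (u t)) x) (at x)"
    "(deriv (apply_Cb (u t)) has_real_derivative deriv (deriv (apply_Cb (u t))) x) (at x)"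
    by (intro smooth_DERIV smooth_deriv smooth_Cb)+
  show "((\<lambda>s. apply_Cb (u s) x) has_real_derivative deriv (deriv (apply_Cb (u t))) x + f (apply_Cb (u t) x)) (at t within {0..T})"
    using assms t by (auto simp: bounded_solution_def intro: has_field_derivative_at_within)
qed

lemma bounded_solution_bound:
  "bounded_solution F u0 u \<Longrightarrow> \<exists>B. \<forall>t\<ge>0. \<forall>x. \<bar>apply_Cb (u t) x\<bar> \<le> B"
  unfolding bounded_solution_def bounded_iff by force

lemma bounded_solution_unique:
  assumes f: "smooth f"
    and u: "bounded_solution (\<lambda>v x. deriv (deriv (apply_Cb v)) x + f (apply_Cb v x)) u0 u"
    and v: "bounded_solution (\<lambda>v x. deriv (deriv (apply_Cb v)) x + f (apply_Cb v x)) u0 v"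
    and t: "t \<ge> 0"
  shows "u t = v t"
proof (rule apply_Cb_eqI)
  fix x
  obtain B where B: "\<And>t x. t \<ge> 0 \<Longrightarrow> \<bar>apply_Cb (u t) x\<bar> \<le> B"
    using bounded_solution_bound[OF u] by blast
  obtain B' where B': "\<And>t x. t \<ge> 0 \<Longrightarrow> \<bar>apply_Cb (v t) x\<bar> \<le> B'"
    using bounded_solution_bound[OF v] by blast
  define M where "M = max B B'"
  obtain K where K: "K > 0" "\<And>a b. a \<in> {-M..M} \<Longrightarrow> b \<in> {-M..M} \<Longrightarrow> \<bar>f a - f b\<bar> \<le> K * \<bar>a - b\<bar>"
    using smooth_lipschitz_on_interval[OF f, of M] by blast
  have uM: "apply_Cb (u t) x \<in> {-M..M}" "apply_Cb (v t) x \<in> {-M..M}" if "t \<ge> 0" for t x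
    using B[OF that, of x] B'[OF that, of x] by (auto simp: M_def)
  have "\<bar>apply_Cb (u t) x - apply_Cb (v t) x\<bar> \<le> exp (K * t) * (0 + 0 * t)"
    by (rule parabolic_estimate_sup[OF parabolic_diff[OF bounded_solution_parabolic[OF u, of t] bounded_solution_parabolic[OF v, of t]]])
       (use t K u v in \<open>auto intro!: K(2) uM simp: bounded_solution_def\<close>)
  then show "apply_Cb (u t) x = apply_Cb (v t) x" by simp
qed

lemma flow_eqI:
  assumes u: "bounded_solution F u0 u"
    and unique: "\<And>v. bounded_solution F u0 v \<Longrightarrow> v t = u t"
  shows "flow F t u0 = u t"
  unfolding flow_def
proof (rule the_equality)
  show "\<exists>v. bounded_solution F u0 v \<and> u t = v t" using u by blast
next
  fix w assume "\<exists>v. bounded_solution F u0 v \<and> w = v t"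
  then show "w = u t" using unique by blast
qed

lemma bounded_solutionI:
  assumes "\<And>x. u 0 x = apply_Cb u0 x" "continuous_on ({0..} \<times> UNIV) (\<lambda>(t, x). u t x)"
    and "\<And>t x. t \<ge> 0 \<Longrightarrow> \<bar>u t x\<bar> \<le> M" "\<And>t. t > 0 \<Longrightarrow> smooth (u t)"
    and "\<And>t x. t > 0 \<Longrightarrow> ((\<lambda>s. u s x) has_real_derivative G (u t) x) (at t)"
  shows "bounded_solution (\<lambda>v x. G (apply_Cb v) x) u0 (\<lambda>t. to_Cb (u t))"
    and "t \<ge> 0 \<Longrightarrow> apply_Cb (to_Cb (u t)) = u t"
proof -
  have u0: "u 0 = apply_Cb u0" using assms(1) by auto
  show a: "apply_Cb (to_Cb (u t)) = u t" if "t \<ge> 0" for t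
  proof (rule apply_to_Cb)
    show "smooth (u t)" using that assms(4) u0 smooth_Cb[of u0] by (cases "t = 0") auto
    show "\<bar>u t x\<bar> \<le> M" for x by (rule assms(3)[OF that])
  qed
  show "bounded_solution (\<lambda>v x. G (apply_Cb v) x) u0 (\<lambda>t. to_Cb (u t))"
    unfolding bounded_solution_def
  proof (intro conjI allI impI)
    show "to_Cb (u 0) = u0" by (simp add: u0 apply_Cb_inverse)
    have eq: "(\<lambda>(t, x). apply_Cb (to_Cb (u t)) x) q = (\<lambda>(t, x). u t x) q" if "q \<in> {0..} \<times> UNIV" for q
      using that a by auto
    show "continuous_on ({0..} \<times> UNIV) (\<lambda>(t, x). apply_Cb (to_Cb (u t)) x)"
      using assms(2) eq by (subst continuous_on_cong[OF refl eq]) auto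
    show "bounded ((\<lambda>(t, x). apply_Cb (to_Cb (u t)) x) ` ({0..} \<times> UNIV))"
      unfolding bounded_iff using assms(3) a by (intro exI[of _ M]) auto
    fix t x :: real assume t: "t > 0"
    have "((\<lambda>s. u s x) has_real_derivative G (u t) x) (at t)" by (rule assms(5)[OF t])
    then have "((\<lambda>s. apply_Cb (to_Cb (u s)) x) has_real_derivative G (u t) x) (at t)"
      by (rule has_field_derivative_transform_within_open[of _ _ _ "{0<..}"]) (use a t in auto)
    then show "((\<lambda>s. apply_Cb (to_Cb (u s)) x) has_real_derivative G (apply_Cb (to_Cb (u t))) x) (at t)"
      using a t by simp
  qed
qed

section \<open>The semi-flows of the heat and of the reaction-diffusion equation\<close>

lemma Xflow_eq: "Xflow = Tflow (\<lambda>_. 0)"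
  by (simp add: Xflow_def Tflow_def)

lemma regular_zero: "regular I b k (\<lambda>_ _. 0)"
  using regular_time[of I "\<lambda>_. 0"] by simp

text \<open>
A Gaussian average is a mild solution with source 0, so it is smooth and solves the heat equation.
\<close>

lemma Xflow_heat:
  assumes "t \<ge> 0"
  shows "apply_Cb (Xflow t v) = heat t (apply_Cb v)"
proof -
  note w = smooth_continuous[OF smooth_Cb, of UNIV v] abs_Cb_le_norm[of v]
  have "duhamel 1 0 (\<lambda>_ _. 0) t x = 0" for t x by (simp add: duhamel_def gauss_avg_const)
  then have c: "heat t (apply_Cb v) x = heat t (apply_Cb v) x + duhamel 1 0 (\<lambda>_ _. 0) t x" for t x by simp
  have z: "cont_bdd {0..} (\<lambda>(_::real) _. 0)" by (rule cont_bdd_const[of _ 0]) auto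
  note m = mild_solution_classical[OF w z c regular_zero]
  have "bounded_solution (\<lambda>v x. deriv (deriv (apply_Cb v)) x + 0) v (\<lambda>t. to_Cb (heat t (apply_Cb v)))"
    and eq: "apply_Cb (to_Cb (heat t (apply_Cb v))) = heat t (apply_Cb v)"
  proof -
    have sm: "smooth (heat t (apply_Cb v))" if "t > 0" for t
      using regular_imp_smooth[OF m(2), of t] that by simp
    have d: "((\<lambda>s. heat s (apply_Cb v) x) has_real_derivative deriv (deriv (heat t (apply_Cb v))) x + 0) (at t)"
      if "t > 0" for t x using m(3)[OF that, of x] by simp
    note b = bounded_solutionI[of "\<lambda>t. heat t (apply_Cb v)" v "norm v" "\<lambda>v x. deriv (deriv v) x + 0",
        OF heat_0 heat_continuous[OF w] abs_heat_le[OF w] sm d]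
    show "bounded_solution (\<lambda>v x. deriv (deriv (apply_Cb v)) x + 0) v (\<lambda>t. to_Cb (heat t (apply_Cb v)))"
      by (rule b(1))
    show "apply_Cb (to_Cb (heat t (apply_Cb v))) = heat t (apply_Cb v)"
      by (rule b(2)) (use assms in auto)
  qed
  note bs = this(1)
  have "Xflow t v = to_Cb (heat t (apply_Cb v))"
    unfolding Xflow_eq Tflow_def
  proof (rule flow_eqI[where u = "\<lambda>t. to_Cb (heat t (apply_Cb v))", OF bs])
    fix u assume "bounded_solution (\<lambda>v x. deriv (deriv (apply_Cb v)) x + 0) v u"
    from bounded_solution_unique[OF smooth_zero this bs assms]
    show "u t = to_Cb (heat t (apply_Cb v))" .
  qed
  then show ?thesis using eq by simp
qed

lemma regular_scaled_eq:
  assumes "regular I b k u" "\<And>t x. t \<in> I \<Longrightarrow> v t x = u t x"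
  shows "regular I b k v"
  using regular_cong[of I v u b k] assms by (auto simp: fun_eq_iff)

text \<open>
The nonlinearity is truncated at \<open>\<plusminus>M\<close> and written as \<open>g r - K * r\<close> with \<open>g r = f r + K * r\<close> nondecreasing on
\<open>[-M, M]\<close>.  The sign condition on \<open>f\<close> gives \<open>\<bar>g r\<bar> \<le> K * M\<close>, and the Duhamel formula for
\<open>w = exp (K * t) * u\<close> yields \<open>\<bar>u\<bar> \<le> M\<close> directly.  Thus the truncation is invisible, and the a priori
bound is obtained before any regularity of \<open>u\<close> is known.
\<close>

lemma semilinear_exists:
  fixes u0 :: "real \<Rightarrow> real"
  assumes f: "smooth f" "f 0 = 0" and diss: "\<And>r. \<bar>r\<bar> \<ge> 1 \<Longrightarrow> r * f r \<le> 0"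
    and u0: "continuous_on UNIV u0" "\<And>x. \<bar>u0 x\<bar> \<le> M" and M: "M \<ge> 1" and kap: "\<kappa> \<ge> 0"
  obtains u K w where "K > 0" "\<And>t x. t \<ge> 0 \<Longrightarrow> \<bar>u t x\<bar> \<le> M" "cont_bdd {0..} w" "\<And>t x. u t x = exp (- K * t) * w t x"
    "\<And>t x. t \<ge> 0 \<Longrightarrow> w t x = gauss_avg 1 (sqrt (2 * \<kappa> * t)) u0 x + duhamel \<kappa> 0 (\<lambda>s x. exp (K * s) * (f (u s x) + K * u s x)) t x"
proof -
  obtain K where K: "K > 0" "\<And>a b. a \<in> {-M..M} \<Longrightarrow> b \<in> {-M..M} \<Longrightarrow> \<bar>f a - f b\<bar> \<le> K * \<bar>a - b\<bar>"
    using smooth_lipschitz_on_interval[OF f(1), of M] by blast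
  define cl where "cl r = max (- M) (min M r)" for r :: real
  have cl: "cl r \<in> {-M..M}" "\<bar>cl a - cl b\<bar> \<le> \<bar>a - b\<bar>" "r \<in> {-M..M} \<Longrightarrow> cl r = r" for r a b
    using M by (auto simp: cl_def)
  define g where "g r = f (cl r) + K * cl r" for r
  have mono: "f a + K * a \<le> f b + K * b" if "a \<in> {-M..M}" "b \<in> {-M..M}" "a \<le> b" for a b
    using K(2)[OF that(1,2)] that(3) K(1) by (auto simp: abs_if algebra_simps split: if_splits)
  have fM: "f M \<le> 0" "f (- M) \<ge> 0" using diss[of M] diss[of "- M"] M by (auto simp: mult_le_0_iff zero_le_mult_iff)
  have gM: "\<bar>g r\<bar> \<le> K * M" for r
  proof -
    have "g r \<le> f M + K * M" unfolding g_def by (rule mono) (use cl(1)[of r] M in auto)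
    moreover have "f (- M) + K * (- M) \<le> g r" unfolding g_def by (rule mono) (use cl(1)[of r] M in auto)
    ultimately show ?thesis using fM by auto
  qed
  have lipg: "\<bar>g a - g b\<bar> \<le> (2 * K) * \<bar>a - b\<bar>" for a b
  proof -
    have "\<bar>g a - g b\<bar> \<le> \<bar>f (cl a) - f (cl b)\<bar> + \<bar>K * (cl a - cl b)\<bar>"
      unfolding g_def right_diff_distrib by linarith
    also have "\<dots> \<le> K * \<bar>cl a - cl b\<bar> + K * \<bar>cl a - cl b\<bar>"
      using K(2)[OF cl(1) cl(1), of a b] K(1) by (simp add: abs_mult)
    also have "\<dots> = (2 * K) * \<bar>cl a - cl b\<bar>" by simp
    also have "\<dots> \<le> (2 * K) * \<bar>a - b\<bar>" using K(1) by (intro mult_left_mono cl(2)) auto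
    finally show ?thesis .
  qed
  have contg: "continuous_on UNIV g"
    unfolding g_def cl_def
    by (intro continuous_intros continuous_on_compose2[OF smooth_continuous[OF f(1), of UNIV]]) auto
  define F where "F t x v = exp (K * t) * g (exp (- K * t) * v)" for t x v :: real
  have "continuous_on ({0..} \<times> UNIV \<times> UNIV) (\<lambda>(t, x, v). F t x v)"
    unfolding F_def split_beta'
    by (intro continuous_intros continuous_on_compose2[OF contg]) auto
  moreover have "\<bar>F t x v - F t x v'\<bar> \<le> 2 * K * \<bar>v - v'\<bar>" if "t \<ge> 0" for t x v v'
  proof -
    have "\<bar>F t x v - F t x v'\<bar> = exp (K * t) * \<bar>g (exp (- K * t) * v) - g (exp (- K * t) * v')\<bar>"
      by (simp add: F_def abs_mult flip: right_diff_distrib)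
    also have "\<dots> \<le> exp (K * t) * ((2 * K) * \<bar>exp (- K * t) * v - exp (- K * t) * v'\<bar>)"
      by (intro mult_left_mono lipg) auto
    also have "\<dots> = exp (K * t) * exp (- K * t) * ((2 * K) * \<bar>v - v'\<bar>)"
      by (simp add: abs_mult flip: right_diff_distrib)
    finally show ?thesis by (simp flip: exp_add)
  qed
  moreover have "F t x 0 = 0" for t x using f(2) M by (simp add: F_def g_def cl_def)
  ultimately obtain w where w: "cont_bdd {0..} w"
    "\<And>t x. t \<ge> 0 \<Longrightarrow> w t x = gauss_avg 1 (sqrt (2 * \<kappa> * t)) u0 x + duhamel \<kappa> 0 (\<lambda>s x. F s x (w s x)) t x"
    by (rule mild_solution_exists[OF u0 kap]) (assumption | rule that)+
  define u where "u t x = exp (- K * t) * w t x" for t x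
  have FG: "F t x (w t x) = exp (K * t) * g (u t x)" for t x by (simp add: F_def u_def)
  have lF: "cont_bdd {0..} (\<lambda>s x. F s x (w s x))"
  proof (rule cont_bddI)
    show "continuous_on ({0..} \<times> UNIV) (\<lambda>(s, x). F s x (w s x))"
      unfolding F_def split_beta'
      by (intro continuous_intros continuous_on_compose2[OF contg] cont_bdd_compose[OF w(1)]) auto
    fix C :: "real set" assume "compact C" "C \<subseteq> {0..}"
    then obtain T where T: "C \<subseteq> {0..T}" using compact_subset_atLeast by blast
    have "\<bar>F s x (w s x)\<bar> \<le> exp (K * T) * (K * M)" if "s \<in> C" for s x
      unfolding FG abs_mult using that T K(1) M by (intro mult_mono gM) auto
    then show "\<exists>B. \<forall>s\<in>C. \<forall>x. \<bar>F s x (w s x)\<bar> \<le> B" by blast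
  qed
  have wM: "\<bar>w t x\<bar> \<le> M * exp (K * t)" if t: "t \<ge> 0" for t x
  proof -
    have "\<bar>duhamel \<kappa> 0 (\<lambda>s x. F s x (w s x)) t x\<bar> \<le> integral {0..t} (\<lambda>s. (K * M) * exp (K * s))"
    proof (rule abs_duhamel_le[OF lF t kap])
      show "\<bar>F s x (w s x)\<bar> \<le> K * M * exp (K * s)" for s x
        unfolding FG abs_mult using gM[of "u s x"] by (simp add: mult.commute)
    qed (intro continuous_intros)
    also have "\<dots> = M * (exp (K * t) - 1)" using exp_integral[OF K(1) t, of "K * M"] K(1) by simp
    finally have "\<bar>duhamel \<kappa> 0 (\<lambda>s x. F s x (w s x)) t x\<bar> \<le> M * exp (K * t) - M" by (simp add: algebra_simps)
    moreover have "\<bar>gauss_avg 1 (sqrt (2 * \<kappa> * t)) u0 x\<bar> \<le> M" by (rule abs_gauss_avg_le[OF u0])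
    ultimately show ?thesis using w(2)[OF t, of x] by linarith
  qed
  have uM: "\<bar>u t x\<bar> \<le> M" if t: "t \<ge> 0" for t x
  proof -
    have "\<bar>u t x\<bar> \<le> exp (- K * t) * (M * exp (K * t))"
      unfolding u_def abs_mult using wM[OF t, of x] by (intro mult_mono) auto
    also have "\<dots> = M" by (simp add: exp_minus field_simps)
    finally show ?thesis .
  qed
  have gu: "F t x (w t x) = exp (K * t) * (f (u t x) + K * u t x)" if t: "t \<ge> 0" for t x
  proof -
    have "cl (u t x) = u t x" using uM[OF t, of x] by (intro cl(3)) auto
    then show ?thesis by (simp add: FG g_def)
  qed
  have "duhamel \<kappa> 0 (\<lambda>s x. F s x (w s x)) t x = duhamel \<kappa> 0 (\<lambda>s x. exp (K * s) * (f (u s x) + K * u s x)) t x" if "t \<ge> 0" for t x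
    unfolding duhamel_def by (intro integral_cong) (use gu in \<open>auto simp: gauss_avg_def\<close>)
  with w(2) have "w t x = gauss_avg 1 (sqrt (2 * \<kappa> * t)) u0 x + duhamel \<kappa> 0 (\<lambda>s x. exp (K * s) * (f (u s x) + K * u s x)) t x"
    if "t \<ge> 0" for t x using that by simp
  from that[OF K(1) uM w(1) u_def this] show ?thesis .
qed

lemma reaction_diffusion_exists:
  fixes u0 :: "real \<Rightarrow> real"
  assumes f: "smooth f" "f 0 = 0" and diss: "\<And>r. \<bar>r\<bar> \<ge> 1 \<Longrightarrow> r * f r \<le> 0"
    and u0: "continuous_on UNIV u0" "\<And>x. \<bar>u0 x\<bar> \<le> M" and M: "M \<ge> 1"
  obtains u where "\<And>t x. t \<ge> 0 \<Longrightarrow> \<bar>u t x\<bar> \<le> M" "cont_bdd {0..} u" "\<And>x. u 0 x = u0 x" "\<And>k. regular {0<..} True k u"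
    "\<And>t x. t > 0 \<Longrightarrow> ((\<lambda>s. u s x) has_real_derivative deriv (deriv (u t)) x + f (u t x)) (at t)"
proof -
  obtain u K w where K: "K > 0" and uM: "\<And>t x. t \<ge> 0 \<Longrightarrow> \<bar>u t x\<bar> \<le> M" and w: "cont_bdd {0..} w"
    and u: "\<And>t x. u t x = exp (- K * t) * w t x"
    and eq: "\<And>t x. t \<ge> 0 \<Longrightarrow> w t x = gauss_avg 1 (sqrt (2 * 1 * t)) u0 x + duhamel 1 0 (\<lambda>s x. exp (K * s) * (f (u s x) + K * u s x)) t x"
    by (rule semilinear_exists[OF f diss u0 M zero_le_one]) (assumption | rule that)+
  define g where "g s x = exp (K * s) * (f (u s x) + K * u s x)" for s x
  have regu: "regular I True k u" if "regular I True k w" for I k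
    by (rule regular_scaled_eq[OF regular_mult[OF regular_time[of I "\<lambda>t. exp (- K * t)"] that]])
       (auto simp: u intro!: continuous_intros)
  have regg: "regular I True k g" if "regular I True k w" for I k
    unfolding g_def
    by (intro regular_mult regular_add regular_cmult regular_smooth_comp[OF f(1)] regu that regular_time continuous_intros)
  have lu: "cont_bdd {0..} u" using regu[of "{0..}" 0] w by (simp add: contb_def)
  have lg: "cont_bdd {0..} g" using regg[of "{0..}" 0] w by (simp add: contb_def)
  have "w t x = heat t u0 x + duhamel 1 0 g t x" if "t \<ge> 0" for t x
    using eq[OF that, of x] by (simp add: heat_def g_def[abs_def])
  note c' = mild_solution_classical[OF u0 lg this regg]
  have c2: "regular {0<..} True k w" for k by (rule c'(2))
  have c3: "((\<lambda>s. w s x) has_real_derivative deriv (deriv (w t)) x + g t x) (at t)" if "t > 0" for t x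
    by (rule c'(3)) (use that in auto)
  show ?thesis
  proof (rule that[OF uM lu])
    show "u 0 x = u0 x" for x using eq[of 0 x] by (simp add: u duhamel_def)
    show "regular {0<..} True k u" for k by (rule regu[OF c2])
    fix t x :: real assume t: "t > 0"
    have t': "t \<in> {0<..}" using t by simp
    have "(u t has_real_derivative exp (- K * t) * deriv (w t) x) (at x)" for x
      unfolding u by (rule DERIV_cmult[OF regular_Suc_DERIV[OF c2 t']])
    then have "deriv (u t) = (\<lambda>x. exp (- K * t) * deriv (w t) x)" using DERIV_imp_deriv by blast
    moreover have "((\<lambda>x. exp (- K * t) * deriv (w t) x) has_real_derivative exp (- K * t) * deriv (deriv (w t)) x) (at x)"
      by (rule DERIV_cmult[OF regular_Suc_DERIV[OF regular_deriv[OF c2] t']])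
    ultimately have dd: "deriv (deriv (u t)) x = exp (- K * t) * deriv (deriv (w t)) x" using DERIV_imp_deriv by simp
    have e: "exp (- K * t) * g t x = f (u t x) + K * u t x" by (simp add: g_def flip: exp_add mult.assoc)
    have "((\<lambda>s. exp (- K * s) * w s x) has_real_derivative
        (exp (- K * t) * - K) * w t x + exp (- K * t) * (deriv (deriv (w t)) x + g t x)) (at t)"
      by (auto intro!: derivative_eq_intros c3[OF t])
    moreover have "(exp (- K * t) * - K) * w t x + exp (- K * t) * (deriv (deriv (w t)) x + g t x)
        = deriv (deriv (u t)) x + f (u t x)"
      using e by (simp add: dd u algebra_simps)
    ultimately show "((\<lambda>s. u s x) has_real_derivative deriv (deriv (u t)) x + f (u t x)) (at t)" by (simp add: u)
  qed
qed

context
  fixes f :: "real \<Rightarrow> real"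
  assumes f: "smooth f" "f 0 = 0" and diss: "\<And>r. \<bar>r\<bar> \<ge> 1 \<Longrightarrow> r * f r \<le> 0"
begin

lemma Tflow_properties:
  shows "Tflow f 0 v = v"
    and "cont_bdd {0..} (\<lambda>t. apply_Cb (Tflow f t v))"
    and "regular {0<..} True k (\<lambda>t. apply_Cb (Tflow f t v))"
    and "\<lbrakk>\<And>x. \<bar>apply_Cb v x\<bar> \<le> M; M \<ge> 1; t \<ge> 0\<rbrakk> \<Longrightarrow> \<bar>apply_Cb (Tflow f t v) x\<bar> \<le> M"
    and "parabolic T (\<lambda>t. apply_Cb (Tflow f t v)) (\<lambda>t x. f (apply_Cb (Tflow f t v) x))"
proof -
  note v = smooth_continuous[OF smooth_Cb, of UNIV v]
  have ex: "\<exists>u. (\<forall>t x. t \<ge> 0 \<longrightarrow> \<bar>u t x\<bar> \<le> M) \<and> cont_bdd {0..} u \<and> (\<forall>k. regular {0<..} True k u)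
      \<and> bounded_solution (\<lambda>v x. deriv (deriv (apply_Cb v)) x + f (apply_Cb v x)) v (\<lambda>t. to_Cb (u t))
      \<and> (\<forall>t\<ge>0. apply_Cb (to_Cb (u t)) = u t)"
    if vM: "\<And>x. \<bar>apply_Cb v x\<bar> \<le> M" and M: "M \<ge> 1" for M
  proof -
    obtain u where uM: "\<And>t x. t \<ge> 0 \<Longrightarrow> \<bar>u t x\<bar> \<le> M" and l: "cont_bdd {0..} u" and u0: "\<And>x. u 0 x = apply_Cb v x"
      and r: "\<And>k. regular {0<..} True k u"
      and d: "\<And>t x. t > 0 \<Longrightarrow> ((\<lambda>s. u s x) has_real_derivative deriv (deriv (u t)) x + f (u t x)) (at t)"
      by (rule reaction_diffusion_exists[OF f diss v vM M]) (assumption | rule that)+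
    have sm: "smooth (u t)" if "t > 0" for t using regular_imp_smooth[OF r, of t] that by simp
    note b = bounded_solutionI[of u v M "\<lambda>v x. deriv (deriv v) x + f (v x)", OF u0 cont_bdd_continuous[OF l] uM sm d]
    show ?thesis using uM l r b by blast
  qed
  have eq: "Tflow f t v = U t"
    if "bounded_solution (\<lambda>v x. deriv (deriv (apply_Cb v)) x + f (apply_Cb v x)) v U" "t \<ge> 0" for U t
    unfolding Tflow_def
  proof (rule flow_eqI[where u = U, OF that(1)])
    fix u assume "bounded_solution (\<lambda>v x. deriv (deriv (apply_Cb v)) x + f (apply_Cb v x)) v u"
    from bounded_solution_unique[OF f(1) this that] show "u t = U t" .
  qed
  show "\<bar>apply_Cb (Tflow f t v) x\<bar> \<le> M" if vM: "\<And>x. \<bar>apply_Cb v x\<bar> \<le> M" and M: "M \<ge> 1" and t: "t \<ge> 0" for M t x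
    using ex[OF vM M] eq t by force
  define M where "M = max 1 (norm v)"
  have vM: "\<bar>apply_Cb v x\<bar> \<le> M" for x using abs_Cb_le_norm[of v x] by (simp add: M_def)
  have "M \<ge> 1" by (simp add: M_def)
  from ex[OF vM this] obtain u where l: "cont_bdd {0..} u" and r: "\<And>k. regular {0<..} True k u"
    and b: "bounded_solution (\<lambda>v x. deriv (deriv (apply_Cb v)) x + f (apply_Cb v x)) v (\<lambda>t. to_Cb (u t))"
    and a: "\<And>t. t \<ge> 0 \<Longrightarrow> apply_Cb (to_Cb (u t)) = u t" by blast
  have Tu: "apply_Cb (Tflow f t v) = u t" if "t \<ge> 0" for t using eq[OF b that] a[OF that] by simp
  show "Tflow f 0 v = v" using eq[OF b, of 0] b by (simp add: bounded_solution_def)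
  show lT: "cont_bdd {0..} (\<lambda>t. apply_Cb (Tflow f t v))"
    using regular_cong[of "{0..}" "\<lambda>t. apply_Cb (Tflow f t v)" u True 0] l Tu by (simp add: contb_def)
  show "regular {0<..} True k (\<lambda>t. apply_Cb (Tflow f t v))" for k
    using regular_cong[of "{0<..}" "\<lambda>t. apply_Cb (Tflow f t v)" u True k] r Tu by simp
  show "parabolic T (\<lambda>t. apply_Cb (Tflow f t v)) (\<lambda>t x. f (apply_Cb (Tflow f t v) x))" for T
  proof (rule parabolic_I)
    show "cont_bdd {0..T} (\<lambda>t. apply_Cb (Tflow f t v))" by (rule cont_bdd_subset[OF lT]) auto
    fix t x assume t: "t \<in> {0<..T}"
    show "(apply_Cb (Tflow f t v) has_real_derivative deriv (apply_Cb (Tflow f t v)) x) (at x)"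
      "(deriv (apply_Cb (Tflow f t v)) has_real_derivative deriv (deriv (apply_Cb (Tflow f t v))) x) (at x)"
      by (intro smooth_DERIV smooth_deriv smooth_Cb)+
    have "((\<lambda>s. apply_Cb (to_Cb (u s)) x) has_real_derivative
        deriv (deriv (apply_Cb (to_Cb (u t)))) x + f (apply_Cb (to_Cb (u t)) x)) (at t within {0..T})"
      by (rule parabolic_D(3)[OF bounded_solution_parabolic[OF b] t])
    then show "((\<lambda>s. apply_Cb (Tflow f s v) x) has_real_derivative
        deriv (deriv (apply_Cb (Tflow f t v))) x + f (apply_Cb (Tflow f t v) x)) (at t within {0..T})"
      unfolding eq[OF b, of t, symmetric, OF less_imp_le, OF t[unfolded greaterThanAtMost_iff, THEN conjunct1]]
      by (rule has_field_derivative_transform_within[OF _ zero_less_one]) (use t eq[OF b] in auto)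
  qed
qed

end

section \<open>The derivative of the reaction-diffusion flow\<close>

text \<open>
The regularity for positive times is included because the time slices of \<open>z\<close> have to be elements
of \<open>Cb\<close>.
\<close>

definition lin_sol :: "(real \<Rightarrow> real \<Rightarrow> real) \<Rightarrow> Cb \<Rightarrow> (real \<Rightarrow> real \<Rightarrow> real) \<Rightarrow> bool" where
  "lin_sol c h z \<longleftrightarrow> z 0 = apply_Cb h \<and> cont_bdd {0..} z \<and> (\<forall>k. regular {0<..} True k z) \<and>
    (\<forall>T. parabolic T z (\<lambda>t x. c t x * z t x))"

lemma parabolic_regular:
  assumes l: "cont_bdd {0..} u" and r: "\<And>k. regular {0<..} True k u"
    and d: "\<And>t x. t > 0 \<Longrightarrow> ((\<lambda>s. u s x) has_real_derivative deriv (deriv (u t)) x + g t x) (at t)"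
  shows "parabolic T u g"
proof (rule parabolic_I)
  show "cont_bdd {0..T} u" by (rule cont_bdd_subset[OF l]) auto
  fix t x assume t: "t \<in> {0<..T}"
  then have t': "t \<in> {0<..}" by simp
  show "(u t has_real_derivative deriv (u t) x) (at x)" by (rule regular_Suc_DERIV[OF r t'])
  show "(deriv (u t) has_real_derivative deriv (deriv (u t)) x) (at x)"
    by (rule regular_Suc_DERIV[OF regular_deriv[OF r] t'])
  show "((\<lambda>s. u s x) has_real_derivative deriv (deriv (u t)) x + g t x) (at t within {0..T})"
    using d[of t x] t by (auto intro: has_field_derivative_at_within)
qed

lemma lin_sol_exists:
  assumes c: "cont_bdd {0..} c" "\<And>t x. t \<ge> 0 \<Longrightarrow> \<bar>c t x\<bar> \<le> K" "\<And>k. regular {0<..} True k c"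
  shows "\<exists>z. lin_sol c h z"
proof -
  note w = smooth_continuous[OF smooth_Cb, of UNIV h] abs_Cb_le_norm[of h]
  have "continuous_on ({0..} \<times> UNIV \<times> UNIV) (\<lambda>(t, x, v). c t x * v)"
    unfolding split_beta' by (intro continuous_intros cont_bdd_compose[OF c(1)]) auto
  moreover have "\<bar>c t x * v - c t x * v'\<bar> \<le> K * \<bar>v - v'\<bar>" if "t \<ge> 0" for t x v v'
    using c(2)[OF that] by (auto simp: abs_mult mult_right_mono simp flip: right_diff_distrib)
  moreover have "c t x * 0 = 0" for t x by simp
  ultimately obtain z where z: "cont_bdd {0..} z"
    "\<And>t x. t \<ge> 0 \<Longrightarrow> z t x = gauss_avg 1 (sqrt (2 * 1 * t)) (apply_Cb h) x + duhamel 1 0 (\<lambda>s x. c s x * z s x) t x"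
    by (rule mild_solution_exists[OF w zero_le_one]) (assumption | rule that)+
  have lg: "cont_bdd {0..} (\<lambda>s x. c s x * z s x)" by (rule cont_bdd_mult[OF c(1) z(1)])
  have eq: "z t x = heat t (apply_Cb h) x + duhamel 1 0 (\<lambda>s x. c s x * z s x) t x" if "t \<ge> 0" for t x
    using z(2)[OF that] by (simp add: heat_def)
  have boot: "regular {0<..} True k (\<lambda>s x. c s x * z s x)" if "regular {0<..} True k z" for k
    by (rule regular_mult[OF c(3) that])
  note m = mild_solution_classical[OF w lg eq boot]
  have r: "regular {0<..} True k z" for k by (rule m(2))
  have d: "((\<lambda>s. z s x) has_real_derivative deriv (deriv (z t)) x + c t x * z t x) (at t)" if "t > 0" for t x
    by (rule m(3)) (use that in auto)
  have "z 0 = apply_Cb h" using eq[of 0] by (simp add: fun_eq_iff duhamel_def)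
  then have "lin_sol c h z" unfolding lin_sol_def using z(1) r parabolic_regular[OF z(1) r d] by blast
  then show ?thesis by blast
qed

lemma lin_sol_bound:
  assumes z: "lin_sol c h z" and c: "\<And>t x. t \<ge> 0 \<Longrightarrow> \<bar>c t x\<bar> \<le> K"
    and h: "\<And>x. \<bar>apply_Cb h x\<bar> \<le> a * (1 + m * x\<^sup>2)" and nonneg: "a \<ge> 0" "m \<ge> 0" and t: "t \<ge> 0"
  shows "\<bar>z t x\<bar> \<le> exp (K * t) * a * (1 + m * (x\<^sup>2 + 2 * t))"
proof -
  have K: "K \<ge> 0" using order_trans[OF abs_ge_zero c[of 0 0]] by simp
  have "\<bar>z t x\<bar> \<le> exp (K * t) * (a + 0 * t) * (1 + m * (x\<^sup>2 + 2 * t))"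
  proof (rule parabolic_estimate)
    show "parabolic t z (\<lambda>t x. c t x * z t x)" using z by (simp add: lin_sol_def)
    show "\<bar>z 0 x\<bar> \<le> a * (1 + m * x\<^sup>2)" for x using z h[of x] by (simp add: lin_sol_def)
    show "\<bar>c s x * z s x\<bar> \<le> K * \<bar>z s x\<bar> + 0 * (1 + m * x\<^sup>2)" if "s \<in> {0<..t}" for s x
      using c[of s x] that by (auto simp: abs_mult intro: mult_right_mono)
  qed (use nonneg t K in auto)
  then show ?thesis by simp
qed

lemma lin_sol_add: "lin_sol c h z \<Longrightarrow> lin_sol c h' z' \<Longrightarrow> lin_sol c (h + h') (\<lambda>t x. z t x + z' t x)"
  unfolding lin_sol_def
  by (auto simp: plus_Cb.rep_eq distrib_left intro!: cont_bdd_add regular_add parabolic_add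
      dest: spec[of "\<lambda>T. parabolic T _ _"])

lemma lin_sol_scaleR: "lin_sol c h z \<Longrightarrow> lin_sol c (a *\<^sub>R h) (\<lambda>t x. a * z t x)"
  unfolding lin_sol_def
  using parabolic_cmult[of _ z "\<lambda>t x. c t x * z t x" a]
  by (auto simp: scaleR_Cb.rep_eq mult_ac intro!: cont_bdd_cmult regular_cmult)

lemma lin_sol_unique:
  assumes z: "lin_sol c h z" "lin_sol c h z'" and c: "\<And>t x. t \<ge> 0 \<Longrightarrow> \<bar>c t x\<bar> \<le> K" and t: "t \<ge> 0"
  shows "z t = z' t"
proof
  fix x
  have d: "lin_sol c (h + (- 1) *\<^sub>R h) (\<lambda>t x. z t x + (- 1) * z' t x)"
    by (intro lin_sol_add lin_sol_scaleR z)
  have "\<bar>z t x + (- 1) * z' t x\<bar> \<le> exp (K * t) * 0 * (1 + 0 * (x\<^sup>2 + 2 * t))"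
    by (rule lin_sol_bound[OF d c]) (use t in \<open>auto simp: plus_Cb.rep_eq scaleR_Cb.rep_eq zero_Cb.rep_eq\<close>)
  then show "z t x = z' t x" by simp
qed

definition linflow :: "(real \<Rightarrow> real \<Rightarrow> real) \<Rightarrow> real \<Rightarrow> Cb \<Rightarrow> Cb" where
  "linflow c t h = to_Cb ((SOME z. lin_sol c h z) t)"

lemma linflow_eq:
  assumes z: "lin_sol c h z" and c: "\<And>t x. t \<ge> 0 \<Longrightarrow> \<bar>c t x\<bar> \<le> K" and t: "t \<ge> 0"
  shows "apply_Cb (linflow c t h) = z t"
proof -
  have "lin_sol c h (SOME z. lin_sol c h z)" by (rule someI[of "lin_sol c h", OF z])
  then have "(SOME z. lin_sol c h z) t = z t" by (rule lin_sol_unique[OF _ z c t])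
  moreover have "apply_Cb (to_Cb (z t)) = z t"
  proof (rule apply_to_Cb)
    show "smooth (z t)"
      using z t regular_imp_smooth[of "{0<..}" True z t] smooth_Cb[of h] by (cases "t = 0") (auto simp: lin_sol_def)
    show "\<bar>z t x\<bar> \<le> exp (K * t) * norm h" for x
      using lin_sol_bound[OF z c, of "norm h" 0 t x] abs_Cb_le_norm[of h] t by simp
  qed
  ultimately show ?thesis by (simp add: linflow_def)
qed

lemma smooth_bounded_on_interval:
  assumes "smooth g"
  shows "\<exists>K>0. \<forall>a\<in>{-M..M}. \<bar>g a\<bar> \<le> K"
proof -
  have "compact (g ` {-M..M})" by (intro compact_continuous_image smooth_continuous assms) auto
  then show ?thesis using compact_imp_bounded[of "g ` {-M..M}"] by (auto simp: bounded_pos)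
qed

text \<open>
On \<open>\<bar>x\<bar> \<le> R\<close> this is uniform continuity on a compact set, and for \<open>\<bar>x\<bar> > R\<close> the weight exceeds the bound
of the family.  It turns locally uniform convergence into convergence with the weight \<open>1 + x\<^sup>2\<close>.
\<close>

lemma cont_bdd_weighted_uniform:
  fixes h :: "real \<Rightarrow> real \<Rightarrow> real"
  assumes S: "compact S" and h: "cont_bdd S h" and e: "e > 0"
  shows "\<exists>d>0. \<forall>s\<in>S. \<forall>s'\<in>S. \<bar>s - s'\<bar> < d \<longrightarrow> (\<forall>x. \<bar>h s x - h s' x\<bar> \<le> e * (1 + x\<^sup>2))"
proof -
  obtain B where B: "B > 0" "\<And>s x. s \<in> S \<Longrightarrow> \<bar>h s x\<bar> \<le> B" using cont_bdd_boundE[OF h S order_refl] by metis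
  define R where "R = 2 * B / e + 1"
  have R: "R \<ge> 1" "2 * B \<le> e * R" using B(1) e by (auto simp: R_def field_simps)
  have "uniformly_continuous_on (S \<times> {-R..R}) (\<lambda>(s, x). h s x)"
    by (intro compact_uniformly_continuous continuous_on_subset[OF cont_bdd_continuous[OF h]] compact_Times S) auto
  then obtain d where d: "d > 0"
    "\<And>q q'. q \<in> S \<times> {-R..R} \<Longrightarrow> q' \<in> S \<times> {-R..R} \<Longrightarrow> dist q' q < d \<Longrightarrow> dist ((\<lambda>(s, x). h s x) q') ((\<lambda>(s, x). h s x) q) < e"
    unfolding uniformly_continuous_on_def using e by metis
  have "\<bar>h s x - h s' x\<bar> \<le> e * (1 + x\<^sup>2)" if s: "s \<in> S" "s' \<in> S" "\<bar>s - s'\<bar> < d" for s s' x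
  proof (cases "\<bar>x\<bar> \<le> R")
    case True
    have "dist (h s x) (h s' x) < e"
      using d(2)[of "(s', x)" "(s, x)"] s True by (simp add: dist_Pair_Pair dist_real_def abs_le_iff)
    also have "e \<le> e * (1 + x\<^sup>2)" using e by simp
    finally show ?thesis by (simp add: dist_real_def)
  next
    case False
    have "\<bar>h s x - h s' x\<bar> \<le> B + B"
      using s by (intro order_trans[OF abs_triangle_ineq4] add_mono B)
    also have "\<dots> \<le> e * R" using R by simp
    also have "R * 1 \<le> \<bar>x\<bar> * \<bar>x\<bar>" using False R by (intro mult_mono) auto
    then have "e * R \<le> e * (1 + x\<^sup>2)" using e by (intro mult_left_mono) (auto simp: power2_eq_square)
    finally show ?thesis .
  qed
  then show ?thesis using d(1) by blast
qed

definition lin_coeff :: "(real \<Rightarrow> real) \<Rightarrow> Cb \<Rightarrow> real \<Rightarrow> real \<Rightarrow> real" where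
  "lin_coeff f v t x = deriv f (apply_Cb (Tflow f t v) x)"

context
  fixes f :: "real \<Rightarrow> real"
  assumes f: "smooth f" "f 0 = 0" and diss: "\<And>r. \<bar>r\<bar> \<ge> 1 \<Longrightarrow> r * f r \<le> 0"
begin

lemmas Tflow_props = Tflow_properties[OF f diss]

lemma T_0: "Tflow f 0 v = v" by (rule Tflow_props(1))
lemma T_cont_bdd: "cont_bdd {0..} (\<lambda>t. apply_Cb (Tflow f t v))" by (rule Tflow_props(2)) 
lemma T_regular: "regular {0<..} True k (\<lambda>t. apply_Cb (Tflow f t v))" by (rule Tflow_props(3))
lemma T_bound: "(\<And>x. \<bar>apply_Cb v x\<bar> \<le> M) \<Longrightarrow> M \<ge> 1 \<Longrightarrow> t \<ge> 0 \<Longrightarrow> \<bar>apply_Cb (Tflow f t v) x\<bar> \<le> M"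
  by (rule Tflow_props(4))
lemma T_parabolic: "parabolic T (\<lambda>t. apply_Cb (Tflow f t v)) (\<lambda>t x. f (apply_Cb (Tflow f t v) x))" by (rule Tflow_props(5))

lemma lin_coeff_regular: "cont_bdd {0..} (lin_coeff f v)" "regular {0<..} True k (lin_coeff f v)"
  unfolding lin_coeff_def[abs_def]
  by (rule cont_bdd_smooth_comp[OF smooth_deriv[OF f(1)] T_cont_bdd],
      rule regular_smooth_comp[OF smooth_deriv[OF f(1)] T_regular])

lemma lin_coeff_bounded: "\<exists>K>0. \<forall>t\<ge>0. \<forall>x. \<bar>lin_coeff f v t x\<bar> \<le> K"
proof -
  define M where "M = max 1 (norm v)"
  obtain K where K: "K > 0" "\<And>a. a \<in> {-M..M} \<Longrightarrow> \<bar>deriv f a\<bar> \<le> K"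
    using smooth_bounded_on_interval[OF smooth_deriv[OF f(1)], of M] by blast
  have "\<bar>apply_Cb (Tflow f t v) x\<bar> \<le> M" if "t \<ge> 0" for t x
    by (rule T_bound) (use abs_Cb_le_norm[of v] that in \<open>auto simp: M_def intro: le_max_iff_disj[THEN iffD2]\<close>)
  then have "\<bar>lin_coeff f v t x\<bar> \<le> K" if "t \<ge> 0" for t x
    unfolding lin_coeff_def using that by (intro K) (auto simp: abs_le_iff minus_le_iff)
  then show ?thesis using K(1) by blast
qed

lemma lin_coeff_sol_exists: "\<exists>z. lin_sol (lin_coeff f v) h z"
  using lin_coeff_bounded[of v] lin_sol_exists[OF lin_coeff_regular(1) _ lin_coeff_regular(2), of v _ h] by blast

lemma linflow_lin_coeff: "lin_sol (lin_coeff f v) h z \<Longrightarrow> t \<ge> 0 \<Longrightarrow> apply_Cb (linflow (lin_coeff f v) t h) = z t"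
  using lin_coeff_bounded[of v] linflow_eq[of "lin_coeff f v" h z _ t] by blast

lemma bounded_linear_linflow:
  assumes t: "t \<ge> 0"
  shows "bounded_linear (linflow (lin_coeff f v) t)"
proof -
  obtain K where K: "K > 0" "\<And>t x. t \<ge> 0 \<Longrightarrow> \<bar>lin_coeff f v t x\<bar> \<le> K" using lin_coeff_bounded by blast
  show ?thesis
  proof (rule bounded_linear_intro[where K = "exp (K * t)"])
    fix h h' :: Cb and a :: real
    obtain z z' where z: "lin_sol (lin_coeff f v) h z" "lin_sol (lin_coeff f v) h' z'"
      using lin_coeff_sol_exists by metis
    show "linflow (lin_coeff f v) t (h + h') = linflow (lin_coeff f v) t h + linflow (lin_coeff f v) t h'"
      by (rule apply_Cb_eqI)
         (simp add: plus_Cb.rep_eq linflow_lin_coeff[OF z(1) t] linflow_lin_coeff[OF z(2) t]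
           linflow_lin_coeff[OF lin_sol_add[OF z] t])
    show "linflow (lin_coeff f v) t (a *\<^sub>R h) = a *\<^sub>R linflow (lin_coeff f v) t h"
      by (rule apply_Cb_eqI)
         (simp add: scaleR_Cb.rep_eq linflow_lin_coeff[OF z(1) t] linflow_lin_coeff[OF lin_sol_scaleR[OF z(1)] t])
    show "norm (linflow (lin_coeff f v) t h) \<le> norm h * exp (K * t)"
    proof (rule norm_Cb_le)
      show "\<bar>apply_Cb (linflow (lin_coeff f v) t h) x\<bar> \<le> norm h * exp (K * t)" for x
        using lin_sol_bound[OF z(1) K(2), of "norm h" 0 t x] abs_Cb_le_norm[of h] t
        by (simp add: linflow_lin_coeff[OF z(1) t] mult.commute)
    qed
  qed
qed

text \<open>
The difference of two solutions minus the solution of the linearised equation solves a linear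
equation whose source is a Taylor remainder, hence of order \<open>\<parallel>w - v\<parallel>\<^sup>2\<close>.
\<close>

lemma Tflow_has_derivative:
  assumes t: "t \<ge> 0"
  shows "(Tflow f t has_derivative linflow (lin_coeff f v) t) (at v)"
proof -
  define M where "M = norm v + 1"
  have M1: "M \<ge> 1" by (simp add: M_def)
  obtain K where K: "K > 0" "\<And>a b. a \<in> {-M..M} \<Longrightarrow> b \<in> {-M..M} \<Longrightarrow> \<bar>f a - f b\<bar> \<le> K * \<bar>a - b\<bar>"
    using smooth_lipschitz_on_interval[OF f(1), of M] by blast
  obtain K2 where K2: "K2 > 0" "\<And>a b. a \<in> {-M..M} \<Longrightarrow> b \<in> {-M..M} \<Longrightarrow> \<bar>f a - f b - deriv f b * (a - b)\<bar> \<le> K2 * \<bar>a - b\<bar>\<^sup>2"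
    using smooth_taylor2_on_interval[OF f(1), of M] by blast
  obtain Kc where Kc: "Kc > 0" "\<And>t x. t \<ge> 0 \<Longrightarrow> \<bar>lin_coeff f v t x\<bar> \<le> Kc" using lin_coeff_bounded by blast
  define C where "C = exp (Kc * t) * (K2 * (exp (K * t))\<^sup>2 * t)"
  have main: "norm (Tflow f t w - Tflow f t v - linflow (lin_coeff f v) t (w - v)) \<le> C * norm (w - v) ^ 2"
    if w: "dist w v < 1" for w
  proof -
    define h where "h = w - v"
    have h1: "norm h < 1" using w by (simp add: h_def dist_norm)
    have "norm w \<le> norm v + norm h" using norm_triangle_ineq[of v h] by (simp add: h_def)
    then have nM: "norm v \<le> M" "norm w \<le> M" using h1 by (auto simp: M_def)
    have TM: "apply_Cb (Tflow f s v) x \<in> {-M..M}" "apply_Cb (Tflow f s w) x \<in> {-M..M}" if "s \<ge> 0" for s x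
      using T_bound[of v M s x] T_bound[of w M s x] M1 that
        order_trans[OF abs_Cb_le_norm nM(1)] order_trans[OF abs_Cb_le_norm nM(2)] by (auto simp: abs_le_iff)
    obtain z where z: "lin_sol (lin_coeff f v) h z" using lin_coeff_sol_exists by blast
    define d where "d s x = apply_Cb (Tflow f s w) x - apply_Cb (Tflow f s v) x" for s x
    have pd: "parabolic t d (\<lambda>s x. f (apply_Cb (Tflow f s w) x) - f (apply_Cb (Tflow f s v) x))"
      unfolding d_def by (rule parabolic_diff[OF T_parabolic T_parabolic])
    have d0: "d 0 x = apply_Cb h x" for x by (simp add: d_def h_def T_0 minus_Cb.rep_eq)
    have dh: "\<bar>d s x\<bar> \<le> exp (K * t) * norm h" if s: "s \<in> {0..t}" for s x
    proof -
      have "\<bar>d s x\<bar> \<le> exp (K * s) * (norm h + 0 * s)"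
      proof (rule parabolic_estimate_sup[OF pd])
        show "\<bar>d 0 x\<bar> \<le> norm h" for x by (simp add: d0 abs_Cb_le_norm)
        show "\<bar>f (apply_Cb (Tflow f s w) x) - f (apply_Cb (Tflow f s v) x)\<bar> \<le> K * \<bar>d s x\<bar> + 0"
          if "s \<in> {0<..t}" for s x
          unfolding d_def using TM that by (auto intro!: K(2))
      qed (use K s in auto)
      also have "\<dots> \<le> exp (K * t) * norm h" using s K(1) by (auto intro!: mult_right_mono)
      finally show ?thesis .
    qed
    have pe: "parabolic t (\<lambda>s x. d s x - z s x)
        (\<lambda>s x. (f (apply_Cb (Tflow f s w) x) - f (apply_Cb (Tflow f s v) x)) - lin_coeff f v s x * z s x)"
      using z by (intro parabolic_diff[OF pd]) (simp add: lin_sol_def)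
    have e: "\<bar>d t x - z t x\<bar> \<le> C * (norm h)\<^sup>2" for x
    proof -
      have "\<bar>d t x - z t x\<bar> \<le> exp (Kc * t) * (0 + K2 * (exp (K * t) * norm h)\<^sup>2 * t)"
      proof (rule parabolic_estimate_sup[OF pe])
        show "\<bar>d 0 x - z 0 x\<bar> \<le> 0" for x using z by (simp add: d0 lin_sol_def)
        fix s x assume s: "s \<in> {0<..t}"
        let ?a = "apply_Cb (Tflow f s w) x" and ?b = "apply_Cb (Tflow f s v) x"
        have "\<bar>f ?a - f ?b - lin_coeff f v s x * d s x\<bar> \<le> K2 * \<bar>d s x\<bar>\<^sup>2"
          unfolding lin_coeff_def d_def using TM s by (intro K2) auto
        also have "\<dots> \<le> K2 * (exp (K * t) * norm h)\<^sup>2"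
          using dh[of s x] s K2(1) by (intro mult_left_mono power_mono) auto
        finally have 1: "\<bar>f ?a - f ?b - lin_coeff f v s x * d s x\<bar> \<le> K2 * (exp (K * t) * norm h)\<^sup>2" .
        have 2: "\<bar>lin_coeff f v s x * (d s x - z s x)\<bar> \<le> Kc * \<bar>d s x - z s x\<bar>"
          unfolding abs_mult using Kc(2)[of s x] s by (intro mult_right_mono) auto
        have "f ?a - f ?b - lin_coeff f v s x * z s x
            = (f ?a - f ?b - lin_coeff f v s x * d s x) + lin_coeff f v s x * (d s x - z s x)"
          by (simp add: algebra_simps)
        then show "\<bar>f ?a - f ?b - lin_coeff f v s x * z s x\<bar> \<le> Kc * \<bar>d s x - z s x\<bar> + K2 * (exp (K * t) * norm h)\<^sup>2"
          using 1 2 by linarith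
      qed (use Kc K2 t in auto)
      then show ?thesis by (simp add: C_def power_mult_distrib mult_ac)
    qed
    show ?thesis
    proof (rule norm_Cb_le)
      show "\<bar>apply_Cb (Tflow f t w - Tflow f t v - linflow (lin_coeff f v) t (w - v)) x\<bar> \<le> C * (norm (w - v))\<^sup>2" for x
        using e[of x] by (simp add: minus_Cb.rep_eq linflow_lin_coeff[OF z t] d_def flip: h_def)
    qed
  qed
  show ?thesis
  proof (rule has_derivativeI_sandwich[where e = 1 and H = "\<lambda>w. C * norm (w - v)"])
    show "norm (Tflow f t w - Tflow f t v - linflow (lin_coeff f v) t (w - v)) / norm (w - v) \<le> C * norm (w - v)"
      if "w \<noteq> v" "dist w v < 1" for w
      using main[OF that(2)] that(1) by (simp add: divide_le_eq power2_eq_square mult_ac)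
    show "((\<lambda>w. C * norm (w - v)) \<longlongrightarrow> 0) (at v)"
      by (rule tendsto_eq_intros | simp)+
  qed (auto intro: bounded_linear_linflow[OF t])
qed

lemma DTflow_linflow: "t \<ge> 0 \<Longrightarrow> DTflow f t v = linflow (lin_coeff f v) t"
  unfolding DTflow_def using frechet_derivative_at[OF Tflow_has_derivative] by simp

lemma DTflow_bounded_linear: "t \<ge> 0 \<Longrightarrow> bounded_linear (DTflow f t v)"
  by (simp add: DTflow_linflow bounded_linear_linflow)

lemma DTflow_solution: "lin_sol (lin_coeff f v) h z \<Longrightarrow> t \<ge> 0 \<Longrightarrow> apply_Cb (DTflow f t v h) = z t"
  by (simp add: DTflow_linflow linflow_lin_coeff)

text \<open>
Continuity of the derivative for bounded, locally uniform convergence.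
\<close>

lemma DTflow_weighted:
  assumes t: "t \<ge> 0"
  shows "\<exists>C>0. \<forall>h a. a \<ge> 0 \<longrightarrow> (\<forall>x. \<bar>apply_Cb h x\<bar> \<le> a * (1 + x\<^sup>2)) \<longrightarrow>
    (\<forall>x. \<bar>apply_Cb (DTflow f t v h) x\<bar> \<le> C * a * (1 + x\<^sup>2))"
proof -
  obtain K where K: "K > 0" "\<And>t x. t \<ge> 0 \<Longrightarrow> \<bar>lin_coeff f v t x\<bar> \<le> K" using lin_coeff_bounded by blast
  have "\<bar>apply_Cb (DTflow f t v h) x\<bar> \<le> exp (K * t) * (1 + 2 * t) * a * (1 + x\<^sup>2)"
    if a: "a \<ge> 0" and h: "\<And>x. \<bar>apply_Cb h x\<bar> \<le> a * (1 + x\<^sup>2)" for h a x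
  proof -
    obtain z where z: "lin_sol (lin_coeff f v) h z" using lin_coeff_sol_exists by blast
    have "\<bar>z t x\<bar> \<le> exp (K * t) * a * (1 + 1 * (x\<^sup>2 + 2 * t))"
      by (rule lin_sol_bound[OF z K(2)]) (use h a t in auto)
    also have "\<dots> \<le> exp (K * t) * a * ((1 + 2 * t) * (1 + x\<^sup>2))"
      using a t by (intro mult_left_mono) (auto simp: algebra_simps)
    finally show ?thesis by (simp add: DTflow_solution[OF z t] mult_ac)
  qed
  moreover have "exp (K * t) * (1 + 2 * t) > 0" using t by auto
  ultimately show ?thesis by blast
qed

lemma DTflow_continuous:
  fixes S :: "real set"
  assumes t: "t \<ge> 0" and S: "compact S" and l: "cont_bdd S (\<lambda>s. apply_Cb (\<Sigma> s))"
  shows "continuous_on S (\<lambda>s. apply_Cb (DTflow f t v (\<Sigma> s)) x)"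
proof -
  obtain C where C: "C > 0" "\<And>h a x. a \<ge> 0 \<Longrightarrow> (\<And>x. \<bar>apply_Cb h x\<bar> \<le> a * (1 + x\<^sup>2)) \<Longrightarrow>
    \<bar>apply_Cb (DTflow f t v h) x\<bar> \<le> C * a * (1 + x\<^sup>2)"
    using DTflow_weighted[OF t] by metis
  interpret DT: bounded_linear "DTflow f t v" by (rule DTflow_bounded_linear[OF t])
  have pos: "1 + x\<^sup>2 > 0" by (rule add_pos_nonneg) auto
  show ?thesis unfolding continuous_on_iff
  proof (intro ballI allI impI)
    fix s e assume s: "s \<in> S" and e: "e > (0::real)"
    define a where "a = e / (2 * C * (1 + x\<^sup>2))"
    have a: "a > 0" using e C(1) pos by (simp add: a_def)
    obtain d where d: "d > 0" "\<And>s s' x. s \<in> S \<Longrightarrow> s' \<in> S \<Longrightarrow> \<bar>s - s'\<bar> < d \<Longrightarrow>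
        \<bar>apply_Cb (\<Sigma> s) x - apply_Cb (\<Sigma> s') x\<bar> \<le> a * (1 + x\<^sup>2)"
      using cont_bdd_weighted_uniform[OF S l a] by blast
    have "dist (apply_Cb (DTflow f t v (\<Sigma> s')) x) (apply_Cb (DTflow f t v (\<Sigma> s)) x) < e"
      if s': "s' \<in> S" "dist s' s < d" for s'
    proof -
      have "\<bar>apply_Cb (DTflow f t v (\<Sigma> s' - \<Sigma> s)) x\<bar> \<le> C * a * (1 + x\<^sup>2)"
        using a by (intro C) (use d(2)[OF s'(1) s] s' in \<open>auto simp: minus_Cb.rep_eq dist_real_def\<close>)
      also have "C * (e / (2 * C * P)) * P = e / 2" if "P > 0" for P using C(1) that by simp
      then have "C * a * (1 + x\<^sup>2) = e / 2" unfolding a_def using pos .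
      also have "\<dots> < e" using e by simp
      finally show ?thesis by (simp add: DT.diff minus_Cb.rep_eq dist_real_def)
    qed
    then show "\<exists>d>0. \<forall>s'\<in>S. dist s' s < d \<longrightarrow>
        dist (apply_Cb (DTflow f t v (\<Sigma> s')) x) (apply_Cb (DTflow f t v (\<Sigma> s)) x) < e"
      using d(1) by blast
  qed
qed

text \<open>
By the mean value theorem the remainder of the difference quotient of \<open>\<Sigma>\<close> is small with the weight
\<open>1 + x\<^sup>2\<close>, although it need not be small in the supremum norm.
\<close>

lemma DTflow_DERIV:
  assumes t: "t \<ge> 0" and l: "cont_bdd {a..b} (\<lambda>s. apply_Cb (\<Sigma>' s))"
    and der: "\<And>s x. s \<in> {a..b} \<Longrightarrow> ((\<lambda>s. apply_Cb (\<Sigma> s) x) has_real_derivative apply_Cb (\<Sigma>' s) x) (at s within {a..b})"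
    and s: "s \<in> {a..b}"
  shows "((\<lambda>s. apply_Cb (DTflow f t v (\<Sigma> s)) x) has_real_derivative apply_Cb (DTflow f t v (\<Sigma>' s)) x) (at s within {a..b})"
proof -
  obtain C where C: "C > 0" "\<And>h a x. a \<ge> 0 \<Longrightarrow> (\<And>x. \<bar>apply_Cb h x\<bar> \<le> a * (1 + x\<^sup>2)) \<Longrightarrow>
    \<bar>apply_Cb (DTflow f t v h) x\<bar> \<le> C * a * (1 + x\<^sup>2)"
    using DTflow_weighted[OF t] by metis
  interpret DT: bounded_linear "DTflow f t v" by (rule DTflow_bounded_linear[OF t])
  have pos: "1 + x\<^sup>2 > 0" by (rule add_pos_nonneg) auto
  show ?thesis unfolding has_field_derivative_def has_derivative_within_alt
  proof (intro conjI allI impI bounded_linear_mult_right)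
    fix e assume e: "e > (0::real)"
    define c where "c = e / (C * (1 + x\<^sup>2))"
    have c: "c > 0" using e C(1) pos by (simp add: c_def)
    obtain d where d: "d > 0" "\<And>s s' x. s \<in> {a..b} \<Longrightarrow> s' \<in> {a..b} \<Longrightarrow> \<bar>s - s'\<bar> < d \<Longrightarrow>
        \<bar>apply_Cb (\<Sigma>' s) x - apply_Cb (\<Sigma>' s') x\<bar> \<le> c * (1 + x\<^sup>2)"
      using cont_bdd_weighted_uniform[OF compact_Icc l c] by blast
    have "norm (apply_Cb (DTflow f t v (\<Sigma> y)) x - apply_Cb (DTflow f t v (\<Sigma> s)) x
        - apply_Cb (DTflow f t v (\<Sigma>' s)) x * (y - s)) \<le> e * norm (y - s)"
      if y: "y \<in> {a..b}" "norm (y - s) < d" for y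
    proof -
      define h where "h = \<Sigma> y - \<Sigma> s - (y - s) *\<^sub>R \<Sigma>' s"
      have h: "\<bar>apply_Cb h x\<bar> \<le> (c * norm (y - s)) * (1 + x\<^sup>2)" for x
      proof -
        let ?S = "closed_segment y s"
        have sub: "?S \<subseteq> {a..b}" using y s by (auto simp: closed_segment_eq_real_ivl split: if_splits)
        have "norm ((apply_Cb (\<Sigma> y) x - y * apply_Cb (\<Sigma>' s) x) - (apply_Cb (\<Sigma> s) x - s * apply_Cb (\<Sigma>' s) x))
            \<le> (c * (1 + x\<^sup>2)) * norm (y - s)"
        proof (rule field_differentiable_bound[of ?S _ "\<lambda>r. apply_Cb (\<Sigma>' r) x - apply_Cb (\<Sigma>' s) x"])
          fix r assume r: "r \<in> ?S"
          then have rin: "r \<in> {a..b}" using sub by auto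
          show "((\<lambda>r. apply_Cb (\<Sigma> r) x - r * apply_Cb (\<Sigma>' s) x) has_field_derivative
              apply_Cb (\<Sigma>' r) x - apply_Cb (\<Sigma>' s) x) (at r within ?S)"
            using DERIV_subset[OF der[OF rin] sub] by (auto intro!: derivative_eq_intros)
          have "\<bar>r - s\<bar> < d" using r y by (auto simp: closed_segment_eq_real_ivl split: if_splits)
          then show "norm (apply_Cb (\<Sigma>' r) x - apply_Cb (\<Sigma>' s) x) \<le> c * (1 + x\<^sup>2)"
            using d(2)[OF rin s] by simp
        qed auto
        moreover have "apply_Cb h x = (apply_Cb (\<Sigma> y) x - y * apply_Cb (\<Sigma>' s) x) - (apply_Cb (\<Sigma> s) x - s * apply_Cb (\<Sigma>' s) x)"
          unfolding h_def minus_Cb.rep_eq scaleR_Cb.rep_eq left_diff_distrib by simp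
        ultimately show ?thesis by (simp only: real_norm_def mult_ac)
      qed
      have "\<bar>apply_Cb (DTflow f t v h) x\<bar> \<le> C * (c * norm (y - s)) * (1 + x\<^sup>2)"
        using c by (intro C h) auto
      also have "\<dots> = e * norm (y - s)" using C(1) pos by (simp add: c_def)
      finally show ?thesis
        by (simp add: h_def DT.diff DT.scaleR minus_Cb.rep_eq scaleR_Cb.rep_eq mult.commute)
    qed
    then show "\<exists>d>0. \<forall>y\<in>{a..b}. norm (y - s) < d \<longrightarrow>
      norm (apply_Cb (DTflow f t v (\<Sigma> y)) x - apply_Cb (DTflow f t v (\<Sigma> s)) x
        - apply_Cb (DTflow f t v (\<Sigma>' s)) x * (y - s)) \<le> e * norm (y - s)"
      using d(1) by blast
  qed
qed

end

section \<open>The nonlinear variation of constants formula\<close>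

text \<open>
The first-order expansion \<open>t * g\<close> of the defect after a short time, as an approximate solution.
\<close>

lemma parabolic_linear_in_time:
  assumes l: "cont_bdd {0..T} (\<lambda>_. g)" and g: "smooth g"
  shows "parabolic T (\<lambda>t x. t * g x) (\<lambda>t x. g x - t * deriv (deriv g) x)"
proof (rule parabolic_I)
  have "cont_bdd {0..T} (\<lambda>t x. t)" using contb_time[of "{0..T}" "\<lambda>t. t" True] by (simp add: contb_def continuous_intros)
  from cont_bdd_mult[OF this l] show "cont_bdd {0..T} (\<lambda>t x. t * g x)" .
  fix t x assume "t \<in> {0<..T}"
  show "((\<lambda>x. t * g x) has_real_derivative t * deriv g x) (at x)"
    by (intro DERIV_cmult smooth_DERIV g)
  show "((\<lambda>x. t * deriv g x) has_real_derivative t * deriv (deriv g) x) (at x)"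
    by (intro DERIV_cmult smooth_DERIV smooth_deriv g)
  show "((\<lambda>s. s * g x) has_real_derivative t * deriv (deriv g) x + (g x - t * deriv (deriv g) x)) (at t within {0..T})"
    by (auto intro!: derivative_eq_intros)
qed

lemma fixed_time_weight:
  fixes h t x :: real
  assumes h: "0 \<le> h" "h \<le> t"
  shows "1 + 1 * (x\<^sup>2 + 2 * h) \<le> (1 + 2 * t) * (1 + x\<^sup>2)"
proof -
  have "2 * h \<le> 2 * t + 2 * P" if "0 \<le> P" for P using h that by linarith
  from this[of "t * x\<^sup>2"] have "1 + 1 * (x\<^sup>2 + 2 * h) \<le> 1 + x\<^sup>2 + 2 * t + 2 * (t * x\<^sup>2)"
    using h by simp
  also have "\<dots> = (1 + 2 * t) * (1 + x\<^sup>2)" by (simp add: algebra_simps)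
  finally show ?thesis .
qed

context
  fixes f :: "real \<Rightarrow> real" and V R :: "real \<Rightarrow> Cb"
  assumes f: "smooth f" "f 0 = 0" and diss: "\<And>r. \<bar>r\<bar> \<ge> 1 \<Longrightarrow> r * f r \<le> 0"
    and V: "cont_bdd {0..} (\<lambda>s. apply_Cb (V s))" and R: "cont_bdd {0<..} (\<lambda>s. apply_Cb (R s))"
    and R2: "\<And>s. s > 0 \<Longrightarrow> \<exists>C. \<forall>x. \<bar>deriv (deriv (apply_Cb (R s))) x\<bar> \<le> C"
    and V_DERIV: "\<And>s x. s > 0 \<Longrightarrow> ((\<lambda>s. apply_Cb (V s) x) has_real_derivative
      deriv (deriv (apply_Cb (V s))) x + (f (apply_Cb (V s) x) + apply_Cb (R s) x)) (at s)"
begin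

lemma V_parabolic: "parabolic T (\<lambda>s. apply_Cb (V s)) (\<lambda>s x. f (apply_Cb (V s) x) + apply_Cb (R s) x)"
proof (rule parabolic_I)
  show "cont_bdd {0..T} (\<lambda>s. apply_Cb (V s))" by (rule cont_bdd_subset[OF V]) auto
  fix s x assume s: "s \<in> {0<..T}"
  show "(apply_Cb (V s) has_real_derivative deriv (apply_Cb (V s)) x) (at x)"
    "(deriv (apply_Cb (V s)) has_real_derivative deriv (deriv (apply_Cb (V s))) x) (at x)"
    by (intro smooth_DERIV smooth_deriv smooth_Cb)+
  show "((\<lambda>s. apply_Cb (V s) x) has_real_derivative
      deriv (deriv (apply_Cb (V s))) x + (f (apply_Cb (V s) x) + apply_Cb (R s) x)) (at s within {0..T})"
    using s by (intro has_field_derivative_at_within[OF V_DERIV]) auto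
qed

lemma V_bound: "\<exists>M\<ge>1. \<forall>s\<in>{0..t}. \<forall>x. \<bar>apply_Cb (V s) x\<bar> \<le> M"
proof -
  have "compact {0..t}" "{0..t} \<subseteq> {0..}" by auto
  from cont_bdd_boundE[OF V this] obtain B where "\<And>s x. s \<in> {0..t} \<Longrightarrow> \<bar>apply_Cb (V s) x\<bar> \<le> B" by metis
  then show ?thesis by (intro exI[of _ "max 1 B"]) (auto simp: le_max_iff_disj)
qed

lemma T_in_interval:
  assumes "\<And>x. \<bar>apply_Cb v x\<bar> \<le> M" "M \<ge> 1" "\<tau> \<ge> 0"
  shows "apply_Cb (Tflow f \<tau> v) x \<in> {-M..M}"
  using T_bound[OF f diss assms, of x] by (auto simp: abs_le_iff)

text \<open>
What the perturbed solution \<open>V\<close> gains on the exact flow in time \<open>\<tau>\<close>, both started from \<open>V a\<close>.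
\<close>

definition defect :: "real \<Rightarrow> real \<Rightarrow> real \<Rightarrow> real" where
  "defect a \<tau> x = apply_Cb (V (\<tau> + a)) x - apply_Cb (Tflow f \<tau> (V a)) x"

lemma defect_parabolic:
  assumes "a \<ge> 0"
  shows "parabolic h (defect a) (\<lambda>\<tau> x. (f (apply_Cb (V (\<tau> + a)) x) + apply_Cb (R (\<tau> + a)) x)
     - f (apply_Cb (Tflow f \<tau> (V a)) x))"
  unfolding defect_def[abs_def]
  by (rule parabolic_diff[OF parabolic_shift[OF V_parabolic[of "h + a"] assms order_refl] T_parabolic[OF f diss]])

lemma defect_0: "defect a 0 x = 0"
  by (simp add: defect_def T_0[OF f diss])

lemma defect_bound:
  assumes M: "M \<ge> 1" "\<And>s x. s \<in> {0..t} \<Longrightarrow> \<bar>apply_Cb (V s) x\<bar> \<le> M"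
    and K: "K > 0" "\<And>a b. a \<in> {-M..M} \<Longrightarrow> b \<in> {-M..M} \<Longrightarrow> \<bar>f a - f b\<bar> \<le> K * \<bar>a - b\<bar>"
    and B: "\<And>s x. s \<in> {a<..a + h} \<Longrightarrow> \<bar>apply_Cb (R s) x\<bar> \<le> B" "B \<ge> 0"
    and a: "a \<ge> 0" "h \<ge> 0" "a + h \<le> t" and \<tau>: "\<tau> \<in> {0..h}"
  shows "\<bar>defect a \<tau> x\<bar> \<le> exp (K * t) * B * h"
proof -
  have "\<bar>defect a \<tau> x\<bar> \<le> exp (K * \<tau>) * (0 + B * \<tau>)"
  proof (rule parabolic_estimate_sup[OF defect_parabolic[OF a(1)]])
    fix s x assume s: "s \<in> {0<..h}"
    let ?a = "apply_Cb (V (s + a)) x" and ?b = "apply_Cb (Tflow f s (V a)) x"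
    have "?a \<in> {-M..M}" using M(2)[of "s + a" x] s a by (auto simp: abs_le_iff)
    moreover have "?b \<in> {-M..M}" by (rule T_in_interval) (use M a s in auto)
    ultimately have "\<bar>f ?a - f ?b\<bar> \<le> K * \<bar>?a - ?b\<bar>" by (rule K(2))
    moreover have "\<bar>apply_Cb (R (s + a)) x\<bar> \<le> B" using s by (intro B) auto
    ultimately show "\<bar>(f ?a + apply_Cb (R (s + a)) x) - f ?b\<bar> \<le> K * \<bar>defect a s x\<bar> + B"
      unfolding defect_def by linarith
  qed (use K B \<tau> defect_0 in auto)
  also have "\<dots> \<le> exp (K * t) * (B * h)"
    using \<tau> a K(1) B(2) by (auto intro!: mult_mono mult_left_mono)
  finally show ?thesis by (simp add: mult_ac)
qed

text \<open>
Follow the perturbed solution until time \<open>s\<close>, then the exact flow until time \<open>t\<close>.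
\<close>

definition interpolation :: "real \<Rightarrow> real \<Rightarrow> real \<Rightarrow> real" where
  "interpolation t x s = apply_Cb (Tflow f (t - s) (V s)) x"

text \<open>
Between the times \<open>p\<close> and \<open>q\<close>, with \<open>h = q - p\<close>, the defect is \<open>h R s\<close> up to a weighted error \<open>o(h)\<close>; from
\<open>q\<close> to \<open>t\<close> it is transported by the linearised flow up to an error \<open>O(h\<^sup>2)\<close>.  The base point \<open>s\<close> is either
\<open>p\<close> or \<open>q\<close>, which gives the right and the left derivative at once.
\<close>

lemma interpolation_step:
  assumes s: "0 < s" "s < t" and e: "e > 0"
  shows "\<exists>d>0. \<forall>p q. 0 < p \<longrightarrow> p \<le> q \<longrightarrow> q < t \<longrightarrow> q - p < d \<longrightarrow> (p = s \<or> q = s) \<longrightarrow>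
     \<bar>interpolation t x q - interpolation t x p - (q - p) * apply_Cb (DTflow f (t - s) (V s) (R s)) x\<bar> \<le> e * (q - p)"
proof -
  obtain M where M: "M \<ge> 1" "\<And>s x. s \<in> {0..t} \<Longrightarrow> \<bar>apply_Cb (V s) x\<bar> \<le> M" using V_bound[of t] by blast
  obtain K0 where K0: "K0 > 0" "\<And>a b. a \<in> {-M..M} \<Longrightarrow> b \<in> {-M..M} \<Longrightarrow> \<bar>f a - f b\<bar> \<le> K0 * \<bar>a - b\<bar>"
    using smooth_lipschitz_on_interval[OF f(1), of M] by blast
  obtain K1 where K1: "K1 > 0" "\<And>a. a \<in> {-M..M} \<Longrightarrow> \<bar>deriv f a\<bar> \<le> K1"
    using smooth_bounded_on_interval[OF smooth_deriv[OF f(1)], of M] by blast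
  obtain K2 where K2: "K2 > 0" "\<And>a b. a \<in> {-M..M} \<Longrightarrow> b \<in> {-M..M} \<Longrightarrow> \<bar>f a - f b - deriv f b * (a - b)\<bar> \<le> K2 * \<bar>a - b\<bar>\<^sup>2"
    using smooth_taylor2_on_interval[OF f(1), of M] by blast
  define K where "K = max K0 K1"
  have K: "K > 0" "\<And>a b. a \<in> {-M..M} \<Longrightarrow> b \<in> {-M..M} \<Longrightarrow> \<bar>f a - f b\<bar> \<le> K * \<bar>a - b\<bar>"
    "\<And>a. a \<in> {-M..M} \<Longrightarrow> \<bar>deriv f a\<bar> \<le> K"
  proof -
    show "K > 0" using K0 by (simp add: K_def)
    show "\<bar>f a - f b\<bar> \<le> K * \<bar>a - b\<bar>" if "a \<in> {-M..M}" "b \<in> {-M..M}" for a b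
      by (rule order_trans[OF K0(2)[OF that]]) (auto simp: K_def intro!: mult_right_mono)
    show "\<bar>deriv f a\<bar> \<le> K" if "a \<in> {-M..M}" for a
      using K1(2)[OF that] by (simp add: K_def)
  qed
  define d0 where "d0 = min s (t - s) / 2"
  have d0: "d0 > 0" "d0 < s" "d0 < t - s" using s by (auto simp: d0_def min_def)
  define S where "S = {s - d0..s + d0}"
  have S: "compact S" "S \<subseteq> {0<..}" "S \<subseteq> {0..t}" using d0 by (auto simp: S_def)
  obtain B where B: "B > 0" "\<And>s x. s \<in> S \<Longrightarrow> \<bar>apply_Cb (R s) x\<bar> \<le> B"
    using cont_bdd_boundE[OF R S(1,2)] by metis
  obtain C2 where C2: "\<And>x. \<bar>deriv (deriv (apply_Cb (R s))) x\<bar> \<le> C2" using R2[OF s(1)] by blast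
  have C2': "C2 \<ge> 0" using order_trans[OF abs_ge_zero C2[of 0]] .
  obtain z where z: "lin_sol (lin_coeff f (V s)) (R s) z" using lin_coeff_sol_exists[OF f diss] by blast
  have zl: "cont_bdd {0..t} z" using z by (auto simp: lin_sol_def intro: cont_bdd_subset)
  have z0: "z 0 = apply_Cb (R s)" using z by (simp add: lin_sol_def)
  have DT: "apply_Cb (DTflow f (t - s) (V s) (R s)) = z (t - s)"
    by (rule DTflow_solution[OF f diss z]) (use s in linarith)+
  \<comment> \<open>\<open>A\<close> and \<open>A3\<close> are the constants of the comparison on \<open>[p, q]\<close>; \<open>Q\<close> is the one of the final estimate\<close>
  define A where "A = exp (K * t) * 2 * (1 + 2 * t)"
  define A3 where "A3 = exp (K * t) * (exp (K * t) * B)"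
  define Q where "Q = exp (K * t) * (A + 1 + t) * (1 + 1 * (x\<^sup>2 + 2 * t))"
  have A0: "A \<ge> 0" using s by (simp add: A_def)
  have A30: "A3 > 0" using B by (simp add: A3_def)
  have "A + 1 + t > 0" using A0 s by linarith
  moreover have "1 + 1 * (x\<^sup>2 + 2 * t) > 0" using s by (intro add_pos_nonneg) auto
  ultimately have Q: "Q > 0" unfolding Q_def by simp
  define e1 where "e1 = e / Q"
  have e1: "e1 > 0" using e Q by (simp add: e1_def)
  obtain d1 where d1: "d1 > 0" "\<And>a b x. a \<in> S \<Longrightarrow> b \<in> S \<Longrightarrow> \<bar>a - b\<bar> < d1 \<Longrightarrow>
      \<bar>apply_Cb (R a) x - apply_Cb (R b) x\<bar> \<le> e1 * (1 + x\<^sup>2)"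
    using cont_bdd_weighted_uniform[OF S(1) cont_bdd_subset[OF R S(2)] e1] by blast
  obtain d2 where d2: "d2 > 0" "\<And>a b x. a \<in> {0..t} \<Longrightarrow> b \<in> {0..t} \<Longrightarrow> \<bar>a - b\<bar> < d2 \<Longrightarrow>
      \<bar>z a x - z b x\<bar> \<le> e1 * (1 + x\<^sup>2)"
    using cont_bdd_weighted_uniform[OF compact_Icc zl e1] by blast
  define d where "d = min (min d0 d1) (min d2 (min (e1 / (C2 + K * (B + 1))) (e1 / (K2 * A3\<^sup>2))))"
  have d: "d > 0" unfolding d_def using d0 d1(1) d2(1) e1 K B C2' K2 A30
    by (auto intro!: divide_pos_pos add_nonneg_pos)
  have "\<bar>interpolation t x q - interpolation t x p - (q - p) * z (t - s) x\<bar> \<le> e * (q - p)"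
    if pq: "0 < p" "p \<le> q" "q < t" "q - p < d" "p = s \<or> q = s" for p q
  proof -
    define h where "h = q - p"
    have h: "0 \<le> h" "h < d0" "h < d1" "h < d2" "h \<le> t"
      using pq s by (auto simp: h_def d_def)
    have "h < e1 / (C2 + K * (B + 1))" "h < e1 / (K2 * A3\<^sup>2)"
      using pq(4) by (auto simp: h_def d_def)
    then have h1: "h * (C2 + K * (B + 1)) \<le> e1" and h2: "h * (K2 * A3\<^sup>2) \<le> e1"
      using K K2 A30 B C2' by (auto simp: less_divide_eq add_nonneg_pos intro: less_imp_le)
    have pS: "p \<in> S" "q \<in> S" using pq(5) h by (auto simp: S_def h_def)
    have win: "\<tau> + p \<in> S" if "\<tau> \<in> {0..h}" for \<tau> using that pS by (auto simp: S_def h_def)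
    have MT: "apply_Cb (Tflow f \<tau> (V a)) y \<in> {-M..M}" if "\<tau> \<ge> 0" "a \<in> {0..t}" for \<tau> a y
      by (rule T_in_interval) (use M that in auto)
    have MV: "apply_Cb (V a) y \<in> {-M..M}" if "a \<in> {0..t}" for a y
      using M(2)[OF that, of y] by (auto simp: abs_le_iff)
    have St: "p \<in> {0..t}" "q \<in> {0..t}" "s \<in> {0..t}" using pq s by auto
    have weight: "1 \<le> 1 + y\<^sup>2" for y :: real by simp
    \<comment> \<open>on \<open>[p, q]\<close> the defect is compared with its first-order expansion \<open>\<tau> * R s\<close>\<close>
    have E1: "\<bar>defect p \<tau> y\<bar> \<le> exp (K * t) * B * h" if "\<tau> \<in> {0..h}" for \<tau> y
    proof (rule defect_bound[OF M K(1,2) _ _ _ h(1) _ that])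
      show "\<bar>apply_Cb (R r) x\<bar> \<le> B" if "r \<in> {p<..p + h}" for r x
        using that pS by (intro B(2)) (auto simp: S_def h_def)
    qed (use B pq in \<open>auto simp: h_def\<close>)
    have lR: "cont_bdd {0..h} (\<lambda>_. apply_Cb (R s))" by (rule cont_bdd_Cb)
    note pe = parabolic_diff[OF defect_parabolic[of p h] parabolic_linear_in_time[OF lR smooth_Cb]]
    have E2: "\<bar>defect p h y - h * apply_Cb (R s) y\<bar> \<le> A * e1 * h * (1 + y\<^sup>2)" for y
    proof -
      have "\<bar>defect p h y - h * apply_Cb (R s) y\<bar> \<le> exp (K * h) * (0 + (2 * e1) * h) * (1 + 1 * (y\<^sup>2 + 2 * h))"
      proof (rule parabolic_estimate[OF pe])
        fix \<tau> y assume \<tau>: "\<tau> \<in> {0<..h}"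
        let ?a = "apply_Cb (V (\<tau> + p)) y" and ?b = "apply_Cb (Tflow f \<tau> (V p)) y"
        have "\<tau> + p \<in> {0..t}" using \<tau> pq by (auto simp: h_def)
        then have f1: "\<bar>f ?a - f ?b\<bar> \<le> K * \<bar>defect p \<tau> y\<bar>"
          unfolding defect_def using \<tau> St by (intro K(2) MV MT) auto
        have "\<tau> * \<bar>apply_Cb (R s) y\<bar> \<le> h * B"
          using \<tau> B pS pq(5) by (intro mult_mono) auto
        then have f2: "\<bar>defect p \<tau> y\<bar> \<le> \<bar>defect p \<tau> y - \<tau> * apply_Cb (R s) y\<bar> + h * B"
          using \<tau> abs_triangle_ineq2[of "defect p \<tau> y" "\<tau> * apply_Cb (R s) y"] by (simp add: abs_mult)
        have f3: "\<bar>apply_Cb (R (\<tau> + p)) y - apply_Cb (R s) y\<bar> \<le> e1 * (1 + y\<^sup>2)"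
          using pS pq(5) \<tau> h by (intro d1(2) win) (auto simp: h_def)
        have f4: "\<bar>\<tau> * deriv (deriv (apply_Cb (R s))) y\<bar> \<le> h * C2"
          unfolding abs_mult using \<tau> C2 h by (intro mult_mono) auto
        have f5: "K * (h * B) + h * C2 \<le> e1 * (1 + y\<^sup>2)"
        proof -
          have "K * (h * B) + h * C2 \<le> h * (C2 + K * (B + 1))" using h(1) K(1) by (simp add: algebra_simps)
          also have "\<dots> \<le> e1 * 1" using h1 by simp
          also have "\<dots> \<le> e1 * (1 + y\<^sup>2)" using e1 by (intro mult_left_mono) auto
          finally show ?thesis .
        qed
        have "\<bar>((f ?a + apply_Cb (R (\<tau> + p)) y) - f ?b) - (apply_Cb (R s) y - \<tau> * deriv (deriv (apply_Cb (R s))) y)\<bar>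
            \<le> K * \<bar>defect p \<tau> y\<bar> + e1 * (1 + y\<^sup>2) + h * C2"
          using f1 f3 f4 by linarith
        also have "K * \<bar>defect p \<tau> y\<bar> \<le> K * \<bar>defect p \<tau> y - \<tau> * apply_Cb (R s) y\<bar> + K * (h * B)"
          using mult_left_mono[OF f2, of K] K(1) by (simp add: algebra_simps)
        finally show "\<bar>((f ?a + apply_Cb (R (\<tau> + p)) y) - f ?b) - (apply_Cb (R s) y - \<tau> * deriv (deriv (apply_Cb (R s))) y)\<bar>
            \<le> K * \<bar>defect p \<tau> y - \<tau> * apply_Cb (R s) y\<bar> + (2 * e1) * (1 + 1 * y\<^sup>2)"
          using f5 by (simp add: algebra_simps)
      qed (use pq K e1 h defect_0 in auto)
      also have "\<dots> \<le> exp (K * t) * ((2 * e1) * h) * ((1 + 2 * t) * (1 + y\<^sup>2))"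
        using h(1,5) K(1) e1 by (intro mult_mono fixed_time_weight) auto
      finally show ?thesis by (simp add: A_def mult_ac)
    qed
    \<comment> \<open>on \<open>[q, t]\<close> the two exact solutions started from \<open>V p\<close> and \<open>V q\<close> are compared with \<open>h * z\<close>\<close>
    define D where "D \<tau> y = apply_Cb (Tflow f \<tau> (V q)) y - apply_Cb (Tflow f (\<tau> + h) (V p)) y" for \<tau> y
    have pD: "parabolic (t - q) D (\<lambda>\<tau> y. f (apply_Cb (Tflow f \<tau> (V q)) y) - f (apply_Cb (Tflow f (\<tau> + h) (V p)) y))"
      unfolding D_def by (rule parabolic_diff[OF T_parabolic[OF f diss] parabolic_shift[OF T_parabolic[OF f diss] h(1) order_refl]])
    have D0: "D 0 y = defect p h y" for y
      by (simp add: D_def defect_def T_0[OF f diss] h_def)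
    have DA: "\<bar>D \<tau> y\<bar> \<le> A3 * h" if \<tau>: "\<tau> \<in> {0..t - q}" for \<tau> y
    proof -
      have "\<bar>D \<tau> y\<bar> \<le> exp (K * \<tau>) * (exp (K * t) * B * h + 0 * \<tau>)"
      proof (rule parabolic_estimate_sup[OF pD])
        show "\<bar>D 0 y\<bar> \<le> exp (K * t) * B * h" for y unfolding D0 using h by (intro E1) auto
        show "\<bar>f (apply_Cb (Tflow f \<tau> (V q)) y) - f (apply_Cb (Tflow f (\<tau> + h) (V p)) y)\<bar> \<le> K * \<bar>D \<tau> y\<bar> + 0"
          if "\<tau> \<in> {0<..t - q}" for \<tau> y
          unfolding D_def using that h St by (auto intro!: K(2) MT)
      qed (use K B h \<tau> in auto)
      also have "\<dots> \<le> exp (K * t) * (exp (K * t) * B * h)"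
        using \<tau> K(1) B h pq by (auto intro!: mult_right_mono)
      finally show ?thesis by (simp add: A3_def mult_ac)
    qed
    \<comment> \<open>the linearised solution \<open>z\<close> starts at \<open>s\<close>, the comparison at \<open>q\<close>\<close>
    define r where "r = q - s"
    have r: "r = 0 \<and> q = s \<or> r = h \<and> p = s" using pq(5) by (auto simp: r_def h_def)
    have r0: "r \<ge> 0" "r \<le> h" using r h by auto
    have pz: "parabolic (t - s) z (\<lambda>\<tau> y. lin_coeff f (V s) \<tau> y * z \<tau> y)" using z by (simp add: lin_sol_def)
    have "t - q + r \<le> t - s" by (simp add: r_def)
    note pW = parabolic_diff[OF pD parabolic_cmult[OF parabolic_shift[OF pz r0(1) this], of h]]
    have "\<bar>D (t - q) x - h * z (t - q + r) x\<bar>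
        \<le> exp (K * (t - q)) * ((A + 1) * e1 * h + e1 * h * (t - q)) * (1 + 1 * (x\<^sup>2 + 2 * (t - q)))"
    proof (rule parabolic_estimate[OF pW])
      show "\<bar>D 0 y - h * z (0 + r) y\<bar> \<le> (A + 1) * e1 * h * (1 + 1 * y\<^sup>2)" for y
      proof -
        have "\<bar>z r y - z 0 y\<bar> \<le> e1 * (1 + y\<^sup>2)"
          using r0 h pq by (intro d2(2)) auto
        then have "h * \<bar>apply_Cb (R s) y - z r y\<bar> \<le> h * (e1 * (1 + y\<^sup>2))"
          using h(1) z0 by (intro mult_left_mono) (auto simp: abs_minus_commute)
        then have "\<bar>h * apply_Cb (R s) y - h * z r y\<bar> \<le> e1 * h * (1 + y\<^sup>2)"
          using h(1) by (simp add: abs_mult mult_ac flip: right_diff_distrib)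
        moreover have "(A + 1) * e1 * h * (1 + 1 * y\<^sup>2) = A * e1 * h * (1 + y\<^sup>2) + e1 * h * (1 + y\<^sup>2)"
          by (simp add: distrib_right)
        ultimately show ?thesis using E2[of y] by (simp add: D0)
      qed
      fix \<tau> y assume \<tau>: "\<tau> \<in> {0<..t - q}"
      let ?a = "apply_Cb (Tflow f \<tau> (V q)) y" and ?b = "apply_Cb (Tflow f (\<tau> + h) (V p)) y"
      let ?c = "lin_coeff f (V s) (\<tau> + r) y"
      have ab: "?a \<in> {-M..M}" "?b \<in> {-M..M}" using \<tau> h St by (auto intro!: MT simp del: atLeastAtMost_iff)
      have c: "?c = deriv f ?a \<or> ?c = deriv f ?b" using r by (auto simp: lin_coeff_def)
      then have cK: "\<bar>?c\<bar> \<le> K" using K(3) ab by auto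
      have "\<bar>f ?a - f ?b - ?c * D \<tau> y\<bar> \<le> K2 * \<bar>D \<tau> y\<bar>\<^sup>2"
        using c
      proof
        assume "?c = deriv f ?b"
        then show ?thesis using K2(2)[OF ab] by (simp add: D_def)
      next
        assume c: "?c = deriv f ?a"
        have "\<bar>f ?b - f ?a - deriv f ?a * (?b - ?a)\<bar> \<le> K2 * \<bar>?b - ?a\<bar>\<^sup>2" by (rule K2(2)[OF ab(2,1)])
        moreover have "f ?a - f ?b - ?c * D \<tau> y = - (f ?b - f ?a - deriv f ?a * (?b - ?a))"
          unfolding c D_def by (simp add: algebra_simps)
        ultimately show ?thesis by (simp add: D_def power2_commute)
      qed
      also have "\<dots> \<le> K2 * (A3 * h)\<^sup>2"
        using DA[of \<tau> y] \<tau> K2(1) by (intro mult_left_mono power_mono) auto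
      also have "\<dots> = h * (h * (K2 * A3\<^sup>2))" by (simp add: power2_eq_square mult_ac)
      also have "\<dots> \<le> h * (e1 * (1 + 1 * y\<^sup>2))"
      proof (rule mult_left_mono[OF _ h(1)])
        show "h * (K2 * A3\<^sup>2) \<le> e1 * (1 + 1 * y\<^sup>2)"
          using h2 mult_left_mono[OF weight[of y] less_imp_le[OF e1]] by simp
      qed
      finally have 1: "\<bar>f ?a - f ?b - ?c * D \<tau> y\<bar> \<le> e1 * h * (1 + 1 * y\<^sup>2)" by (simp add: mult_ac)
      have "\<bar>?c * (D \<tau> y - h * z (\<tau> + r) y)\<bar> \<le> K * \<bar>D \<tau> y - h * z (\<tau> + r) y\<bar>"
        unfolding abs_mult by (intro mult_right_mono cK) auto
      moreover have "f ?a - f ?b - h * (?c * z (\<tau> + r) y)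
          = (f ?a - f ?b - ?c * D \<tau> y) + ?c * (D \<tau> y - h * z (\<tau> + r) y)"
        by (simp add: algebra_simps)
      ultimately show "\<bar>f ?a - f ?b - h * (?c * z (\<tau> + r) y)\<bar>
          \<le> K * \<bar>D \<tau> y - h * z (\<tau> + r) y\<bar> + e1 * h * (1 + 1 * y\<^sup>2)"
        using 1 by linarith
    qed (use A0 e1 h K pq in auto)
    also have "\<dots> \<le> exp (K * t) * ((A + 1) * e1 * h + e1 * h * t) * (1 + 1 * (x\<^sup>2 + 2 * t))"
      using A0 e1 h(1) K(1) pq by (intro mult_mono add_left_mono mult_left_mono) (auto intro!: add_nonneg_nonneg)
    also have "\<dots> = e1 * Q * h" by (simp add: Q_def algebra_simps)
    also have "\<dots> = e * h" using Q by (simp add: e1_def)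
    finally have "\<bar>D (t - q) x - h * z (t - q + r) x\<bar> \<le> e * h" .
    moreover have "t - q + r = t - s" by (simp add: r_def)
    moreover have "D (t - q) x = interpolation t x q - interpolation t x p" by (simp add: D_def interpolation_def h_def)
    ultimately show ?thesis by (simp add: h_def)
  qed
  then show ?thesis unfolding DT using d by blast
qed

lemma interpolation_DERIV:
  assumes s: "0 < s" "s < t"
  shows "(interpolation t x has_real_derivative apply_Cb (DTflow f (t - s) (V s) (R s)) x) (at s)"
  unfolding has_field_derivative_def has_derivative_at_alt
proof (intro conjI allI impI bounded_linear_mult_right)
  fix e :: real assume e: "e > 0"
  let ?z = "apply_Cb (DTflow f (t - s) (V s) (R s)) x"
  obtain d where d: "d > 0" "\<And>p q. 0 < p \<Longrightarrow> p \<le> q \<Longrightarrow> q < t \<Longrightarrow> q - p < d \<Longrightarrow> p = s \<or> q = s \<Longrightarrow>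
      \<bar>interpolation t x q - interpolation t x p - (q - p) * ?z\<bar> \<le> e * (q - p)"
    using interpolation_step[OF s e, of x] by blast
  have "norm (interpolation t x y - interpolation t x s - ?z * (y - s)) \<le> e * norm (y - s)" if y: "norm (y - s) < min d (min s (t - s))" for y
  proof (cases "s \<le> y")
    case True
    then show ?thesis using d(2)[of s y] y s by (simp add: mult.commute)
  next
    case False
    then have "\<bar>interpolation t x s - interpolation t x y - (s - y) * ?z\<bar> \<le> e * (s - y)" using y s by (intro d(2)) auto
    moreover have "interpolation t x y - interpolation t x s - ?z * (y - s) = - (interpolation t x s - interpolation t x y - (s - y) * ?z)"
      by (simp add: algebra_simps)
    ultimately show ?thesis using False by simp
  qed
  moreover have "min d (min s (t - s)) > 0" using d s by simp
  ultimately show "\<exists>d>0. \<forall>y. norm (y - s) < d \<longrightarrow>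
      norm (interpolation t x y - interpolation t x s - ?z * (y - s)) \<le> e * norm (y - s)" by blast
qed

text \<open>
\<open>V s\<close> and the exact solution have the common initial value \<open>V 0\<close>, so they differ little in the weighted
sense; convergence in the supremum norm fails here in general.
\<close>

lemma interpolation_continuous_0:
  assumes t: "t > 0"
  shows "continuous (at 0 within {0..t}) (interpolation t x)"
  unfolding continuous_within_eps_delta
proof (intro allI impI)
  fix e :: real assume e: "e > 0"
  obtain M where M: "M \<ge> 1" "\<And>s x. s \<in> {0..t} \<Longrightarrow> \<bar>apply_Cb (V s) x\<bar> \<le> M" using V_bound[of t] by blast
  obtain K where K: "K > 0" "\<And>a b. a \<in> {-M..M} \<Longrightarrow> b \<in> {-M..M} \<Longrightarrow> \<bar>f a - f b\<bar> \<le> K * \<bar>a - b\<bar>"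
    using smooth_lipschitz_on_interval[OF f(1), of M] by blast
  define Q where "Q = exp (K * t) * ((1 + 2 * t) * (1 + x\<^sup>2))"
  have Q: "Q > 0" unfolding Q_def using t by (intro mult_pos_pos add_pos_nonneg) auto
  define e1 where "e1 = e / (2 * Q)"
  have e1: "e1 > 0" using e Q by (simp add: e1_def)
  define h where "h s y = apply_Cb (V s) y - apply_Cb (Tflow f s (V 0)) y" for s y
  have "cont_bdd {0..t} h" unfolding h_def
    by (intro cont_bdd_diff) (auto intro: cont_bdd_subset[OF V] cont_bdd_subset[OF T_cont_bdd[OF f diss]])
  from cont_bdd_weighted_uniform[OF compact_Icc this e1]
  obtain d where d: "d > 0" "\<And>s s' x. s \<in> {0..t} \<Longrightarrow> s' \<in> {0..t} \<Longrightarrow> \<bar>s - s'\<bar> < d \<Longrightarrow> \<bar>h s x - h s' x\<bar> \<le> e1 * (1 + x\<^sup>2)"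
    by blast
  have h0: "h 0 y = 0" for y by (simp add: h_def T_0[OF f diss])
  have "dist (interpolation t x s) (interpolation t x 0) < e" if s: "s \<in> {0..t}" "dist s 0 < d" for s
  proof -
    have hs: "\<bar>h s y\<bar> \<le> e1 * (1 + 1 * y\<^sup>2)" for y
      using d(2)[of s 0 y] s t by (simp add: h0)
    define D where "D \<tau> y = apply_Cb (Tflow f \<tau> (V s)) y - apply_Cb (Tflow f (\<tau> + s) (V 0)) y" for \<tau> y
    have s0: "s \<ge> 0" using s by simp
    have pD: "parabolic (t - s) D (\<lambda>\<tau> y. f (apply_Cb (Tflow f \<tau> (V s)) y) - f (apply_Cb (Tflow f (\<tau> + s) (V 0)) y))"
      unfolding D_def by (rule parabolic_diff[OF T_parabolic[OF f diss] parabolic_shift[OF T_parabolic[OF f diss] s0 order_refl]])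
    have "\<bar>D (t - s) x\<bar> \<le> exp (K * (t - s)) * (e1 + 0 * (t - s)) * (1 + 1 * (x\<^sup>2 + 2 * (t - s)))"
    proof (rule parabolic_estimate[OF pD])
      show "\<bar>D 0 y\<bar> \<le> e1 * (1 + 1 * y\<^sup>2)" for y
        using hs[of y] by (simp add: D_def h_def T_0[OF f diss])
      fix \<tau> y assume \<tau>: "\<tau> \<in> {0<..t - s}"
      have "\<bar>f (apply_Cb (Tflow f \<tau> (V s)) y) - f (apply_Cb (Tflow f (\<tau> + s) (V 0)) y)\<bar> \<le> K * \<bar>D \<tau> y\<bar>"
        unfolding D_def by (intro K(2) T_in_interval) (use M s \<tau> in auto)
      then show "\<bar>f (apply_Cb (Tflow f \<tau> (V s)) y) - f (apply_Cb (Tflow f (\<tau> + s) (V 0)) y)\<bar>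
          \<le> K * \<bar>D \<tau> y\<bar> + 0 * (1 + 1 * y\<^sup>2)" by simp
    qed (use e1 K s in auto)
    also have "\<dots> \<le> exp (K * t) * e1 * ((1 + 2 * t) * (1 + x\<^sup>2))"
      using s K(1) e1 by (intro mult_mono fixed_time_weight) (auto intro!: mult_left_mono)
    also have "\<dots> = Q * e1" by (simp add: Q_def mult_ac)
    also have "\<dots> = e / 2" using Q by (simp add: e1_def)
    also have "\<dots> < e" using e by simp
    finally show ?thesis by (simp add: D_def interpolation_def dist_real_def)
  qed
  then show "\<exists>d>0. \<forall>s\<in>{0..t}. dist s 0 < d \<longrightarrow> dist (interpolation t x s) (interpolation t x 0) < e" using d(1) by blast
qed

lemma interpolation_continuous_end:
  assumes t: "t > 0"
  shows "continuous (at t within {0..t}) (interpolation t x)"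
  unfolding continuous_within_eps_delta
proof (intro allI impI)
  fix e :: real assume e: "e > 0"
  obtain M where M: "M \<ge> 1" "\<And>s x. s \<in> {0..t} \<Longrightarrow> \<bar>apply_Cb (V s) x\<bar> \<le> M" using V_bound[of t] by blast
  obtain K where K: "K > 0" "\<And>a b. a \<in> {-M..M} \<Longrightarrow> b \<in> {-M..M} \<Longrightarrow> \<bar>f a - f b\<bar> \<le> K * \<bar>a - b\<bar>"
    using smooth_lipschitz_on_interval[OF f(1), of M] by blast
  have "compact {t/2..t}" "{t/2..t} \<subseteq> {0<..}" using t by auto
  from cont_bdd_boundE[OF R this] obtain B where B: "B > 0" "\<And>s x. s \<in> {t/2..t} \<Longrightarrow> \<bar>apply_Cb (R s) x\<bar> \<le> B" by metis
  define d where "d = min (t/2) (e / (exp (K * t) * B))"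
  have "d > 0" using t e B by (simp add: d_def)
  moreover have "dist (interpolation t x s) (interpolation t x t) < e" if s: "s \<in> {0..t}" "dist s t < d" for s
  proof -
    have ts: "t - s < d" using s by (simp add: dist_real_def)
    have "\<bar>defect s (t - s) x\<bar> \<le> exp (K * t) * B * (t - s)"
    proof (rule defect_bound[OF M K])
      show "\<bar>apply_Cb (R r) x\<bar> \<le> B" if "r \<in> {s<..s + (t - s)}" for r x
        using that ts by (intro B(2)) (auto simp: d_def)
    qed (use s B in auto)
    also have "\<dots> < e" using ts B by (simp add: d_def less_divide_eq mult_ac)
    finally show ?thesis by (simp add: defect_def interpolation_def dist_real_def T_0[OF f diss] abs_minus_commute)
  qed
  ultimately show "\<exists>d>0. \<forall>s\<in>{0..t}. dist s t < d \<longrightarrow> dist (interpolation t x s) (interpolation t x t) < e" by blast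
qed

text \<open>
The defect \<open>R\<close> is only required on positive times: for the splitting \<open>YX\<close> it
involves \<open>\<partial>\<^sub>xX\<^sup>su0\<close>, which may be unbounded in space at \<open>s = 0\<close>.
\<close>

theorem alekseev_groebner:
  assumes t: "t \<ge> 0"
  shows "((\<lambda>s. apply_Cb (DTflow f (t - s) (V s) (R s)) x) has_integral
    (apply_Cb (V t) x - apply_Cb (Tflow f t (V 0)) x)) {0..t}"
proof (cases "t = 0")
  case True
  then show ?thesis by (simp add: T_0[OF f diss] has_integral_refl)
next
  case False
  then have t0: "t > 0" using t by simp
  have "((\<lambda>s. apply_Cb (DTflow f (t - s) (V s) (R s)) x) has_integral (interpolation t x t - interpolation t x 0)) {0..t}"
  proof (rule fundamental_theorem_of_calculus_interior[OF t])
    show "(interpolation t x has_vector_derivative apply_Cb (DTflow f (t - s) (V s) (R s)) x) (at s)" if "s \<in> {0<..<t}" for s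
      using interpolation_DERIV[of s t x] that by (simp add: has_real_derivative_iff_has_vector_derivative)
    show "continuous_on {0..t} (interpolation t x)"
      unfolding continuous_on_eq_continuous_within
    proof
      fix s assume "s \<in> {0..t}"
      then consider "s = 0" | "s = t" | "0 < s" "s < t" by fastforce
      then show "continuous (at s within {0..t}) (interpolation t x)"
      proof cases
        case 3
        then show ?thesis using DERIV_isCont[OF interpolation_DERIV] continuous_at_imp_continuous_at_within by blast
      qed (use interpolation_continuous_0[OF t0] interpolation_continuous_end[OF t0] in auto)
    qed
  qed
  then show ?thesis by (simp add: interpolation_def T_0[OF f diss])
qed

end

section \<open>The flow of the ordinary differential equation\<close>

lemma smooth_exp: "smooth (exp :: real \<Rightarrow> real)"
proof -
  have "(deriv ^^ n) exp = (exp :: real \<Rightarrow> real)" for n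
    by (induction n) (auto intro!: ext DERIV_imp_deriv)
  then show ?thesis
    unfolding smooth_def field_differentiable_def by (metis DERIV_exp)
qed

text \<open>
The continuous extension of the difference quotient \<open>(f b - f a) / (b - a)\<close> to the diagonal.
\<close>

definition divdiff :: "(real \<Rightarrow> real) \<Rightarrow> real \<Rightarrow> real \<Rightarrow> real" where
  "divdiff f a b = integral {0..1} (\<lambda>\<theta>. deriv f (a + \<theta> * (b - a)))"

lemma divdiff_same: "divdiff f a a = deriv f a"
  by (simp add: divdiff_def)

lemma divdiff_continuous:
  assumes f: "smooth f"
  shows "continuous_on UNIV (\<lambda>(a, b). divdiff f a b)"
proof -
  have "continuous_on (UNIV \<times> cbox 0 1) (\<lambda>(q, \<theta>). deriv f (fst q + \<theta> * (snd q - fst q)))"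
    unfolding split_beta'
    by (intro continuous_on_compose2[OF smooth_continuous[OF smooth_deriv[OF f], of UNIV]] continuous_intros) auto
  from integral_continuous_on_param[OF this] show ?thesis
    by (simp add: divdiff_def split_beta')
qed

lemma divdiff_eq:
  assumes f: "smooth f"
  shows "f b - f a = divdiff f a b * (b - a)"
proof -
  have "((\<lambda>\<theta>. deriv f (a + \<theta> * (b - a)) * (b - a)) has_integral (f (a + 1 * (b - a)) - f (a + 0 * (b - a)))) {0..1}"
  proof (rule fundamental_theorem_of_calculus)
    fix \<theta> :: real
    have "((\<lambda>\<theta>. a + \<theta> * (b - a)) has_real_derivative (b - a)) (at \<theta> within {0..1})"
      by (auto intro!: derivative_eq_intros)
    from DERIV_chain2[OF smooth_DERIV[OF f] this]
    show "((\<lambda>\<theta>. f (a + \<theta> * (b - a))) has_vector_derivative deriv f (a + \<theta> * (b - a)) * (b - a)) (at \<theta> within {0..1})"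
      by (simp add: has_real_derivative_iff_has_vector_derivative)
  qed auto
  from integral_unique[OF this]
  have "integral {0..1} (\<lambda>\<theta>. deriv f (a + \<theta> * (b - a)) * (b - a)) = f b - f a"
    by simp
  then show ?thesis by (simp add: divdiff_def)
qed

text \<open>
The difference of two solutions of \<open>y' = f(y)\<close> solves a linear equation whose coefficient is the
divided difference of \<open>f\<close>.  Uniqueness, Lipschitz continuity and differentiability in the
initial value are all read off from this identity.
\<close>

lemma ode_difference:
  fixes p q :: "real \<Rightarrow> real"
  assumes f: "smooth f" and T: "T \<ge> 0"
    and p: "continuous_on {0..T} p" "\<And>t. t \<in> {0<..<T} \<Longrightarrow> (p has_real_derivative f (p t)) (at t)"
    and q: "continuous_on {0..T} q" "\<And>t. t \<in> {0<..<T} \<Longrightarrow> (q has_real_derivative f (q t)) (at t)"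
  shows "q T - p T = (q 0 - p 0) * exp (integral {0..T} (\<lambda>s. divdiff f (p s) (q s)))"
proof (cases "T = 0")
  case False
  then have T0: "T > 0" using T by simp
  define Q where "Q s = divdiff f (p s) (q s)" for s
  have cQ: "continuous_on {0..T} Q"
    unfolding Q_def
    by (rule continuous_on_compose2[OF divdiff_continuous[OF f], of _ "\<lambda>s. (p s, q s)", simplified])
       (intro continuous_intros p q)
  define r where "r t = (q t - p t) * exp (- integral {0..t} Q)" for t
  have "r T = r 0"
  proof (rule DERIV_isconst2[OF T0])
    show "continuous_on {0..T} r"
      unfolding r_def
      by (intro continuous_intros p q indefinite_integral_continuous_1 integrable_continuous_real cQ)
    fix t assume t: "0 < t" "t < T"
    have "((\<lambda>t. integral {0..t} Q) has_real_derivative Q t) (at t within {0..T})"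
      by (rule integral_has_real_derivative[OF cQ]) (use t in auto)
    then have I: "((\<lambda>t. integral {0..t} Q) has_real_derivative Q t) (at t)"
      using t by (simp add: at_within_Icc_at)
    have "f (q t) - f (p t) = Q t * (q t - p t)" unfolding Q_def by (rule divdiff_eq[OF f])
    have "(r has_real_derivative (f (q t) - f (p t)) * exp (- integral {0..t} Q)
        + (exp (- integral {0..t} Q) * - Q t) * (q t - p t)) (at t)"
      unfolding r_def using t by (auto intro!: derivative_eq_intros p(2) q(2) I)
    then show "(r has_real_derivative 0) (at t)"
      unfolding \<open>f (q t) - f (p t) = Q t * (q t - p t)\<close> by simp
  qed (use T0 in auto)
  then have "(q T - p T) * exp (- integral {0..T} Q) = q 0 - p 0" by (simp add: r_def)
  then have "(q T - p T) * (exp (- integral {0..T} Q) * exp (integral {0..T} Q)) = (q 0 - p 0) * exp (integral {0..T} Q)"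
    by (simp add: mult.assoc[symmetric])
  then show ?thesis unfolding Q_def[symmetric] by (simp flip: exp_add)
qed simp

text \<open>
Contrary to \<open>Yflow\<close> this is a function of two real variables; its smoothness in the initial value
gives the smoothness of the time slices of \<open>Yflow\<close>.
\<close>

definition is_ode_flow :: "(real \<Rightarrow> real) \<Rightarrow> (real \<Rightarrow> real \<Rightarrow> real) \<Rightarrow> bool" where
  "is_ode_flow f y \<longleftrightarrow> (\<forall>a. y 0 a = a \<and> (\<forall>t\<ge>0. \<bar>y t a\<bar> \<le> max 1 \<bar>a\<bar>) \<and>
     (\<forall>t\<ge>0. ((\<lambda>s. y s a) has_real_derivative f (y t a)) (at t within {0..})))"

text \<open>
Mild solutions with \<open>\<kappa> = 0\<close> and constant initial value, evaluated at the point 0.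
\<close>

lemma ode_flow_exists:
  assumes f: "smooth f" "f 0 = 0" and diss: "\<And>r. \<bar>r\<bar> \<ge> 1 \<Longrightarrow> r * f r \<le> 0"
  shows "\<exists>y. is_ode_flow f y"
proof -
  have "\<exists>y. y 0 = a \<and> (\<forall>t\<ge>0. \<bar>y t\<bar> \<le> max 1 \<bar>a\<bar>) \<and>
     (\<forall>t\<ge>0. (y has_real_derivative f (y t)) (at t within {0..}))" for a
  proof -
    have a: "continuous_on UNIV (\<lambda>_::real. a)" "\<bar>a\<bar> \<le> max 1 \<bar>a\<bar>" "max 1 \<bar>a\<bar> \<ge> 1" by auto
    obtain u K w where K: "K > 0" and uM: "\<And>t x. t \<ge> 0 \<Longrightarrow> \<bar>u t x\<bar> \<le> max 1 \<bar>a\<bar>" and w: "cont_bdd {0..} w"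
      and u: "\<And>t x. u t x = exp (- K * t) * w t x"
      and eq: "\<And>t x. t \<ge> 0 \<Longrightarrow> w t x = gauss_avg 1 (sqrt (2 * 0 * t)) (\<lambda>_. a) x
        + duhamel 0 0 (\<lambda>s x. exp (K * s) * (f (u s x) + K * u s x)) t x"
      by (rule semilinear_exists[OF f diss a order_refl]) (assumption | rule that)+
    define g where "g s = exp (K * s) * (f (u s 0) + K * u s 0)" for s
    have cw: "continuous_on {0..} (\<lambda>t. w t 0)" by (intro cont_bdd_compose[OF w] continuous_intros) auto
    have cg: "continuous_on {0..} g"
      unfolding g_def u
      by (intro continuous_intros cw continuous_on_compose2[OF smooth_continuous[OF f(1), of UNIV]]) auto
    have w0: "w t 0 = a + integral {0..t} g" if "t \<ge> 0" for t
      using eq[OF that, of 0] by (simp add: duhamel_def g_def[abs_def])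
    have dw: "((\<lambda>t. w t 0) has_real_derivative g t) (at t within {0..})" if t: "t \<ge> 0" for t
    proof -
      have "((\<lambda>s. a + integral {0..s} g) has_real_derivative g t) (at t within {0..t + 1})"
        using t by (auto intro!: derivative_eq_intros integral_has_real_derivative continuous_on_subset[OF cg])
      then have "((\<lambda>t. w t 0) has_real_derivative g t) (at t within {0..t + 1})"
        by (rule has_field_derivative_transform_within[OF _ zero_less_one]) (use t w0 in auto)
      moreover have "at t within {0..t + 1} = at t within {0..}"
        by (rule at_within_nhd[of _ "{..<t + 1}"]) (use t in auto)
      ultimately show ?thesis by simp
    qed
    have "((\<lambda>t. u t 0) has_real_derivative f (u t 0)) (at t within {0..})" if t: "t \<ge> 0" for t
    proof -
      have "((\<lambda>t. exp (- K * t) * w t 0) has_real_derivative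
          (exp (- K * t) * - K) * w t 0 + exp (- K * t) * g t) (at t within {0..})"
        by (auto intro!: derivative_eq_intros dw[OF t])
      moreover have "exp (- K * t) * g t = f (u t 0) + K * u t 0" by (simp add: g_def flip: exp_add mult.assoc)
      ultimately show ?thesis by (simp add: u)
    qed
    moreover have "u 0 0 = a" using w0[of 0] by (simp add: u)
    ultimately show ?thesis using uM by (intro exI[of _ "\<lambda>t. u t 0"]) auto
  qed
  then obtain y where "\<forall>a. y a 0 = a \<and> (\<forall>t\<ge>0. \<bar>y a t\<bar> \<le> max 1 \<bar>a\<bar>) \<and>
     (\<forall>t\<ge>0. (y a has_real_derivative f (y a t)) (at t within {0..}))" by metis
  then show ?thesis unfolding is_ode_flow_def by (intro exI[of _ "\<lambda>t a. y a t"]) simp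
qed

lemma continuous_on_time_integral:
  fixes u :: "real \<Rightarrow> real \<Rightarrow> real"
  assumes u: "continuous_on ({0..} \<times> UNIV) (\<lambda>(t, a). u t a)"
  shows "continuous_on ({0..} \<times> UNIV) (\<lambda>(t, a). integral {0..t} (\<lambda>s. u s a))"
proof -
  have "continuous_on (({0..} \<times> UNIV) \<times> cbox 0 1) (\<lambda>(q, \<theta>). fst q * u (\<theta> * fst q) (snd q))"
    unfolding split_beta'
    by (intro continuous_intros continuous_on_compose2[OF u, of _ "\<lambda>v. (snd v * fst (fst v), snd (fst v))", simplified]) auto
  from integral_continuous_on_param[OF this]
  have "continuous_on ({0..} \<times> UNIV) (\<lambda>q. integral {0..1} (\<lambda>\<theta>. fst q * u (\<theta> * fst q) (snd q)))" by simp
  then show ?thesis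
  proof (rule continuous_on_eq)
    fix q :: "real \<times> real" assume q: "q \<in> {0..} \<times> UNIV"
    have "continuous_on {0..fst q} (\<lambda>s. u s (snd q))"
      by (rule continuous_on_compose2[OF u, of _ "\<lambda>s. (s, snd q)", simplified]) (auto intro!: continuous_intros)
    from integral_to_unit[OF this] q
    show "integral {0..1} (\<lambda>\<theta>. fst q * u (\<theta> * fst q) (snd q)) = (\<lambda>(t, a). integral {0..t} (\<lambda>s. u s a)) q"
      by (auto simp: split_beta')
  qed
qed

lemma time_integral_DERIV:
  assumes u: "regular {0..} False (Suc k) u" and t: "t \<ge> 0"
  shows "((\<lambda>a. integral {0..t} (\<lambda>s. u s a)) has_real_derivative integral {0..t} (\<lambda>s. deriv (u s) a)) (at a)"
proof -
  have c0: "contb {0..} False u" using u by simp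
  have c1: "contb {0..} False (\<lambda>t. deriv (u t))" using u by (auto dest: regular_contb)
  have "((\<lambda>a. integral (cbox 0 t) (\<lambda>s. u s a)) has_field_derivative integral (cbox 0 t) (\<lambda>s. deriv (u s) a)) (at a within UNIV)"
  proof (rule leibniz_rule_field_derivative)
    show "((\<lambda>a. u s a) has_field_derivative deriv (u s) a) (at a within UNIV)" if "s \<in> cbox 0 t" for a s
      using regular_Suc_DERIV[OF u, of s a] that by simp
    show "(\<lambda>s. u s a) integrable_on cbox 0 t" for a
      using contb_compose[OF c0, of "{0..t}" "\<lambda>s. s" "\<lambda>_. a"]
      by (auto intro!: integrable_continuous_real continuous_intros)
    show "continuous_on (UNIV \<times> cbox 0 t) (\<lambda>(a, s). deriv (u s) a)"
      unfolding split_beta' by (intro contb_compose[OF c1] continuous_intros) auto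
  qed auto
  then show ?thesis by simp
qed

lemma regular_time_integral: "regular {0..} False k u \<Longrightarrow> regular {0..} False k (\<lambda>t a. integral {0..t} (\<lambda>s. u s a))"
proof (induction k arbitrary: u)
  case 0
  then show ?case using continuous_on_time_integral[of u] by (simp add: contb_def)
next
  case (Suc k)
  show ?case
  proof (rule regular_SucI)
    show "contb {0..} False (\<lambda>t a. integral {0..t} (\<lambda>s. u s a))"
      using continuous_on_time_integral[of u] Suc.prems by (simp add: contb_def)
    show "regular {0..} False k (\<lambda>t a. integral {0..t} (\<lambda>s. deriv (u s) a))"
      by (rule Suc.IH) (use Suc.prems in simp)
  qed (use time_integral_DERIV[OF Suc.prems] in auto)
qed

context
  fixes f :: "real \<Rightarrow> real" and y :: "real \<Rightarrow> real \<Rightarrow> real"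
  assumes f: "smooth f" and y: "is_ode_flow f y"
begin

lemma y_0 [simp]: "y 0 a = a" using y by (simp add: is_ode_flow_def)
lemma y_bound: "t \<ge> 0 \<Longrightarrow> \<bar>y t a\<bar> \<le> max 1 \<bar>a\<bar>" using y by (simp add: is_ode_flow_def)
lemma y_DERIV: "t \<ge> 0 \<Longrightarrow> ((\<lambda>s. y s a) has_real_derivative f (y t a)) (at t within {0..})"
  using y by (simp add: is_ode_flow_def)

lemma y_DERIV_at: "t > 0 \<Longrightarrow> ((\<lambda>s. y s a) has_real_derivative f (y t a)) (at t)"
  using y_DERIV[of t a] at_within_interior[of t "{0..}"] by simp

lemma y_continuous_t: "continuous_on {0..} (\<lambda>s. y s a)"
  using y_DERIV by (auto intro!: DERIV_continuous_on[where D = "\<lambda>t. f (y t a)"])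

lemma y_difference:
  assumes t: "t \<ge> 0"
  shows "y t b - y t a = (b - a) * exp (integral {0..t} (\<lambda>s. divdiff f (y s a) (y s b)))"
proof -
  have c: "continuous_on {0..t} (\<lambda>s. y s a)" for a by (rule continuous_on_subset[OF y_continuous_t]) auto
  have d: "((\<lambda>s. y s a) has_real_derivative f (y s a)) (at s)" if "s \<in> {0<..<t}" for s a
    using y_DERIV_at that by simp
  show ?thesis using ode_difference[OF f t c d c d, of b a] by simp
qed

lemma y_lipschitz:
  "\<exists>L. \<forall>t\<in>{0..T}. \<forall>a\<in>{-N..N}. \<forall>b\<in>{-N..N}. \<bar>y t b - y t a\<bar> \<le> L * \<bar>b - a\<bar>"
proof -
  define M where "M = max 1 N"
  obtain K where K: "K > 0" "\<And>a. a \<in> {-M..M} \<Longrightarrow> \<bar>deriv f a\<bar> \<le> K"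
    using smooth_bounded_on_interval[OF smooth_deriv[OF f], of M] by blast
  have yM: "y s a \<in> {-M..M}" if "s \<ge> 0" "a \<in> {-N..N}" for s a
  proof -
    have "\<bar>a\<bar> \<le> N" using that by auto
    then show ?thesis using y_bound[OF that(1), of a] by (auto simp: M_def max_def split: if_splits)
  qed
  have dd: "divdiff f p q \<le> K" if pq: "p \<in> {-M..M}" "q \<in> {-M..M}" for p q
  proof -
    have seg: "p + \<theta> * (q - p) \<in> {-M..M}" if "\<theta> \<in> {0..1}" for \<theta>
    proof -
      have "(1 - \<theta>) *\<^sub>R p + \<theta> *\<^sub>R q \<in> {-M..M}"
        using that pq by (intro convexD[OF convex_real_interval(5)]) auto
      then show ?thesis by (simp add: algebra_simps)
    qed
    have "norm (divdiff f p q) \<le> integral {0..1::real} (\<lambda>_. K)"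
      unfolding divdiff_def
    proof (rule integral_norm_bound_integral)
      show "(\<lambda>\<theta>. deriv f (p + \<theta> * (q - p))) integrable_on {0..1}"
        by (intro integrable_continuous_real continuous_on_compose2[OF smooth_continuous[OF smooth_deriv[OF f], of UNIV]] continuous_intros) auto
      show "norm (deriv f (p + \<theta> * (q - p))) \<le> K" if "\<theta> \<in> {0..1}" for \<theta>
        using K(2)[OF seg[OF that]] by simp
    qed auto
    then show ?thesis by simp
  qed
  have "\<bar>y t b - y t a\<bar> \<le> exp (K * T) * \<bar>b - a\<bar>" if "t \<in> {0..T}" "a \<in> {-N..N}" "b \<in> {-N..N}" for t a b
  proof -
    have "integral {0..t} (\<lambda>s. divdiff f (y s a) (y s b)) \<le> integral {0..t} (\<lambda>_. K)"
    proof (rule integral_le)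
      have "continuous_on {0..t} (\<lambda>s. divdiff f (y s a) (y s b))"
        by (rule continuous_on_compose2[OF divdiff_continuous[OF f], of _ "\<lambda>s. (y s a, y s b)", simplified])
           (auto intro!: continuous_intros continuous_on_subset[OF y_continuous_t])
      then show "(\<lambda>s. divdiff f (y s a) (y s b)) integrable_on {0..t}" by (rule integrable_continuous_real)
      show "divdiff f (y s a) (y s b) \<le> K" if "s \<in> {0..t}" for s
        using that \<open>a \<in> _\<close> \<open>b \<in> _\<close> by (intro dd yM) auto
    qed auto
    also have "\<dots> \<le> K * T" using that K(1) by (simp add: mult.commute mult_left_mono)
    finally have "exp (integral {0..t} (\<lambda>s. divdiff f (y s a) (y s b))) \<le> exp (K * T)" by simp
    then have "\<bar>b - a\<bar> * exp (integral {0..t} (\<lambda>s. divdiff f (y s a) (y s b))) \<le> \<bar>b - a\<bar> * exp (K * T)"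
      by (intro mult_left_mono) auto
    then show ?thesis using that by (simp add: y_difference abs_mult mult.commute)
  qed
  then show ?thesis by blast
qed

lemma y_continuous: "continuous_on ({0..} \<times> UNIV) (\<lambda>(t, a). y t a)"
  unfolding continuous_on_iff
proof (intro ballI allI impI)
  fix q :: "real \<times> real" and e :: real assume q: "q \<in> {0..} \<times> UNIV" and e: "e > 0"
  obtain t a where ta: "q = (t, a)" "t \<ge> 0" using q by auto
  have "a \<in> {- (\<bar>a\<bar> + 1)..\<bar>a\<bar> + 1}" by auto
  with y_lipschitz[of "t + 1" "\<bar>a\<bar> + 1"]
  obtain L where L: "\<And>s b. s \<in> {0..t + 1} \<Longrightarrow> b \<in> {- (\<bar>a\<bar> + 1)..\<bar>a\<bar> + 1} \<Longrightarrow> \<bar>y s b - y s a\<bar> \<le> L * \<bar>b - a\<bar>"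
    by blast
  have "\<exists>d>0. \<forall>s\<in>{0..}. dist s t < d \<longrightarrow> dist (y s a) (y t a) < e / 2"
    using y_continuous_t[of a, unfolded continuous_on_iff] ta(2) e by (meson atLeast_iff half_gt_zero)
  then obtain d where d: "d > 0" "\<And>s. s \<ge> 0 \<Longrightarrow> dist s t < d \<Longrightarrow> dist (y s a) (y t a) < e / 2" by auto
  define d' where "d' = min (min d 1) (e / (2 * (\<bar>L\<bar> + 1)))"
  have "d' > 0" using d(1) e by (simp add: d'_def)
  moreover have "dist (y s b) (y t a) < e" if sb: "s \<ge> 0" "dist (s, b) (t, a) < d'" for s b
  proof -
    have ds: "dist s t < d'" "dist b a < d'"
      using sb dist_fst_le[of "(s, b)" "(t, a)"] dist_snd_le[of "(s, b)" "(t, a)"] by auto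
    then have "s \<in> {0..t + 1}" "b \<in> {- (\<bar>a\<bar> + 1)..\<bar>a\<bar> + 1}"
      using sb(1) by (auto simp: d'_def dist_real_def)
    then have "\<bar>y s b - y s a\<bar> \<le> L * \<bar>b - a\<bar>" by (rule L)
    also have "\<dots> \<le> (\<bar>L\<bar> + 1) * \<bar>b - a\<bar>" by (intro mult_right_mono) auto
    also have "\<dots> < (\<bar>L\<bar> + 1) * (e / (2 * (\<bar>L\<bar> + 1)))"
      using ds(2) by (intro mult_strict_left_mono) (auto simp: d'_def dist_real_def)
    also have "\<dots> = e / 2" by (simp add: field_simps)
    finally have "\<bar>y s b - y s a\<bar> < e / 2" .
    moreover have "dist (y s a) (y t a) < e / 2" using d(2)[OF sb(1)] ds by (simp add: d'_def)
    ultimately show ?thesis unfolding dist_real_def by linarith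
  qed
  ultimately show "\<exists>d>0. \<forall>q'\<in>{0..} \<times> UNIV. dist q' q < d \<longrightarrow> dist ((\<lambda>(t, a). y t a) q') ((\<lambda>(t, a). y t a) q) < e"
    unfolding ta(1) by (intro exI[of _ d']) auto
qed

lemma y_contb: "contb {0..} False y"
  using y_continuous by (simp add: contb_def)

text \<open>
The difference quotient is the exponential in \<open>y_difference\<close>; it is continuous in \<open>b\<close>, so Caratheodory's
criterion applies.
\<close>

lemma y_DERIV_a:
  assumes t: "t \<ge> 0"
  shows "(y t has_real_derivative exp (integral {0..t} (\<lambda>s. deriv f (y s a)))) (at a)"
proof -
  define E where "E b = exp (integral {0..t} (\<lambda>s. divdiff f (y s a) (y s b)))" for b
  have "continuous_on (UNIV \<times> cbox 0 t) (\<lambda>(b, s). divdiff f (y s a) (y s b))"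
    unfolding split_beta'
    by (rule continuous_on_compose2[OF divdiff_continuous[OF f], of _ "\<lambda>q. (y (snd q) a, y (snd q) (fst q))", simplified])
       (intro continuous_intros contb_compose[OF y_contb]; auto)
  from integral_continuous_on_param[OF this]
  have "continuous_on UNIV E" unfolding E_def by (intro continuous_intros) simp
  then have "isCont E a" by (simp add: continuous_on_eq_continuous_at)
  moreover have "y t b - y t a = E b * (b - a)" for b
    using y_difference[OF t, of b a] by (simp add: E_def mult.commute)
  ultimately have "(y t has_real_derivative E a) (at a)"
    unfolding CARAT_DERIV by (intro exI[of _ E]) auto
  then show ?thesis by (simp add: E_def divdiff_same)
qed

text \<open>
The derivative is an expression in \<open>y\<close> itself, so each step of the induction gives one more.
\<close>

lemma y_regular: "regular {0..} False k y"
proof (induction k)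
  case 0
  then show ?case using y_contb by simp
next
  case (Suc k)
  show ?case
  proof (rule regular_SucI[OF y_contb])
    show "(y t has_real_derivative exp (integral {0..t} (\<lambda>s. deriv f (y s a)))) (at a)" if "t \<in> {0..}" for t a
      using y_DERIV_a that by simp
    show "regular {0..} False k (\<lambda>t a. exp (integral {0..t} (\<lambda>s. deriv f (y s a))))"
      by (rule regular_smooth_comp[OF smooth_exp regular_time_integral[OF regular_smooth_comp[OF smooth_deriv[OF f] Suc.IH]]])
  qed
qed

lemma y_comp_smooth:
  assumes t: "t \<ge> 0" and v: "smooth v"
  shows "smooth (\<lambda>x. y t (v x))"
  using regular_imp_smooth[of "{0..}" False "\<lambda>t x. y t (v x)" t] regular_comp[OF y_regular regular_smooth[OF v]] t by simp

lemma Yflow_y: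
  assumes t: "t \<ge> 0"
  shows "apply_Cb (Yflow f t v) x = y t (apply_Cb v x)"
proof -
  define M where "M = max 1 (norm v)"
  define u where "u t x = y t (apply_Cb v x)" for t x
  have u0: "u 0 x = apply_Cb v x" for x by (simp add: u_def)
  have cu: "continuous_on ({0..} \<times> UNIV) (\<lambda>(t, x). u t x)"
    unfolding u_def split_beta'
    by (intro contb_compose[OF y_contb] continuous_intros continuous_on_compose2[OF smooth_continuous[OF smooth_Cb[of v], of UNIV]]) auto
  have uM: "\<bar>u t x\<bar> \<le> M" if "t \<ge> 0" for t x
    using y_bound[OF that, of "apply_Cb v x"] abs_Cb_le_norm[of v x] by (simp add: u_def M_def)
  have sm: "smooth (u t)" if "t > 0" for t
    unfolding u_def using that by (intro y_comp_smooth smooth_Cb) auto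
  have du: "((\<lambda>s. u s x) has_real_derivative (\<lambda>v x. f (v x)) (u t) x) (at t)" if "t > 0" for t x
    unfolding u_def using y_DERIV_at[OF that] by simp
  note b = bounded_solutionI[of u v M "\<lambda>v x. f (v x)", OF u0 cu uM sm du]
  have bs: "bounded_solution (\<lambda>v x. f (apply_Cb v x)) v (\<lambda>t. to_Cb (u t))" by (rule b(1))
  have ut: "apply_Cb (to_Cb (u t)) = u t" if "t \<ge> 0" for t by (rule b(2)) (use that in auto)
  have "Yflow f t v = to_Cb (u t)"
    unfolding Yflow_def
  proof (rule flow_eqI[where u = "\<lambda>t. to_Cb (u t)", OF bs])
    fix w assume w: "bounded_solution (\<lambda>v x. f (apply_Cb v x)) v w"
    show "w t = to_Cb (u t)"
    proof (rule apply_Cb_eqI)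
      fix x
      have cw: "continuous_on ({0..} \<times> UNIV) (\<lambda>(t, x). apply_Cb (w t) x)" using w by (simp add: bounded_solution_def)
      have "continuous_on {0..t} (\<lambda>s. apply_Cb (w s) x)"
        by (rule continuous_on_compose2[OF cw, of _ "\<lambda>s. (s, x)", simplified]) (auto intro!: continuous_intros)
      moreover have "((\<lambda>s. apply_Cb (w s) x) has_real_derivative f (apply_Cb (w s) x)) (at s)" if "s \<in> {0<..<t}" for s
        using w that by (simp add: bounded_solution_def)
      moreover have "continuous_on {0..t} (\<lambda>s. u s x)"
        by (rule continuous_on_compose2[OF cu, of _ "\<lambda>s. (s, x)", simplified]) (auto intro!: continuous_intros)
      moreover have "((\<lambda>s. u s x) has_real_derivative f (u s x)) (at s)" if "s \<in> {0<..<t}" for s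
        using du that by simp
      ultimately have "apply_Cb (w t) x - u t x = (apply_Cb (w 0) x - u 0 x) *
          exp (integral {0..t} (\<lambda>s. divdiff f (u s x) (apply_Cb (w s) x)))"
        by (intro ode_difference[OF f t])
      then show "apply_Cb (w t) x = apply_Cb (to_Cb (u t)) x"
        using w ut[OF t] by (simp add: u0 bounded_solution_def)
    qed
  qed
  then show ?thesis using ut[OF t] by (simp add: u_def)
qed

end

section \<open>Composite functions and time-dependent Gaussian averages\<close>

definition compCb :: "(real \<Rightarrow> real) \<Rightarrow> Cb \<Rightarrow> Cb" where
  "compCb f v = to_Cb (\<lambda>x. f (apply_Cb v x))"

lemma cont_bdd_cong: "(\<And>s. s \<in> S \<Longrightarrow> u s = v s) \<Longrightarrow> cont_bdd S u = cont_bdd S v" for S :: "real set"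
  using contb_cong[of S u v True] by (simp add: contb_def)

lemma apply_to_Cb_regular:
  assumes "\<And>k. regular I True k u" "t \<in> I"
  shows "apply_Cb (to_Cb (u t)) = u t"
proof -
  obtain B where "\<And>x. \<bar>u t x\<bar> \<le> B" using cont_bdd_bound_at[OF regular_cont_bdd[OF assms(1)] assms(2)] by blast
  with regular_imp_smooth[OF assms] show ?thesis by (rule apply_to_Cb)
qed

lemma regular_Cb: "regular I False k (\<lambda>_. apply_Cb v)"
  by (rule regular_smooth[OF smooth_Cb])

lemma apply_compCb:
  assumes f: "smooth f"
  shows "apply_Cb (compCb f v) = (\<lambda>x. f (apply_Cb v x))"
proof -
  have r: "regular {0} False k (\<lambda>_ x. f (apply_Cb v x))" for k by (rule regular_smooth_comp[OF f regular_Cb])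
  have l: "cont_bdd {0::real} (\<lambda>_ x. f (apply_Cb v x))" by (rule cont_bdd_smooth_comp[OF f cont_bdd_Cb])
  obtain B where "\<forall>x. \<bar>f (apply_Cb v x)\<bar> \<le> B" using cont_bdd_bound_at[OF l] by auto
  then show ?thesis
    unfolding compCb_def using regular_imp_smooth[OF r, of 0] by (intro apply_to_Cb[of _ B]) auto
qed

lemma cont_bdd_heat: "cont_bdd S g \<Longrightarrow> continuous_on S \<alpha> \<Longrightarrow> cont_bdd S (\<lambda>s. heat (\<alpha> s) (g s))"
  unfolding heat_def by (intro cont_bdd_gauss_avg continuous_intros)

lemma regular_heat: "cont_bdd I g \<Longrightarrow> I \<subseteq> {0<..} \<Longrightarrow> regular I True k (\<lambda>t. heat t (g t))"
  using regular_gauss_avg[of I g "\<lambda>t. sqrt (2 * t)" k 1 0] by (auto simp: heat_def continuous_intros subset_iff)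

lemma heat_diff:
  assumes "cont_bdd I u" "cont_bdd I v" "t \<in> I"
  shows "heat a (\<lambda>x. u t x - v t x) x = heat a (u t) x - heat a (v t) x"
proof -
  obtain B where B: "\<And>x. \<bar>u t x\<bar> \<le> B" using cont_bdd_bound_at[OF assms(1,3)] by blast
  obtain B' where B': "\<And>x. \<bar>v t x\<bar> \<le> B'" using cont_bdd_bound_at[OF assms(2,3)] by blast
  show ?thesis unfolding heat_def
    by (rule gauss_avg_diff[OF cont_bdd_slice[OF assms(1,3)] B cont_bdd_slice[OF assms(2,3)] B'])
qed

lemma heat_deriv2_eq:
  assumes w: "cont_bdd I w" "s \<in> I" and t: "t > 0"
  shows "((\<lambda>t. heat t (w s) x) has_real_derivative deriv (deriv (heat t (w s))) x) (at t)"
proof -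
  obtain B where B: "\<And>x. \<bar>w s x\<bar> \<le> B" using cont_bdd_bound_at[OF w] by blast
  note h = cont_bdd_slice[OF w] B
  have "deriv (heat t (w s)) = (\<lambda>x. - gauss_avg (gauss_deriv 1) (sqrt (2 * t)) (w s) x / sqrt (2 * t))"
    using DERIV_imp_deriv[OF heat_DERIV_x[OF h t]] by blast
  then have "deriv (deriv (heat t (w s))) x = gauss_avg (gauss_deriv (gauss_deriv 1)) (sqrt (2 * t)) (w s) x / (2 * t)"
    using DERIV_imp_deriv[OF heat_DERIV_xx[OF h t]] by simp
  then show ?thesis using heat_DERIV_t[OF h t, of x] by simp
qed

lemma heat_deriv2_smooth:
  assumes u: "regular I True (Suc (Suc 0)) u" and t: "t \<in> I"
  shows "deriv (deriv (heat a (u t))) = heat a (deriv (deriv (u t)))"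
proof -
  have d: "(heat a (v t) has_real_derivative heat a (deriv (v t)) x) (at x)" if v: "regular I True (Suc k) v" for v k x
  proof -
    note l = regular_cont_bdd[OF v] and l' = regular_cont_bdd[OF regular_deriv[OF v]]
    obtain B where B: "\<And>x. \<bar>v t x\<bar> \<le> B" using cont_bdd_bound_at[OF l t] by blast
    obtain B' where B': "\<And>x. \<bar>deriv (v t) x\<bar> \<le> B'" using cont_bdd_bound_at[OF l' t] by blast
    show ?thesis unfolding heat_def
      by (rule gauss_avg_DERIV_x_smooth[OF cont_bdd_slice[OF l t] B cont_bdd_slice[OF l' t] B' regular_Suc_DERIV[OF v t]])
  qed
  have "deriv (heat a (u t)) = heat a (deriv (u t))" using DERIV_imp_deriv[OF d[OF u]] by blast
  then show ?thesis using DERIV_imp_deriv[OF d[OF regular_deriv[OF u]]] by auto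
qed

text \<open>
The averaged function and the time of the average vary together.  This gives \<open>\<partial>\<^sub>s(X\<^sup>sY\<^sup>su0)\<close>, and
the derivative of \<open>X\<^bsup>s-r\<^esup>f(X\<^sup>rw)\<close> in \<open>r\<close>.
\<close>

lemma heat_moving_DERIV:
  assumes g: "cont_bdd {a..b} g" and g': "cont_bdd {a..b} g'"
    and der: "\<And>s x. s \<in> {a..b} \<Longrightarrow> ((\<lambda>s. g s x) has_real_derivative g' s x) (at s within {a..b})"
    and r: "a < r" "r < b" and \<alpha>: "(\<alpha> has_real_derivative \<alpha>') (at r)" "\<alpha> r > 0"
  shows "((\<lambda>r. heat (\<alpha> r) (g r) x) has_real_derivative
    deriv (deriv (heat (\<alpha> r) (g r))) x * \<alpha>' + heat (\<alpha> r) (g' r) x) (at r)"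
proof -
  have rin: "r \<in> {a..b}" using r by simp
  have "((\<lambda>r. heat (\<alpha> r) (g r) x) has_real_derivative
    deriv (deriv (heat (\<alpha> r) (g r))) x * \<alpha>' + heat (\<alpha> r) (g' r) x * 1) (at r within {a..b})"
  proof (rule diagonal_DERIV[where I = "\<lambda>a b. heat a (g b) x" and Ib = "\<lambda>a b. heat a (g' b) x" and A = UNIV
        and B = "{a..b}" and \<beta> = "\<lambda>r. r"])
    show "((\<lambda>a. heat a (g r) x) has_real_derivative deriv (deriv (heat (\<alpha> r) (g r))) x) (at (\<alpha> r) within UNIV)"
      using heat_deriv2_eq[OF g rin \<alpha>(2)] by simp
    show "((\<lambda>b. heat c (g b) x) has_real_derivative heat c (g' s) x) (at s within {a..b})" if "s \<in> {a..b}" for c s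
      unfolding heat_def by (rule gauss_avg_DERIV_param[OF g g' der that])
    show "continuous_on (UNIV \<times> {a..b}) (\<lambda>(a, b). heat a (g' b) x)"
      unfolding heat_def split_beta' by (intro continuous_on_gauss_avg[OF g'] continuous_intros) auto
    show "(\<alpha> has_real_derivative \<alpha>') (at r within {a..b})" by (rule has_field_derivative_at_within[OF \<alpha>(1)])
  qed (use rin in auto)
  then show ?thesis using r by (simp add: at_within_Icc_at)
qed

text \<open>
The identity for the inner integral may fail at \<open>s = 0\<close>, where the source is unspecified; the inner
integral then runs over a single point.
\<close>

lemma iterated_integral:
  fixes g :: "real \<Rightarrow> real" and G :: "real \<Rightarrow> real \<Rightarrow> real"
  assumes "(g has_integral I) {0..t}" "\<And>s. s \<in> {0<..t} \<Longrightarrow> (G s has_integral g s) {0..s}"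
  shows "(\<forall>s\<in>{0..t}. G s integrable_on {0..s}) \<and> ((\<lambda>s. integral {0..s} (G s)) has_integral I) {0..t}"
proof
  show "\<forall>s\<in>{0..t}. G s integrable_on {0..s}"
  proof
    fix s assume "s \<in> {0..t}"
    then show "G s integrable_on {0..s}"
      using assms(2)[of s] integrable_on_refl[of "G 0" 0] by (cases "s = 0") auto
  qed
  show "((\<lambda>s. integral {0..s} (G s)) has_integral I) {0..t}"
    by (rule has_integral_spike_finite[OF _ _ assms(1), of "{0}"])
       (use assms(2) in \<open>auto intro!: integral_unique\<close>)
qed

context
  fixes f :: "real \<Rightarrow> real" and y :: "real \<Rightarrow> real \<Rightarrow> real" and u0 :: Cb
  assumes f: "smooth f" "f 0 = 0" and diss: "\<And>r. \<bar>r\<bar> \<ge> 1 \<Longrightarrow> r * f r \<le> 0"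
    and y: "is_ode_flow f y"
begin

lemma Y_apply: "t \<ge> 0 \<Longrightarrow> apply_Cb (Yflow f t v) = (\<lambda>x. y t (apply_Cb v x))"
  using Yflow_y[OF f(1) y] by blast

lemma cont_bdd_y_comp: "cont_bdd I h \<Longrightarrow> I \<subseteq> {0..} \<Longrightarrow> cont_bdd I (\<lambda>t x. y t (h t x))"
  using contb_comp[OF contb_subset[OF y_contb[OF f(1) y]], of I True h] by (simp add: contb_def)

lemma Y_cont_bdd: "cont_bdd {0..} (\<lambda>t. apply_Cb (Yflow f t v))"
proof -
  have "cont_bdd {0..} (\<lambda>t x. y t (apply_Cb v x))" by (rule cont_bdd_y_comp[OF cont_bdd_Cb]) simp
  moreover have "cont_bdd {0..} (\<lambda>t. apply_Cb (Yflow f t v)) = cont_bdd {0..} (\<lambda>t x. y t (apply_Cb v x))"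
    by (rule cont_bdd_cong) (simp add: Y_apply)
  ultimately show ?thesis by simp
qed

lemma Y_0: "Yflow f 0 v = v"
  by (rule apply_Cb_eqI) (simp add: Y_apply y_0[OF f(1) y])

lemma X_0: "Xflow 0 v = v"
  by (rule apply_Cb_eqI) (simp add: Xflow_heat)

lemma Y_DERIV: "t > 0 \<Longrightarrow> ((\<lambda>t. apply_Cb (Yflow f t v) x) has_real_derivative f (apply_Cb (Yflow f t v) x)) (at t)"
proof -
  assume t: "t > 0"
  have "((\<lambda>t. y t (apply_Cb v x)) has_real_derivative f (y t (apply_Cb v x))) (at t)"
    by (rule y_DERIV_at[OF f(1) y t])
  then have "((\<lambda>t. apply_Cb (Yflow f t v) x) has_real_derivative f (y t (apply_Cb v x))) (at t)"
    by (rule has_field_derivative_transform_within_open[of _ _ _ "{0<..}"]) (use t Y_apply in auto)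
  then show ?thesis using t by (simp add: Y_apply)
qed

section \<open>The defect of the splitting XY\<close>

definition "defect_XY s = Xflow s (compCb f (Yflow f s u0)) - compCb f (Xflow s (Yflow f s u0))"

lemma defect_XY_apply: "s \<ge> 0 \<Longrightarrow> apply_Cb (defect_XY s) =
   (\<lambda>x. heat s (\<lambda>x. f (apply_Cb (Yflow f s u0) x)) x - f (heat s (apply_Cb (Yflow f s u0)) x))"
  by (simp add: defect_XY_def minus_Cb.rep_eq Xflow_heat apply_compCb[OF f(1)])

lemma defect_XY_regular: "regular {0<..} True k (\<lambda>s. apply_Cb (defect_XY s))"
proof -
  have l: "cont_bdd {0<..} (\<lambda>t. apply_Cb (Yflow f t u0))" by (rule cont_bdd_subset[OF Y_cont_bdd]) auto
  have "regular {0<..} True k (\<lambda>s x. heat s (\<lambda>x. f (apply_Cb (Yflow f s u0) x)) x - f (heat s (apply_Cb (Yflow f s u0)) x))"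
    by (rule regular_diff[OF regular_heat[OF cont_bdd_smooth_comp[OF f(1) l] order_refl]
          regular_smooth_comp[OF f(1) regular_heat[OF l order_refl]]])
  then show ?thesis by (rule regular_scaled_eq) (simp add: defect_XY_apply)
qed

lemma XY_DERIV:
  assumes s: "s > 0"
  shows "((\<lambda>s. apply_Cb (Xflow s (Yflow f s u0)) x) has_real_derivative
    deriv (deriv (apply_Cb (Xflow s (Yflow f s u0)))) x
      + (f (apply_Cb (Xflow s (Yflow f s u0)) x) + apply_Cb (defect_XY s) x)) (at s)"
proof -
  let ?w = "\<lambda>s. apply_Cb (Yflow f s u0)"
  have l: "cont_bdd {s/2..s + 1} ?w" by (rule cont_bdd_subset[OF Y_cont_bdd]) (use s in auto)
  have "((\<lambda>s. heat s (?w s) x) has_real_derivative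
      deriv (deriv (heat s (?w s))) x * 1 + heat s (\<lambda>x. f (?w s x)) x) (at s)"
  proof (rule heat_moving_DERIV[OF l cont_bdd_smooth_comp[OF f(1) l]])
    show "((\<lambda>s. ?w s x) has_real_derivative f (?w r x)) (at r within {s/2..s + 1})" if "r \<in> {s/2..s + 1}" for r x
      using that s by (intro has_field_derivative_at_within[OF Y_DERIV]) auto
  qed (use s in auto)
  then have "((\<lambda>s. apply_Cb (Xflow s (Yflow f s u0)) x) has_real_derivative
      deriv (deriv (heat s (?w s))) x * 1 + heat s (\<lambda>x. f (?w s x)) x) (at s)"
    by (rule has_field_derivative_transform_within_open[of _ _ _ "{0<..}"]) (use s Xflow_heat in auto)
  then show ?thesis using s by (simp add: defect_XY_apply Xflow_heat)
qed

lemma XY_defect_integral: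
  assumes t: "t \<ge> 0"
  shows "((\<lambda>s. apply_Cb (DTflow f (t - s) (Xflow s (Yflow f s u0)) (defect_XY s)) x) has_integral
    (apply_Cb (Xflow t (Yflow f t u0)) x - apply_Cb (Tflow f t u0) x)) {0..t}"
proof -
  have "cont_bdd {0..} (\<lambda>s. heat s (apply_Cb (Yflow f s u0)))"
    by (intro cont_bdd_heat Y_cont_bdd continuous_intros)
  then have V: "cont_bdd {0..} (\<lambda>s. apply_Cb (Xflow s (Yflow f s u0)))"
    by (subst cont_bdd_cong[where v = "\<lambda>s. heat s (apply_Cb (Yflow f s u0))"]) (auto simp: Xflow_heat)
  have R2: "\<exists>C. \<forall>x. \<bar>deriv (deriv (apply_Cb (defect_XY s))) x\<bar> \<le> C" if "s > 0" for s
    using cont_bdd_bound_at[OF regular_cont_bdd[OF regular_deriv[OF regular_deriv[OF defect_XY_regular]]], of s] that by simp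
  from alekseev_groebner[OF f diss V regular_cont_bdd[OF defect_XY_regular] R2 XY_DERIV t]
  show ?thesis by (simp add: X_0 Y_0)
qed

text \<open>
With \<open>k r = X\<^sup>rw\<close> and \<open>w = Y\<^sup>su0\<close>, the functions \<open>\<Sigma> r = X\<^bsup>s-r\<^esup>f(k r)\<close> satisfy
\<open>\<Sigma>' = X\<^bsup>s-r\<^esup>(f'(k) k\<^sub>x\<^sub>x - \<partial>\<^sub>x\<^sup>2f(k)) = - X\<^bsup>s-r\<^esup>(f''(k) k\<^sub>x\<^sup>2)\<close>.  The source may be of order \<open>1 / r\<close> near \<open>r = 0\<close>;
the fundamental theorem of calculus needs only that the primitive is continuous there.
\<close>

lemma XY_inner_integral:
  assumes s: "s > 0" and \<tau>: "\<tau> \<ge> 0"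
  shows "((\<lambda>r. apply_Cb (DTflow f \<tau> v (Xflow (s - r) (splitting_source_XY f u0 s r))) x) has_integral
    apply_Cb (DTflow f \<tau> v (defect_XY s)) x) {0..s}"
proof -
  interpret DT: bounded_linear "DTflow f \<tau> v" by (rule DTflow_bounded_linear[OF f diss \<tau>])
  define w where "w = apply_Cb (Yflow f s u0)"
  have lw: "cont_bdd I (\<lambda>_. w)" for I :: "real set" unfolding w_def by (rule cont_bdd_Cb)
  define k where "k r = heat r w" for r
  have kl: "cont_bdd {0..} k" unfolding k_def by (intro cont_bdd_heat lw continuous_intros)
  have kr: "regular {0<..} True n k" for n unfolding k_def by (rule regular_heat[OF lw order_refl])
  have kx: "regular {0<..} True n (\<lambda>r. deriv (k r))" for n by (rule regular_deriv[OF kr])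
  have kxx: "regular {0<..} True n (\<lambda>r. deriv (deriv (k r)))" for n by (rule regular_deriv[OF kx])
  define src where "src r x = deriv (deriv f) (k r x) * (deriv (k r) x)\<^sup>2" for r x
  have src: "regular {0<..} True n src" for n
    unfolding src_def power2_eq_square
    by (rule regular_mult[OF regular_smooth_comp[OF smooth_deriv[OF smooth_deriv[OF f(1)]] kr] regular_mult[OF kx kx]])
  define \<Sigma> where "\<Sigma> r = Xflow (s - r) (compCb f (Xflow r (Yflow f s u0)))" for r
  define \<Sigma>' where "\<Sigma>' r = - Xflow (s - r) (splitting_source_XY f u0 s r)" for r
  have \<Sigma>: "apply_Cb (\<Sigma> r) = heat (s - r) (\<lambda>x. f (k r x))" if "r \<in> {0..s}" for r
    using that by (simp add: \<Sigma>_def Xflow_heat apply_compCb[OF f(1)] k_def w_def)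
  have srcCb: "apply_Cb (splitting_source_XY f u0 s r) = src r" if "r > 0" for r
  proof -
    have "splitting_source_XY f u0 s r = to_Cb (src r)"
      using that unfolding splitting_source_XY_def src_def k_def w_def by (simp add: Xflow_heat)
    then show ?thesis using apply_to_Cb_regular[OF src, of r] that by simp
  qed
  have \<Sigma>': "apply_Cb (\<Sigma>' r) = (\<lambda>x. - heat (s - r) (src r) x)" if "0 < r" "r \<le> s" for r
    using that by (simp add: \<Sigma>'_def uminus_Cb.rep_eq Xflow_heat srcCb)
  have fk: "regular {0<..} True n (\<lambda>r x. f (k r x))" for n by (rule regular_smooth_comp[OF f(1) kr])
  \<comment> \<open>the time derivative of \<open>f(k r)\<close>\<close>
  define g' where "g' r x = deriv f (k r x) * deriv (deriv (k r)) x" for r x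
  have g': "regular {0<..} True n g'" for n
    unfolding g'_def by (rule regular_mult[OF regular_smooth_comp[OF smooth_deriv[OF f(1)] kr] kxx])
  have fkxx: "deriv (deriv (\<lambda>x. f (k r x))) = (\<lambda>x. src r x + g' r x)" if r: "r > 0" for r
  proof -
    have r': "r \<in> {0<..}" using r by simp
    have "((\<lambda>x. f (k r x)) has_real_derivative deriv f (k r x) * deriv (k r) x) (at x)" for x
      by (rule DERIV_chain2[OF smooth_DERIV[OF f(1)] regular_Suc_DERIV[OF kr r']])
    then have "deriv (\<lambda>x. f (k r x)) = (\<lambda>x. deriv f (k r x) * deriv (k r) x)" using DERIV_imp_deriv by blast
    moreover have "((\<lambda>x. deriv f (k r x) * deriv (k r) x) has_real_derivative src r x + g' r x) (at x)" for x
      by (rule DERIV_cong[OF DERIV_mult[OF DERIV_chain2[OF smooth_DERIV[OF smooth_deriv[OF f(1)]] regular_Suc_DERIV[OF kr r']]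
              regular_Suc_DERIV[OF kx r']]])
         (simp add: src_def g'_def power2_eq_square algebra_simps)
    ultimately show ?thesis using DERIV_imp_deriv by (metis ext)
  qed
  have der: "((\<lambda>r. apply_Cb (\<Sigma> r) x) has_real_derivative apply_Cb (\<Sigma>' r) x) (at r)" if r: "0 < r" "r < s" for r x
  proof -
    have r': "r \<in> {0<..}" using r by simp
    have sub: "{r/2..s} \<subseteq> {0<..}" using r by auto
    have "((\<lambda>r. heat (s - r) (\<lambda>x. f (k r x)) x) has_real_derivative
        deriv (deriv (heat (s - r) (\<lambda>x. f (k r x)))) x * (- 1) + heat (s - r) (g' r) x) (at r)"
    proof (rule heat_moving_DERIV[where a = "r/2" and b = s])
      show "cont_bdd {r/2..s} (\<lambda>r x. f (k r x))" "cont_bdd {r/2..s} g'"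
        by (rule cont_bdd_subset[OF regular_cont_bdd[OF fk] sub], rule cont_bdd_subset[OF regular_cont_bdd[OF g'] sub])
      show "((\<lambda>r. f (k r x)) has_real_derivative g' \<rho> x) (at \<rho> within {r/2..s})" if "\<rho> \<in> {r/2..s}" for \<rho> x
      proof -
        have "\<rho> > 0" using that r by auto
        from heat_deriv2_eq[OF lw[of UNIV] UNIV_I this]
        have "((\<lambda>r. k r x) has_real_derivative deriv (deriv (k \<rho>)) x) (at \<rho> within {r/2..s})"
          unfolding k_def by (rule has_field_derivative_at_within)
        from DERIV_chain2[OF smooth_DERIV[OF f(1)] this] show ?thesis by (simp add: g'_def)
      qed
      show "((\<lambda>r. s - r) has_real_derivative - 1) (at r)" by (auto intro!: derivative_eq_intros)
    qed (use r in auto)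
    moreover have "deriv (deriv (heat (s - r) (\<lambda>x. f (k r x)))) x = heat (s - r) (\<lambda>x. src r x + g' r x) x"
      using heat_deriv2_smooth[OF fk r', of "s - r"] by (simp add: fkxx[OF r(1)])
    moreover have "heat (s - r) (\<lambda>x. (src r x + g' r x) - g' r x) x
        = heat (s - r) (\<lambda>x. src r x + g' r x) x - heat (s - r) (g' r) x"
      by (rule heat_diff[OF regular_cont_bdd[OF regular_add[OF src g']] regular_cont_bdd[OF g'] r'])
    ultimately have "((\<lambda>r. heat (s - r) (\<lambda>x. f (k r x)) x) has_real_derivative apply_Cb (\<Sigma>' r) x) (at r)"
      using r by (simp add: \<Sigma>')
    then show ?thesis
      by (rule has_field_derivative_transform_within_open[of _ _ _ "{0<..<s}"]) (use r \<Sigma> in auto)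
  qed
  have "((\<lambda>r. apply_Cb (DTflow f \<tau> v (\<Sigma>' r)) x) has_integral
     (apply_Cb (DTflow f \<tau> v (\<Sigma> s)) x - apply_Cb (DTflow f \<tau> v (\<Sigma> 0)) x)) {0..s}"
  proof (rule fundamental_theorem_of_calculus_interior)
    have "cont_bdd {0..s} (\<lambda>r. heat (s - r) (\<lambda>x. f (k r x)))"
      by (intro cont_bdd_heat cont_bdd_smooth_comp[OF f(1)] continuous_intros cont_bdd_subset[OF kl]) auto
    then have l: "cont_bdd {0..s} (\<lambda>r. apply_Cb (\<Sigma> r))"
      by (subst cont_bdd_cong[where v = "\<lambda>r. heat (s - r) (\<lambda>x. f (k r x))"]) (auto simp: \<Sigma>)
    show "continuous_on {0..s} (\<lambda>r. apply_Cb (DTflow f \<tau> v (\<Sigma> r)) x)"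
      by (rule DTflow_continuous[OF f diss \<tau> compact_Icc l])
    fix r assume "r \<in> {0<..<s}"
    then have r: "0 < r" "r < s" by auto
    define a b where "a = r / 2" and "b = (r + s) / 2"
    have ab: "0 < a" "a < r" "r < b" "b < s" using r by (auto simp: a_def b_def)
    have "cont_bdd {a..b} (\<lambda>r x. (- 1) * heat (s - r) (src r) x)"
      by (intro cont_bdd_cmult cont_bdd_heat continuous_intros cont_bdd_subset[OF regular_cont_bdd[OF src]]) (use ab in auto)
    then have l: "cont_bdd {a..b} (\<lambda>r. apply_Cb (\<Sigma>' r))"
      by (subst cont_bdd_cong[where v = "\<lambda>r x. (- 1) * heat (s - r) (src r) x"]) (use ab in \<open>auto simp: \<Sigma>'\<close>)
    have "((\<lambda>r. apply_Cb (DTflow f \<tau> v (\<Sigma> r)) x) has_real_derivative apply_Cb (DTflow f \<tau> v (\<Sigma>' r)) x) (at r within {a..b})"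
      by (rule DTflow_DERIV[OF f diss \<tau> l]) (use ab in \<open>auto intro!: has_field_derivative_at_within[OF der]\<close>)
    then show "((\<lambda>r. apply_Cb (DTflow f \<tau> v (\<Sigma> r)) x) has_vector_derivative apply_Cb (DTflow f \<tau> v (\<Sigma>' r)) x) (at r)"
      using ab by (simp add: at_within_Icc_at has_real_derivative_iff_has_vector_derivative)
  qed (use s in auto)
  moreover have "\<Sigma> s = compCb f (Xflow s (Yflow f s u0))" "\<Sigma> 0 = Xflow s (compCb f (Yflow f s u0))"
    by (simp_all add: \<Sigma>_def X_0)
  ultimately have "((\<lambda>r. - apply_Cb (DTflow f \<tau> v (Xflow (s - r) (splitting_source_XY f u0 s r))) x) has_integral
     - apply_Cb (DTflow f \<tau> v (defect_XY s)) x) {0..s}"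
    by (simp add: \<Sigma>'_def defect_XY_def DT.neg DT.diff uminus_Cb.rep_eq minus_Cb.rep_eq)
  then show ?thesis by (simp add: has_integral_neg_iff)
qed

section \<open>The defect of the splitting YX\<close>

definition y_space_deriv :: "real \<Rightarrow> real \<Rightarrow> real" where
  "y_space_deriv t a = exp (integral {0..t} (\<lambda>s. deriv f (y s a)))"

text \<open>
The derivative of \<open>ln (y_space_deriv t a)\<close> with respect to \<open>a\<close>; hence \<open>\<partial>\<^sub>a\<^sup>2y = y_space_deriv * y_log_deriv\<close>.
\<close>

definition y_log_deriv :: "real \<Rightarrow> real \<Rightarrow> real" where
  "y_log_deriv t a = integral {0..t} (\<lambda>s. deriv (deriv f) (y s a) * y_space_deriv s a)"

lemma y_DERIV_space: "t \<ge> 0 \<Longrightarrow> (y t has_real_derivative y_space_deriv t a) (at a)"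
  unfolding y_space_deriv_def by (rule y_DERIV_a[OF f(1) y])

lemma regular_fy: "smooth g \<Longrightarrow> regular {0..} False k (\<lambda>t a. g (y t a))"
  by (rule regular_smooth_comp[OF _ y_regular[OF f(1) y]])

lemma regular_y_space_deriv: "regular {0..} False k y_space_deriv"
  unfolding y_space_deriv_def[abs_def]
  by (rule regular_smooth_comp[OF smooth_exp regular_time_integral[OF regular_fy[OF smooth_deriv[OF f(1)]]]])

lemma regular_y_log_deriv: "regular {0..} False k y_log_deriv"
  unfolding y_log_deriv_def[abs_def]
  by (rule regular_time_integral[OF regular_mult[OF regular_fy[OF smooth_deriv[OF smooth_deriv[OF f(1)]]] regular_y_space_deriv]])

lemma y_space_deriv_DERIV:
  assumes t: "t \<ge> 0"
  shows "(y_space_deriv t has_real_derivative y_space_deriv t a * y_log_deriv t a) (at a)"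
proof -
  have "((\<lambda>a. integral {0..t} (\<lambda>s. deriv f (y s a))) has_real_derivative
      integral {0..t} (\<lambda>s. deriv (\<lambda>a. deriv f (y s a)) a)) (at a)"
    by (rule time_integral_DERIV[OF regular_fy[OF smooth_deriv[OF f(1)]] t])
  moreover have "integral {0..t} (\<lambda>s. deriv (\<lambda>a. deriv f (y s a)) a) = y_log_deriv t a"
    unfolding y_log_deriv_def
  proof (rule integral_cong)
    fix s assume "s \<in> {0..t}"
    then have s: "s \<ge> 0" by simp
    show "deriv (\<lambda>a. deriv f (y s a)) a = deriv (deriv f) (y s a) * y_space_deriv s a"
      by (rule DERIV_imp_deriv[OF DERIV_chain2[OF smooth_DERIV[OF smooth_deriv[OF f(1)]] y_DERIV_space[OF s]]])
  qed
  ultimately show ?thesis unfolding y_space_deriv_def by (auto intro!: derivative_eq_intros)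
qed

lemma y_log_deriv_DERIV_t:
  assumes r: "r \<in> {0..s}"
  shows "((\<lambda>r. y_log_deriv r a) has_real_derivative deriv (deriv f) (y r a) * y_space_deriv r a) (at r within {0..s})"
  unfolding y_log_deriv_def
proof (rule integral_has_real_derivative[OF _ r])
  have "contb {0..} False (\<lambda>s a. deriv (deriv f) (y s a) * y_space_deriv s a)"
    by (rule regular_contb[OF regular_mult[OF regular_fy[OF smooth_deriv[OF smooth_deriv[OF f(1)]]] regular_y_space_deriv]])
  from contb_compose[OF this, of "{0..s}" "\<lambda>s. s" "\<lambda>_. a"]
  show "continuous_on {0..s} (\<lambda>s. deriv (deriv f) (y s a) * y_space_deriv s a)"
    by (auto intro!: continuous_intros)
qed

definition heat_u0 :: "real \<Rightarrow> real \<Rightarrow> real" where "heat_u0 s = heat s (apply_Cb u0)"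

lemma heat_u0_X: "s \<ge> 0 \<Longrightarrow> apply_Cb (Xflow s u0) = heat_u0 s"
  by (simp add: heat_u0_def Xflow_heat)

lemma heat_u0_cont_bdd: "cont_bdd {0..} heat_u0"
  unfolding heat_u0_def[abs_def] by (intro cont_bdd_heat cont_bdd_Cb continuous_intros)

lemma heat_u0_regular: "regular {0<..} True k heat_u0"
  unfolding heat_u0_def[abs_def] by (rule regular_heat[OF cont_bdd_Cb order_refl])

lemma heat_u0_regular_const: "s > 0 \<Longrightarrow> regular I True k (\<lambda>_. heat_u0 s)"
  using regular_gauss_avg[OF cont_bdd_Cb[of I u0], of "\<lambda>_. sqrt (2 * s)" k 1 0] by (simp add: heat_u0_def heat_def)

lemma heat_u0_DERIV:
  assumes "s > 0"
  shows "(heat_u0 s has_real_derivative deriv (heat_u0 s) x) (at x)"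
    "(deriv (heat_u0 s) has_real_derivative deriv (deriv (heat_u0 s)) x) (at x)"
    "((\<lambda>s. heat_u0 s x) has_real_derivative deriv (deriv (heat_u0 s)) x) (at s)"
proof -
  have s: "s \<in> {0<..}" using assms by simp
  show "(heat_u0 s has_real_derivative deriv (heat_u0 s) x) (at x)" by (rule regular_Suc_DERIV[OF heat_u0_regular s])
  show "(deriv (heat_u0 s) has_real_derivative deriv (deriv (heat_u0 s)) x) (at x)"
    by (rule regular_Suc_DERIV[OF regular_deriv[OF heat_u0_regular] s])
  show "((\<lambda>s. heat_u0 s x) has_real_derivative deriv (deriv (heat_u0 s)) x) (at s)"
    unfolding heat_u0_def by (rule heat_deriv2_eq[OF cont_bdd_Cb UNIV_I assms])
qed

text \<open>
\<open>\<partial>\<^sub>a\<^sup>2y(s, h) (\<partial>\<^sub>xh)\<^sup>2\<close> for \<open>h = X\<^sup>su0\<close>: the term of \<open>\<partial>\<^sub>x\<^sup>2(y(s, h))\<close> that is missing in \<open>\<partial>\<^sub>s(y(s, h))\<close>.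
\<close>

definition YX_rate :: "real \<Rightarrow> real \<Rightarrow> real" where
  "YX_rate s x = y_space_deriv s (heat_u0 s x) * y_log_deriv s (heat_u0 s x) * (deriv (heat_u0 s) x)\<^sup>2"

lemma YX_rate_regular: "regular {0<..} True k YX_rate"
proof -
  have p: "{0<..} \<subseteq> {0::real..}" by auto
  show ?thesis
    unfolding YX_rate_def[abs_def] power2_eq_square
    by (rule regular_mult[OF regular_mult[OF regular_comp[OF regular_subset[OF regular_y_space_deriv p] heat_u0_regular] regular_comp[OF regular_subset[OF regular_y_log_deriv p] heat_u0_regular]]
          regular_mult[OF regular_deriv[OF heat_u0_regular] regular_deriv[OF heat_u0_regular]]])
qed

definition "defect_YX s = - to_Cb (YX_rate s)"

lemma defect_YX_apply: "s > 0 \<Longrightarrow> apply_Cb (defect_YX s) = (\<lambda>x. - YX_rate s x)"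
  using apply_to_Cb_regular[OF YX_rate_regular, of s] by (simp add: defect_YX_def uminus_Cb.rep_eq)

lemma defect_YX_regular: "regular {0<..} True k (\<lambda>s. apply_Cb (defect_YX s))"
  by (rule regular_scaled_eq[OF regular_minus[OF YX_rate_regular]]) (simp add: defect_YX_apply)

lemma V_YX: "s \<ge> 0 \<Longrightarrow> apply_Cb (Yflow f s (Xflow s u0)) = (\<lambda>x. y s (heat_u0 s x))"
  by (simp add: Y_apply heat_u0_X)

lemma YX_DERIV:
  assumes s: "s > 0"
  shows "((\<lambda>s. apply_Cb (Yflow f s (Xflow s u0)) x) has_real_derivative
    deriv (deriv (apply_Cb (Yflow f s (Xflow s u0)))) x
      + (f (apply_Cb (Yflow f s (Xflow s u0)) x) + apply_Cb (defect_YX s) x)) (at s)"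
proof -
  have s0: "s \<ge> 0" using s by simp
  have "((\<lambda>x. y s (heat_u0 s x)) has_real_derivative y_space_deriv s (heat_u0 s x) * deriv (heat_u0 s) x) (at x)" for x
    by (rule DERIV_chain2[OF y_DERIV_space[OF s0] heat_u0_DERIV(1)[OF s]])
  then have "deriv (\<lambda>x. y s (heat_u0 s x)) = (\<lambda>x. y_space_deriv s (heat_u0 s x) * deriv (heat_u0 s) x)" using DERIV_imp_deriv by blast
  moreover have "((\<lambda>x. y_space_deriv s (heat_u0 s x) * deriv (heat_u0 s) x) has_real_derivative
      YX_rate s x + y_space_deriv s (heat_u0 s x) * deriv (deriv (heat_u0 s)) x) (at x)"
    by (rule DERIV_cong[OF DERIV_mult[OF DERIV_chain2[OF y_space_deriv_DERIV[OF s0] heat_u0_DERIV(1)[OF s]] heat_u0_DERIV(2)[OF s]]])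
       (simp add: YX_rate_def power2_eq_square algebra_simps)
  ultimately have xx: "deriv (deriv (\<lambda>x. y s (heat_u0 s x))) x = YX_rate s x + y_space_deriv s (heat_u0 s x) * deriv (deriv (heat_u0 s)) x"
    using DERIV_imp_deriv by simp
  have "((\<lambda>r. y r (heat_u0 r x)) has_real_derivative f (y s (heat_u0 s x)) * 1 + y_space_deriv s (heat_u0 s x) * deriv (deriv (heat_u0 s)) x)
      (at s within {s/2..s + 1})"
  proof (rule diagonal_DERIV[where I = y and Ib = y_space_deriv and A = "{0..}" and B = UNIV and \<alpha> = "\<lambda>r. r"])
    show "((\<lambda>a. y a (heat_u0 s x)) has_real_derivative f (y s (heat_u0 s x))) (at s within {0..})"
      by (rule y_DERIV[OF f(1) y s0])
    show "(y a has_real_derivative y_space_deriv a b) (at b within UNIV)" if "a \<in> {0..}" for a b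
      using y_DERIV_space[of a b] that by simp
    show "continuous_on ({0..} \<times> UNIV) (\<lambda>(a, b). y_space_deriv a b)" by (rule contb_continuous[OF regular_contb[OF regular_y_space_deriv]])
    show "((\<lambda>r. heat_u0 r x) has_real_derivative deriv (deriv (heat_u0 s)) x) (at s within {s/2..s + 1})"
      by (rule has_field_derivative_at_within[OF heat_u0_DERIV(3)[OF s]])
  qed (use s in auto)
  then have "((\<lambda>r. y r (heat_u0 r x)) has_real_derivative f (y s (heat_u0 s x)) * 1 + y_space_deriv s (heat_u0 s x) * deriv (deriv (heat_u0 s)) x) (at s)"
    using s by (simp add: at_within_Icc_at)
  then have "((\<lambda>s. apply_Cb (Yflow f s (Xflow s u0)) x) has_real_derivative
      f (y s (heat_u0 s x)) * 1 + y_space_deriv s (heat_u0 s x) * deriv (deriv (heat_u0 s)) x) (at s)"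
    by (rule has_field_derivative_transform_within_open[of _ _ _ "{0<..}"]) (use s V_YX in auto)
  then show ?thesis using s by (simp add: V_YX defect_YX_apply xx add.commute)
qed

lemma YX_defect_integral:
  assumes t: "t \<ge> 0"
  shows "((\<lambda>s. apply_Cb (DTflow f (t - s) (Yflow f s (Xflow s u0)) (defect_YX s)) x) has_integral
    (apply_Cb (Yflow f t (Xflow t u0)) x - apply_Cb (Tflow f t u0) x)) {0..t}"
proof -
  have "cont_bdd {0..} (\<lambda>s x. y s (heat_u0 s x))" by (rule cont_bdd_y_comp[OF heat_u0_cont_bdd order_refl])
  then have V: "cont_bdd {0..} (\<lambda>s. apply_Cb (Yflow f s (Xflow s u0)))"
    by (subst cont_bdd_cong[where v = "\<lambda>s x. y s (heat_u0 s x)"]) (auto simp: V_YX)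
  have R2: "\<exists>C. \<forall>x. \<bar>deriv (deriv (apply_Cb (defect_YX s))) x\<bar> \<le> C" if "s > 0" for s
    using cont_bdd_bound_at[OF regular_cont_bdd[OF regular_deriv[OF regular_deriv[OF defect_YX_regular]]], of s] that by simp
  from alekseev_groebner[OF f diss V regular_cont_bdd[OF defect_YX_regular] R2 YX_DERIV t]
  show ?thesis by (simp add: X_0 Y_0)
qed

text \<open>
A shift turns the first exponent into the integral over \<open>{r..s}\<close>; together with one of the two
integrals over \<open>{0..r}\<close> it makes up the derivative \<open>y_space_deriv\<close> at time \<open>s\<close>.
\<close>

lemma source_YX:
  assumes s: "s > 0" and r: "r \<in> {0..s}"
  shows "splitting_source_YX f u0 s r =
    to_Cb (\<lambda>x. y_space_deriv s (heat_u0 s x) * (deriv (deriv f) (y r (heat_u0 s x)) * y_space_deriv r (heat_u0 s x)) * (deriv (heat_u0 s) x)\<^sup>2)"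
proof -
  have "exp (integral {0..s - r} (\<lambda>\<sigma>. deriv f (apply_Cb (Yflow f (\<sigma> + r) (Xflow s u0)) x))) *
     deriv (deriv f) (apply_Cb (Yflow f r (Xflow s u0)) x) *
     exp (2 * integral {0..r} (\<lambda>\<sigma>. deriv f (apply_Cb (Yflow f \<sigma> (Xflow s u0)) x))) *
     (deriv (apply_Cb (Xflow s u0)) x)\<^sup>2
    = y_space_deriv s (heat_u0 s x) * (deriv (deriv f) (y r (heat_u0 s x)) * y_space_deriv r (heat_u0 s x)) * (deriv (heat_u0 s) x)\<^sup>2" for x
  proof -
    define p where "p \<sigma> = deriv f (y \<sigma> (heat_u0 s x))" for \<sigma>
    have cp: "continuous_on {0..s} p" unfolding p_def
      using contb_compose[OF regular_contb[OF regular_fy[OF smooth_deriv[OF f(1)]]], of "{0..s}" "\<lambda>s. s" "\<lambda>_. heat_u0 s x"]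
      by (auto intro!: continuous_intros)
    have "integral {0..s - r} (\<lambda>\<sigma>. deriv f (apply_Cb (Yflow f (\<sigma> + r) (Xflow s u0)) x)) = integral {0..s - r} (p \<circ> (\<lambda>x. x + r))"
      by (rule integral_cong) (use s r in \<open>simp add: p_def Y_apply heat_u0_X\<close>)
    also have "\<dots> = integral {0 + r..s - r + r} p"
      by (rule integral_shift) (use r in \<open>auto intro: continuous_on_subset[OF cp]\<close>)
    finally have i1: "integral {0..s - r} (\<lambda>\<sigma>. deriv f (apply_Cb (Yflow f (\<sigma> + r) (Xflow s u0)) x)) = integral {r..s} p" by simp
    have i2: "integral {0..r} (\<lambda>\<sigma>. deriv f (apply_Cb (Yflow f \<sigma> (Xflow s u0)) x)) = integral {0..r} p"
      by (rule integral_cong) (use s in \<open>simp add: p_def Y_apply heat_u0_X\<close>)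
    have i3: "integral {0..r} p + integral {r..s} p = integral {0..s} p"
      using r by (intro Henstock_Kurzweil_Integration.integral_combine integrable_continuous_real cp) auto
    have "exp (integral {r..s} p) * exp (2 * integral {0..r} p) = exp (integral {0..s} p) * exp (integral {0..r} p)"
      by (simp add: i3[symmetric] flip: exp_add)
    moreover have "y_space_deriv s (heat_u0 s x) = exp (integral {0..s} p)" "y_space_deriv r (heat_u0 s x) = exp (integral {0..r} p)"
      by (simp_all add: y_space_deriv_def p_def[abs_def])
    ultimately have "exp (integral {r..s} p) * D * exp (2 * integral {0..r} p) * H = y_space_deriv s (heat_u0 s x) * (D * y_space_deriv r (heat_u0 s x)) * H" for D H
      by (simp add: mult_ac)
    then show ?thesis using s r by (simp add: i1 i2 Y_apply heat_u0_X)
  qed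
  then show ?thesis unfolding splitting_source_YX_def by simp
qed

text \<open>
Only the factor \<open>y_log_deriv\<close> of the second space derivative of the flow is an integral in time; stopping this
integral at \<open>r\<close> gives the primitive \<open>q r\<close>.
\<close>

lemma YX_inner_integral:
  assumes s: "s > 0" and \<tau>: "\<tau> \<ge> 0"
  shows "((\<lambda>r. apply_Cb (DTflow f \<tau> v (splitting_source_YX f u0 s r)) x) has_integral
    - apply_Cb (DTflow f \<tau> v (defect_YX s)) x) {0..s}"
proof -
  interpret DT: bounded_linear "DTflow f \<tau> v" by (rule DTflow_bounded_linear[OF f diss \<tau>])
  have sub: "{0..s} \<subseteq> {0..}" by auto
  have s0: "s \<in> {0..}" using s by simp
  have yas: "smooth (y_space_deriv s)" by (rule regular_imp_smooth[OF regular_y_space_deriv s0])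
  note hc = heat_u0_regular_const[OF s, of "{0..s}"]
  define \<sigma> where "\<sigma> r x = y_space_deriv s (heat_u0 s x) * (deriv (deriv f) (y r (heat_u0 s x)) * y_space_deriv r (heat_u0 s x)) * (deriv (heat_u0 s) x)\<^sup>2" for r x
  define q where "q r x = y_space_deriv s (heat_u0 s x) * y_log_deriv r (heat_u0 s x) * (deriv (heat_u0 s) x)\<^sup>2" for r x
  have \<sigma>: "regular {0..s} True k \<sigma>" for k
    unfolding \<sigma>_def[abs_def] power2_eq_square
    by (rule regular_mult[OF regular_mult[OF regular_smooth_comp[OF yas hc]
          regular_comp[OF regular_subset[OF regular_mult[OF regular_fy[OF smooth_deriv[OF smooth_deriv[OF f(1)]]] regular_y_space_deriv] sub] hc]]
          regular_mult[OF regular_deriv[OF hc] regular_deriv[OF hc]]])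
  have q: "regular {0..s} True k q" for k
    unfolding q_def[abs_def] power2_eq_square
    by (rule regular_mult[OF regular_mult[OF regular_smooth_comp[OF yas hc] regular_comp[OF regular_subset[OF regular_y_log_deriv sub] hc]]
          regular_mult[OF regular_deriv[OF hc] regular_deriv[OF hc]]])
  have src: "apply_Cb (splitting_source_YX f u0 s r) = \<sigma> r" if "r \<in> {0..s}" for r
    using apply_to_Cb_regular[OF \<sigma> that] source_YX[OF s that] by (simp add: \<sigma>_def[abs_def])
  have Q: "apply_Cb (to_Cb (q r)) = q r" if "r \<in> {0..s}" for r by (rule apply_to_Cb_regular[OF q that])
  have l: "cont_bdd {0..s} (\<lambda>r. apply_Cb (splitting_source_YX f u0 s r))"
    using regular_cont_bdd[OF \<sigma>] by (subst cont_bdd_cong[where v = \<sigma>]) (auto simp: src)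
  have "((\<lambda>r. apply_Cb (DTflow f \<tau> v (splitting_source_YX f u0 s r)) x) has_integral
      (apply_Cb (DTflow f \<tau> v (to_Cb (q s))) x - apply_Cb (DTflow f \<tau> v (to_Cb (q 0))) x)) {0..s}"
  proof (rule fundamental_theorem_of_calculus)
    fix r assume r: "r \<in> {0..s}"
    have "((\<lambda>r. apply_Cb (DTflow f \<tau> v (to_Cb (q r))) x) has_real_derivative
        apply_Cb (DTflow f \<tau> v (splitting_source_YX f u0 s r)) x) (at r within {0..s})"
    proof (rule DTflow_DERIV[OF f diss \<tau> l _ r])
      fix r x assume r: "r \<in> {0..s}"
      have "((\<lambda>r. q r x) has_real_derivative \<sigma> r x) (at r within {0..s})"
        unfolding q_def \<sigma>_def by (intro DERIV_cmult DERIV_cmult_right y_log_deriv_DERIV_t r)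
      then have "((\<lambda>r. apply_Cb (to_Cb (q r)) x) has_real_derivative \<sigma> r x) (at r within {0..s})"
        by (rule has_field_derivative_transform_within[OF _ zero_less_one r]) (use Q in auto)
      then show "((\<lambda>r. apply_Cb (to_Cb (q r)) x) has_real_derivative apply_Cb (splitting_source_YX f u0 s r) x) (at r within {0..s})"
        by (simp add: src[OF r])
    qed
    then show "((\<lambda>r. apply_Cb (DTflow f \<tau> v (to_Cb (q r))) x) has_vector_derivative
        apply_Cb (DTflow f \<tau> v (splitting_source_YX f u0 s r)) x) (at r within {0..s})"
      by (simp add: has_real_derivative_iff_has_vector_derivative)
  qed (use s in auto)
  moreover have "to_Cb (q 0) = 0"
  proof (rule apply_Cb_eqI)
    have "apply_Cb (to_Cb (q 0)) = q 0" by (rule Q) (use s in simp)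
    then show "apply_Cb (to_Cb (q 0)) x = apply_Cb 0 x" for x by (simp add: q_def y_log_deriv_def zero_Cb.rep_eq)
  qed
  moreover have "to_Cb (q s) = - defect_YX s" by (simp add: defect_YX_def q_def[abs_def] YX_rate_def[abs_def])
  ultimately show ?thesis by (simp add: DT.neg DT.zero uminus_Cb.rep_eq zero_Cb.rep_eq)
qed

end

section \<open>The splitting formulas\<close>

theorem theorem2:
  fixes f :: "real \<Rightarrow> real" and u0 :: Cb and t :: real
  assumes "smooth f" and "f 0 = 0"
    and "\<And>r. \<bar>r\<bar> \<ge> 1 \<Longrightarrow> r * f r \<le> 0"
    and "t \<ge> 0"
  shows
    "(\<forall>x. let G = (\<lambda>s r. DTflow f (t - s) (Xflow s (Yflow f s u0))
                           (Xflow (s - r) (splitting_source_XY f u0 s r)) x) in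
       (\<forall>s\<in>{0..t}. G s integrable_on {0..s}) \<and>
       (\<lambda>s. integral {0..s} (G s)) integrable_on {0..t} \<and>
       Tflow f t u0 x - Xflow t (Yflow f t u0) x
         = - integral {0..t} (\<lambda>s. integral {0..s} (G s)))
     \<and>
     (\<forall>x. let H = (\<lambda>s r. DTflow f (t - s) (Yflow f s (Xflow s u0))
                           (splitting_source_YX f u0 s r) x) in
       (\<forall>s\<in>{0..t}. H s integrable_on {0..s}) \<and>
       (\<lambda>s. integral {0..s} (H s)) integrable_on {0..t} \<and>
       Tflow f t u0 x - Yflow f t (Xflow t u0) x
         = integral {0..t} (\<lambda>s. integral {0..s} (H s)))"
proof -
  note f = assms(1-3) and t = assms(4)
  obtain y where y: "is_ode_flow f y" using ode_flow_exists[OF f] by blast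
  show ?thesis
  proof (intro conjI allI)
    fix x
    have "(\<forall>s\<in>{0..t}. (\<lambda>r. DTflow f (t - s) (Xflow s (Yflow f s u0)) (Xflow (s - r) (splitting_source_XY f u0 s r)) x)
          integrable_on {0..s}) \<and>
        ((\<lambda>s. integral {0..s} (\<lambda>r. DTflow f (t - s) (Xflow s (Yflow f s u0)) (Xflow (s - r) (splitting_source_XY f u0 s r)) x))
          has_integral (Xflow t (Yflow f t u0) x - Tflow f t u0 x)) {0..t}"
      by (rule iterated_integral[OF XY_defect_integral[OF f y t] XY_inner_integral[OF f y]]) auto
    then show "let G = (\<lambda>s r. DTflow f (t - s) (Xflow s (Yflow f s u0))
                           (Xflow (s - r) (splitting_source_XY f u0 s r)) x) in
       (\<forall>s\<in>{0..t}. G s integrable_on {0..s}) \<and>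
       (\<lambda>s. integral {0..s} (G s)) integrable_on {0..t} \<and>
       Tflow f t u0 x - Xflow t (Yflow f t u0) x
         = - integral {0..t} (\<lambda>s. integral {0..s} (G s))"
      by (auto simp: Let_def dest: integral_unique)
    have "((\<lambda>s. - apply_Cb (DTflow f (t - s) (Yflow f s (Xflow s u0)) (defect_YX f y u0 s)) x) has_integral
        - (Yflow f t (Xflow t u0) x - Tflow f t u0 x)) {0..t}"
      by (rule has_integral_neg[OF YX_defect_integral[OF f y t]])
    from iterated_integral[OF this YX_inner_integral[OF f y]]
    have "(\<forall>s\<in>{0..t}. (\<lambda>r. DTflow f (t - s) (Yflow f s (Xflow s u0)) (splitting_source_YX f u0 s r) x)
          integrable_on {0..s}) \<and>
        ((\<lambda>s. integral {0..s} (\<lambda>r. DTflow f (t - s) (Yflow f s (Xflow s u0)) (splitting_source_YX f u0 s r) x))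
          has_integral - (Yflow f t (Xflow t u0) x - Tflow f t u0 x)) {0..t}"
      by auto
    then show "let H = (\<lambda>s r. DTflow f (t - s) (Yflow f s (Xflow s u0))
                           (splitting_source_YX f u0 s r) x) in
       (\<forall>s\<in>{0..t}. H s integrable_on {0..s}) \<and>
       (\<lambda>s. integral {0..s} (H s)) integrable_on {0..t} \<and>
       Tflow f t u0 x - Yflow f t (Xflow t u0) x
         = integral {0..t} (\<lambda>s. integral {0..s} (H s))"
      by (auto simp: Let_def dest: integral_unique)
  qed
qed

end
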